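(* Let $T>0$, let $(\mathscr{L}_t)_{t\in[0,T]}$ be an $\mathbb{R}^d$-valued Lévy process on a filtered probability space $(\Omega,\mathcal{F},(\mathcal{F}_t)_{t\in[0,T]},\mathbb{P})$ with characteristic $\psi:\mathbb{R}^d\to\mathbb{C}$, let $\alpha\in(0,2]$, and let $k:\{(t,s):0\le s\le t\le T\}\to\mathbb{R}$ be a (possibly singular) Volterra kernel with $k(t,\cdot)\in L^\alpha([0,t])$ for every $t\in[0,T]$. Let $z_t=\int_0^t k(t,s)\,\mathrm{d}\mathscr{L}_s$, $t\in[0,T]$, be the associated Volterra-Lévy process, and assume that $z$ is continuous in probability. Suppose that for some $\zeta>0$ $$\inf_{t\in(0,T]}\ \inf_{s\in[0,t)}\ \inf_{\xi\in\mathbb{R}^d\setminus\{0\}}\ \frac{\int_s^t \operatorname{Re}\psi(k(t,r)\xi)\,\mathrm{d}r}{(t-s)^\zeta|\xi|^\alpha}>0 .$$ If $\zeta\in(0,\frac{\alpha}{d})$, then the local time $L:\Omega\times[0,T]\times\mathbb{R}^d\to\mathbb{R}_+$ associated to $z$ exists $\mathbb{P}$-a.s., and for any $\kappa<\frac{\alpha}{2\zeta}-\frac d2$ there exists $\gamma>\frac12$ such that $L\in\mathcal{C}^\gamma([0,T];H^\kappa(\mathbb{R}^d))$, $\mathbb{P}$-a.s.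
   Context: A Lévy process is a càdlàg, $(\mathcal{F}_t)$-adapted process with $\mathscr{L}_0=0$ a.s., with independent and stationary increments (increments after time $s$ independent of $\mathcal{F}_s$), continuous in probability, on a complete filtered probability space satisfying the usual assumptions. Its characteristic $\psi$ is defined by $\mathbb{E}[e^{i\langle\xi,\mathscr{L}_t\rangle}]=e^{-t\psi(\xi)}$. Volterra-Lévy process: for $k$ with $k(t,\cdot)\in L^\alpha([0,t])$ for every $t$, $z_t=\int_0^t k(t,s)\,\mathrm{d}\mathscr{L}_s$ is the stochastic integral of a deterministic function. For step functions $f=\sum_j a_j1_{(s_j,s_{j+1}]}$ it is $\sum_j a_j(\mathscr{L}_{s_{j+1}}-\mathscr{L}_{s_j})$. For $k(t,\cdot)$ it is the limit in $L^p(\Omega)$, for some $p\in(0,\alpha]$, of the integrals of step functions approximating $k(t,\cdot)$ in $L^\alpha([0,t])$; the existence of this limit, independently of the approximating sequence, is part of the definition of a Volterra-Lévy process. The process $z$ is taken to have measurable paths. Continuity in probability: for every $t$ and $\epsilon>0$, $\mathbb{P}(|z_t-z_s|>\epsilon)\to0$ as $s\to t$. Occupation measure and local time: for a measurable path $z:[0,T]\to\mathbb{R}^d$, $\mu_t(A)=\lambda\{s\in[0,t]: z_s\in A\}$ for Borel $A$, with $\lambda$ Lebesgue measure. The local time is a function $L:[0,T]\times\mathbb{R}^d\to\mathbb{R}_+$ with $\mu_t(A)=\int_A L_t(x)\,\mathrm{d}x$ for all $t$ and Borel $A$. $H^\kappa(\mathbb{R}^d)$ is the Sobolev space with norm $\|f\|_{H^\kappa}^2=\int(1+|\xi|^2)^\kappa|\mathscr{F}f(\xi)|^2\,\mathrm{d}\xi$.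 For a Banach space $E$ and $\gamma\in(0,1)$, $\mathcal{C}^\gamma([0,T];E)$ is the space of $\gamma$-Hölder continuous functions $[0,T]\to E$.
   Formalization: The process z is assumed jointly measurable in time and ω, not merely to have measurable paths; with measurable paths alone the claim fails, since a modification of z can vanish at all but countably many times on every path and then has no local time. *)

theory Defs
  imports "HOL-Probability.Probability"
begin

definition in_Lp :: "'s measure \<Rightarrow> real \<Rightarrow> ('s \<Rightarrow> 'v::euclidean_space) \<Rightarrow> bool" where
  "in_Lp M p f \<longleftrightarrow> f \<in> borel_measurable M \<and> (\<integral>\<^sup>+x. ennreal (norm (f x) powr p) \<partial>M) < \<infinity>"

text \<open>The \<open>p\<close>-th power of the \<open>L\<^sup>p\<close> (quasi-)norm is used, so that \<open>0 < p < 1\<close> is covered too.\<close>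

definition Lp_tendsto ::
  "'s measure \<Rightarrow> real \<Rightarrow> (nat \<Rightarrow> 's \<Rightarrow> 'v::euclidean_space) \<Rightarrow> ('s \<Rightarrow> 'v) \<Rightarrow> bool" where
  "Lp_tendsto M p f g \<longleftrightarrow>
     (\<forall>n. in_Lp M p (f n)) \<and> in_Lp M p g \<and>
     (\<lambda>n. \<integral>\<^sup>+x. ennreal (norm (f n x - g x) powr p) \<partial>M) \<longlonglongrightarrow> 0"

definition filtered_prob_space :: "real \<Rightarrow> 'w measure \<Rightarrow> (real \<Rightarrow> 'w measure) \<Rightarrow> bool" where
  "filtered_prob_space T M F \<longleftrightarrow>
     prob_space M \<and> complete_measure M \<and>
     (\<forall>t\<in>{0..T}. subalgebra M (F t)) \<and>
     (\<forall>s\<in>{0..T}. \<forall>t\<in>{s..T}. sets (F s) \<subseteq> sets (F t)) \<and>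
     (\<forall>t\<in>{0..<T}. sets (F t) = (\<Inter>s\<in>{t<..T}. sets (F s))) \<and>
     null_sets M \<subseteq> sets (F 0)"

definition continuous_in_prob ::
  "real \<Rightarrow> 'w measure \<Rightarrow> (real \<Rightarrow> 'w \<Rightarrow> 'v::euclidean_space) \<Rightarrow> bool" where
  "continuous_in_prob T M X \<longleftrightarrow>
     (\<forall>t\<in>{0..T}. \<forall>\<epsilon>>0.
        ((\<lambda>s. measure M {\<omega>\<in>space M. norm (X t \<omega> - X s \<omega>) > \<epsilon>}) \<longlongrightarrow> 0) (at t within {0..T}))"

definition cadlag :: "real \<Rightarrow> (real \<Rightarrow> 'v::euclidean_space) \<Rightarrow> bool" where
  "cadlag T f \<longleftrightarrow>
     (\<forall>t\<in>{0..<T}. (f \<longlongrightarrow> f t) (at_right t)) \<and>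
     (\<forall>t\<in>{0<..T}. \<exists>l. (f \<longlongrightarrow> l) (at_left t))"

definition levy_process ::
  "real \<Rightarrow> 'w measure \<Rightarrow> (real \<Rightarrow> 'w measure) \<Rightarrow> (real \<Rightarrow> 'w \<Rightarrow> 'v::euclidean_space) \<Rightarrow> bool" where
  "levy_process T M F X \<longleftrightarrow>
     filtered_prob_space T M F \<and>
     (\<forall>\<omega>\<in>space M. cadlag T (\<lambda>t. X t \<omega>)) \<and>
     (\<forall>t\<in>{0..T}. X t \<in> borel_measurable (F t)) \<and>
     (AE \<omega> in M. X 0 \<omega> = 0) \<and>
     (\<forall>s\<in>{0..T}. \<forall>t\<in>{s..T}.
        prob_space.indep_set M (sets (F s))
          (sets (vimage_algebra (space M) (\<lambda>\<omega>. X t \<omega> - X s \<omega>) borel))) \<and>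
     (\<forall>s t h. 0 \<le> s \<and> 0 \<le> t \<and> 0 \<le> h \<and> s + h \<le> T \<and> t + h \<le> T \<longrightarrow>
        distr M borel (\<lambda>\<omega>. X (s + h) \<omega> - X s \<omega>) = distr M borel (\<lambda>\<omega>. X (t + h) \<omega> - X t \<omega>)) \<and>
     continuous_in_prob T M X"

definition levy_characteristic ::
  "real \<Rightarrow> 'w measure \<Rightarrow> (real \<Rightarrow> 'w \<Rightarrow> 'v::euclidean_space) \<Rightarrow> ('v \<Rightarrow> complex) \<Rightarrow> bool" where
  "levy_characteristic T M X \<psi> \<longleftrightarrow>
     (\<forall>t\<in>{0..T}. \<forall>\<xi>. (CLINT \<omega>|M. iexp (\<xi> \<bullet> X t \<omega>)) = exp (- (of_real t * \<psi> \<xi>)))"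

text \<open>A step function on \<open>[0,t]\<close> is given by the number \<open>n\<close> of its steps, its values
  \<open>a 0, \<dots>, a (n - 1)\<close> and its nodes \<open>0 \<le> s 0 \<le> \<dots> \<le> s n \<le> t\<close>.\<close>

definition step_nodes :: "real \<Rightarrow> nat \<Rightarrow> (nat \<Rightarrow> real) \<Rightarrow> bool" where
  "step_nodes t n s \<longleftrightarrow> (\<forall>j\<le>n. s j \<in> {0..t}) \<and> (\<forall>j<n. s j \<le> s (Suc j))"

definition step_fun :: "nat \<Rightarrow> (nat \<Rightarrow> real) \<Rightarrow> (nat \<Rightarrow> real) \<Rightarrow> real \<Rightarrow> real" where
  "step_fun n a s r = (\<Sum>j<n. a j * indicator {s j<..s (Suc j)} r)"

definition step_integral ::
  "(real \<Rightarrow> 'w \<Rightarrow> 'v::euclidean_space) \<Rightarrow> nat \<Rightarrow> (nat \<Rightarrow> real) \<Rightarrow> (nat \<Rightarrow> real) \<Rightarrow> 'w \<Rightarrow> 'v" where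
  "step_integral X n a s \<omega> = (\<Sum>j<n. a j *\<^sub>R (X (s (Suc j)) \<omega> - X (s j) \<omega>))"

text \<open>\<open>Y\<close> is the integral \<open>\<integral>\<^sub>0\<^sup>t f(s) dX\<^sub>s\<close>. Since \<open>Y\<close> is the limit along every
  approximating sequence, existence of the limit and its independence of the sequence are
  both part of the condition.\<close>

definition is_levy_integral ::
  "'w measure \<Rightarrow> real \<Rightarrow> (real \<Rightarrow> 'w \<Rightarrow> 'v::euclidean_space) \<Rightarrow> real \<Rightarrow> (real \<Rightarrow> real) \<Rightarrow> ('w \<Rightarrow> 'v) \<Rightarrow> bool"
  where
  "is_levy_integral M \<alpha> X t f Y \<longleftrightarrow>
     (\<exists>p\<in>{0<..\<alpha>}. \<forall>n a s.
        (\<forall>m. step_nodes t (n m) (s m)) \<and>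
        Lp_tendsto (lebesgue_on {0..t}) \<alpha> (\<lambda>m. step_fun (n m) (a m) (s m)) f \<longrightarrow>
        Lp_tendsto M p (\<lambda>m. step_integral X (n m) (a m) (s m)) Y)"

text \<open>The process is required to be measurable jointly in time and \<open>\<omega>\<close>; in particular all
  its paths are measurable. Measurability of the paths alone would not allow Fubini's theorem
  to be applied to functionals of the occupation measure.\<close>

definition volterra_levy_process ::
  "real \<Rightarrow> 'w measure \<Rightarrow> real \<Rightarrow> (real \<Rightarrow> 'w \<Rightarrow> 'v::euclidean_space) \<Rightarrow> (real \<Rightarrow> real \<Rightarrow> real) \<Rightarrow>
   (real \<Rightarrow> 'w \<Rightarrow> 'v) \<Rightarrow> bool" where
  "volterra_levy_process T M \<alpha> X k z \<longleftrightarrow>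
     (\<forall>t\<in>{0..T}. in_Lp (lebesgue_on {0..t}) \<alpha> (k t)) \<and>
     (\<forall>t\<in>{0..T}. is_levy_integral M \<alpha> X t (k t) (z t)) \<and>
     (\<lambda>(t, \<omega>). z t \<omega>) \<in> borel_measurable (lebesgue_on {0..T} \<Otimes>\<^sub>M M)"

definition occupation_measure :: "(real \<Rightarrow> 'v::euclidean_space) \<Rightarrow> real \<Rightarrow> 'v set \<Rightarrow> ennreal" where
  "occupation_measure w t A = emeasure lebesgue {s\<in>{0..t}. w s \<in> A}"

definition is_local_time ::
  "real \<Rightarrow> (real \<Rightarrow> 'v::euclidean_space) \<Rightarrow> (real \<Rightarrow> 'v \<Rightarrow> real) \<Rightarrow> bool" where
  "is_local_time T w l \<longleftrightarrow>
     (\<forall>t\<in>{0..T}. l t \<in> borel_measurable borel \<and> (\<forall>x. 0 \<le> l t x) \<and>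
        (\<forall>A\<in>sets borel. occupation_measure w t A = (\<integral>\<^sup>+x\<in>A. ennreal (l t x) \<partial>lborel)))"

text \<open>Only integrable functions are considered in \<open>H\<^sup>\<kappa>\<close>, so that the Fourier transform is
  given by the integral for every real \<open>\<kappa>\<close>. Nothing is lost for local times, which are
  densities of finite measures. The normalisation of the Fourier transform only changes the
  norm by a constant factor.\<close>

definition fourier :: "('v::euclidean_space \<Rightarrow> real) \<Rightarrow> 'v \<Rightarrow> complex" where
  "fourier f \<xi> = (CLINT x|lborel. iexp (- (\<xi> \<bullet> x)) * of_real (f x))"

definition sobolev_sq :: "real \<Rightarrow> ('v::euclidean_space \<Rightarrow> real) \<Rightarrow> ennreal" where
  "sobolev_sq \<kappa> f =
     (\<integral>\<^sup>+\<xi>. ennreal ((1 + (norm \<xi>)\<^sup>2) powr \<kappa> * (cmod (fourier f \<xi>))\<^sup>2) \<partial>lborel)"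

definition sobolev_space :: "real \<Rightarrow> ('v::euclidean_space \<Rightarrow> real) set" where
  "sobolev_space \<kappa> = {f. integrable lborel f \<and> sobolev_sq \<kappa> f < \<infinity>}"

definition sobolev_norm :: "real \<Rightarrow> ('v::euclidean_space \<Rightarrow> real) \<Rightarrow> real" where
  "sobolev_norm \<kappa> f = sqrt (enn2real (sobolev_sq \<kappa> f))"

definition holder_sobolev ::
  "real \<Rightarrow> real \<Rightarrow> real \<Rightarrow> (real \<Rightarrow> 'v::euclidean_space \<Rightarrow> real) set" where
  "holder_sobolev T \<gamma> \<kappa> =
     {u. (\<forall>t\<in>{0..T}. u t \<in> sobolev_space \<kappa>) \<and>
         (\<exists>C. \<forall>s\<in>{0..T}. \<forall>t\<in>{0..T}.
            sobolev_norm \<kappa> (\<lambda>x. u t x - u s x) \<le> C * \<bar>t - s\<bar> powr \<gamma>)}"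

text \<open>The integral of \<open>Re \<psi>\<close> is taken in \<open>[0,\<infinity>]\<close>: the real part of the characteristic of a
  Levy process is nonnegative, because \<open>exp (- t Re \<psi>(\<xi>))\<close> is the modulus of an
  expectation of unimodular variables.\<close>

definition nondeterminism_const ::
  "real \<Rightarrow> real \<Rightarrow> real \<Rightarrow> ('v::euclidean_space \<Rightarrow> complex) \<Rightarrow> (real \<Rightarrow> real \<Rightarrow> real) \<Rightarrow> ennreal" where
  "nondeterminism_const T \<alpha> \<zeta> \<psi> k =
     (INF t\<in>{0<..T}. INF s\<in>{0..<t}. INF \<xi>\<in>UNIV - {0}.
        (\<integral>\<^sup>+r\<in>{s..t}. ennreal (Re (\<psi> (k t r *\<^sub>R \<xi>))) \<partial>lebesgue)
          / ennreal ((t - s) powr \<zeta> * norm \<xi> powr \<alpha>))"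

end

theory Submission
  imports Defs
begin

text \<open>Write \<open>U s t \<xi>\<close> for the integral of \<open>exp (- i \<xi> \<bullet> z u)\<close> over \<open>u \<in> [s, t]\<close>, the Fourier transform of
  the occupation measure. For \<open>u < v\<close> the part of \<open>z v\<close> coming from the increments of the Levy process
  after time \<open>u\<close> is independent of the past, so the nondeterminism condition gives
  \<open>\<bar>E (H exp (i \<xi> \<bullet> z v))\<bar> \<le> E \<bar>H\<bar> exp (- c (v - u)\<^bsup>\<zeta>\<^esup> \<bar>\<xi>\<bar>\<^bsup>\<alpha>\<^esup>)\<close> for \<open>H\<close> depending on the past of \<open>u\<close>. Writing the
  \<open>2m\<close>-th power of a real time integral \<open>S\<close> as a double integral of \<open>S\<^bsup>2m-2\<^esup> f(u) f(v)\<close>, an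
  induction on \<open>m\<close> shows, for every \<open>\<theta> \<in> (0, 1)\<close>, that \<open>E \<bar>U s t \<xi>\<bar>\<^bsup>2m\<^esup>\<close> is at most a constant times
  \<open>((t - s)\<^bsup>1+\<theta>\<^esup> (1 + \<bar>\<xi>\<bar>\<^sup>2)\<^bsup>-\<beta>/2\<^esup>)\<^bsup>m\<^esup>\<close> with \<open>\<beta> = (1 - \<theta>) \<alpha> / \<zeta>\<close>. If \<open>2 \<kappa> + d < \<beta>\<close>, this is integrable against the
  Sobolev weight, and dyadic chaining as in Kolmogorov's continuity theorem makes \<open>t \<mapsto> U 0 t\<close> almost
  surely Hoelder continuous of every order below \<open>(1 + \<theta>) / 2\<close> in the Fourier image of \<open>H\<^bsup>\<kappa>\<^esup>\<close>.
  The case \<open>\<kappa> = 0\<close>, available since \<open>\<zeta> < \<alpha> / d\<close>, makes the Fourier transform of the occupation measure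
  square integrable, which forces it to have a density: the local time.\<close>

section \<open>Analytic preliminaries\<close>

text \<open>The parameter \<theta> splits the decay exp (- c x^\<zeta> |\<xi>|^\<alpha>), with x = v
  - u, into a singularity x^(\<theta>-1) in time and a negative power of |\<xi>|. Any \<theta> > 0
  keeps the singularity integrable and provides the excess of (1 + \<theta>) / 2 over 1/2; letting
  \<theta> tend to 0 exhausts all \<beta> below \<alpha> / \<zeta>, which is the range of \<kappa>.
  Second moments are not enough: level n of the chaining has 2^n intervals, and this factor is
  absorbed only if m (1 + \<theta> - 2 \<gamma>) > 1, so arbitrarily high moments are needed. They
  are even because decorrelation compares with E |H|, and for H containing an even power of S this
  is again bounded by a moment of S. A further obstacle is measurability: z arises from limits of
  step integrals, so a single z u is identified with a variable of the past only up to a null set,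
  and nothing comparable is at hand for the time integral S. This forces the detour through Fubini
  when the independent factor is split off.\<close>

lemma AE_neq_atomless:
  fixes N :: "real measure"
  assumes [measurable]: "(\<lambda>x. x) \<in> borel_measurable N" and atom: "emeasure N ({a} \<inter> space N) = 0"
  shows "AE x in N. x \<noteq> a"
proof -
  have "{a} \<inter> space N = {x\<in>space N. x = a}" by auto
  moreover have "{x\<in>space N. x = a} \<in> sets N" by measurable
  ultimately have "{a} \<inter> space N \<in> null_sets N" using atom by (intro null_setsI) auto
  then show ?thesis by (rule AE_I') auto
qed

text \<open>For a continuous primitive of bounded variation this is d(S^(n+1)) = (n+1) S^n dS. As
  \<open>\<phi>\<close> is merely integrable, the formula is obtained from Fubini by induction on
  the power instead of differentiation. Atoms would add a contribution of the diagonal.\<close>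

lemma power_primitive:
  fixes \<phi> :: "real \<Rightarrow> real" and N :: "real measure"
  assumes sf: "sigma_finite_measure N" and id: "(\<lambda>x. x) \<in> borel_measurable N"
    and atom: "\<And>x. emeasure N ({x} \<inter> space N) = 0" and int: "integrable N \<phi>"
  defines "S \<equiv> \<lambda>r. \<integral>u. indicator {..r} u * \<phi> u \<partial>N"
  shows "S \<in> borel_measurable N"
    and "S t ^ Suc n = Suc n * (\<integral>r. indicator {..t} r * \<phi> r * S r ^ n \<partial>N)"
proof -
  interpret sigma_finite_measure N by fact
  interpret NN: pair_sigma_finite N N by standard
  note [measurable] = id
  have [measurable]: "\<phi> \<in> borel_measurable N" using int by auto
  define B where "B = (\<integral>u. \<bar>\<phi> u\<bar> \<partial>N)"
  have meas_le[measurable]: "Measurable.pred (N \<Otimes>\<^sub>M N) (\<lambda>(r, u). u \<le> r)"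
    by measurable
  have sets_atMost[measurable, simp]: "{..r} \<inter> space N \<in> sets N" for r
  proof -
    have "{u\<in>space N. u \<le> r} \<in> sets N" by measurable
    also have "{u\<in>space N. u \<le> r} = {..r} \<inter> space N" by auto
    finally show ?thesis .
  qed
  have ind_int: "integrable N (\<lambda>u. indicator {..r} u * f u)" if "integrable N f" for r and f :: "real \<Rightarrow> real"
  proof (rule Bochner_Integration.integrable_bound[OF that])
    show "(\<lambda>u. indicator {..r} u * f u) \<in> borel_measurable N"
      using that by (intro borel_measurable_times) (auto simp: borel_measurable_indicator_iff)
  qed (auto simp: indicator_def)
  have Smeas[measurable]: "S \<in> borel_measurable N"
    unfolding S_def atMost_def indicator_def by measurable
  then show "S \<in> borel_measurable N" .
  have SB: "\<bar>S r\<bar> \<le> B" for r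
  proof -
    have "\<bar>S r\<bar> \<le> (\<integral>u. \<bar>indicator {..r} u * \<phi> u\<bar> \<partial>N)"
      unfolding S_def by (rule integral_abs_bound)
    also have "\<dots> \<le> B" unfolding B_def
      using ind_int[OF int] int
      by (intro integral_mono) (auto simp: indicator_def intro!: integrable_abs)
    finally show ?thesis .
  qed
  have intS: "integrable N (\<lambda>u. \<phi> u * S u ^ n)" for n
  proof (rule Bochner_Integration.integrable_bound)
    show "integrable N (\<lambda>u. B ^ n * \<phi> u)" using int by simp
    show "AE u in N. norm (\<phi> u * S u ^ n) \<le> norm (B ^ n * \<phi> u)"
    proof (intro AE_I2)
      fix u
      have "\<bar>S u\<bar> ^ n \<le> B ^ n" using SB by (intro power_mono) auto
      then show "norm (\<phi> u * S u ^ n) \<le> norm (B ^ n * \<phi> u)"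
        using mult_right_mono[of "\<bar>S u\<bar> ^ n" "B ^ n" "\<bar>\<phi> u\<bar>"]
        by (simp add: abs_mult power_abs mult.commute B_def)
    qed
  qed measurable
  have "S t ^ Suc n = Suc n * (\<integral>r. indicator {..t} r * (\<phi> r * S r ^ n) \<partial>N)" for t
  proof (induction n arbitrary: t)
    case 0
    show ?case by (simp add: S_def)
  next
    case (Suc n)
    define J where "J = (\<integral>r. indicator {..t} r * (\<phi> r * S r ^ Suc n) \<partial>N)"
    define g where "g = (\<lambda>r u. indicator {..t} r * \<phi> r * (indicator {..r} u * (\<phi> u * S u ^ n)))"
    have gint: "integrable (N \<Otimes>\<^sub>M N) (\<lambda>(r, u). g r u)"
    proof (rule Bochner_Integration.integrable_bound)
      show "integrable (N \<Otimes>\<^sub>M N) (\<lambda>(r, u). \<phi> r * (\<phi> u * S u ^ n))"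
      proof (rule NN.Fubini_integrable)
        show "integrable N (\<lambda>r. \<integral>u. norm (case (r, u) of (r, u) \<Rightarrow> \<phi> r * (\<phi> u * S u ^ n)) \<partial>N)"
          using int by (simp add: abs_mult)
        show "AE r in N. integrable N (\<lambda>u. case (r, u) of (r, u) \<Rightarrow> \<phi> r * (\<phi> u * S u ^ n))"
          using intS by auto
      qed measurable
      show "(\<lambda>(r, u). g r u) \<in> borel_measurable (N \<Otimes>\<^sub>M N)"
        unfolding g_def atMost_def indicator_def by measurable
      show "AE x in N \<Otimes>\<^sub>M N. norm (case x of (r, u) \<Rightarrow> g r u)
              \<le> norm (case x of (r, u) \<Rightarrow> \<phi> r * (\<phi> u * S u ^ n))"
        by (auto simp: g_def indicator_def)
    qed
    \<comment> \<open>Inserting the induction hypothesis for \<open>S r ^ Suc n\<close> and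
      exchanging the integrals reproduces \<open>J\<close> on the right with factor
      \<open>- Suc n\<close>, because the inner integral becomes \<open>S t - S u\<close>. Solving
      this linear equation for \<open>J\<close> is the whole induction step.\<close>
    have "J = (\<integral>r. indicator {..t} r * \<phi> r * (Suc n * (\<integral>u. indicator {..r} u * (\<phi> u * S u ^ n) \<partial>N)) \<partial>N)"
      unfolding J_def using Suc.IH by (simp add: mult.assoc)
    also have "\<dots> = Suc n * (\<integral>r. (\<integral>u. g r u \<partial>N) \<partial>N)"
    proof -
      have "indicator {..t} r * \<phi> r * (Suc n * (\<integral>u. indicator {..r} u * (\<phi> u * S u ^ n) \<partial>N))
          = Suc n * (\<integral>u. g r u \<partial>N)" for r
      proof -
        have "(\<integral>u. g r u \<partial>N) = indicator {..t} r * \<phi> r * (\<integral>u. indicator {..r} u * (\<phi> u * S u ^ n) \<partial>N)"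
          unfolding g_def by (rule integral_mult_right_zero)
        then show ?thesis by simp
      qed
      then show ?thesis by (simp only: integral_mult_right_zero)
    qed
    also have "(\<integral>r. (\<integral>u. g r u \<partial>N) \<partial>N) = (\<integral>u. (\<integral>r. g r u \<partial>N) \<partial>N)"
      using NN.Fubini_integral[OF gint] by simp
    also have "\<dots> = (\<integral>u. indicator {..t} u * (\<phi> u * S u ^ n) * (S t - S u) \<partial>N)"
    proof (rule Bochner_Integration.integral_cong[OF refl])
      fix u
      show "(\<integral>r. g r u \<partial>N) = indicator {..t} u * (\<phi> u * S u ^ n) * (S t - S u)"
      proof (cases "u \<le> t")
        case True
        have "(\<integral>r. g r u \<partial>N) = (\<phi> u * S u ^ n) * (\<integral>r. indicator {u..t} r * \<phi> r \<partial>N)"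
          unfolding integral_mult_right_zero[symmetric] g_def
          by (rule Bochner_Integration.integral_cong[OF refl]) (auto simp: indicator_def)
        also have "(\<integral>r. indicator {u..t} r * \<phi> r \<partial>N)
            = (\<integral>r. indicator {..t} r * \<phi> r - indicator {..u} r * \<phi> r \<partial>N)"
        proof (rule integral_cong_AE)
          \<comment> \<open>The indicator of \<open>{u..t}\<close> and the difference of the
            indicators of \<open>{..t}\<close> and \<open>{..u}\<close> disagree at \<open>u\<close>
            only; this is where the absence of atoms enters.\<close>
          have "AE r in N. r \<noteq> u" using id atom by (rule AE_neq_atomless)
          then show "AE r in N. indicator {u..t} r * \<phi> r = indicator {..t} r * \<phi> r - indicator {..u} r * \<phi> r"
            by eventually_elim (use True in \<open>auto simp: indicator_def\<close>)
        qed (unfold atMost_def atLeastAtMost_def atLeast_def indicator_def, measurable)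
        also have "\<dots> = S t - S u"
          unfolding S_def by (intro Bochner_Integration.integral_diff ind_int int)
        finally show ?thesis using True by simp
      next
        case False
        then have "g r u = 0" for r by (auto simp: g_def indicator_def)
        then show ?thesis using False by simp
      qed
    qed
    also have "\<dots> = (\<integral>u. S t * (indicator {..t} u * (\<phi> u * S u ^ n)) - indicator {..t} u * (\<phi> u * S u ^ Suc n) \<partial>N)"
      by (rule Bochner_Integration.integral_cong[OF refl]) (auto simp: algebra_simps)
    also have "\<dots> = S t * (\<integral>u. (indicator {..t} u * (\<phi> u * S u ^ n)) \<partial>N) - J"
      unfolding J_def by (subst Bochner_Integration.integral_diff) (auto intro!: ind_int intS simp del: power_Suc)
    finally have "J = Suc n * (S t * (\<integral>u. (indicator {..t} u * (\<phi> u * S u ^ n)) \<partial>N)) - Suc n * J"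
      by (simp add: algebra_simps)
    then have "Suc (Suc n) * J = S t * (Suc n * (\<integral>u. (indicator {..t} u * (\<phi> u * S u ^ n)) \<partial>N))"
      by (simp add: algebra_simps)
    also have "\<dots> = S t ^ Suc (Suc n)" using Suc.IH[of t] by simp
    finally show ?case by (simp add: J_def)
  qed
  then show "S t ^ Suc n = Suc n * (\<integral>r. indicator {..t} r * \<phi> r * S r ^ n \<partial>N)"
    by (simp add: mult.assoc)
qed

text \<open>A replacement for Jensen's inequality: Bernoulli gives \<open>m a\<^sup>m\<^sup>-\<^sup>1 q \<le> q\<^sup>m + (m - 1) a\<^sup>m\<close> pointwise,
  which is then integrated against \<open>\<rho>\<close>.\<close>

lemma bernoulli_nn_integral:
  fixes \<rho> q :: "'a \<Rightarrow> real"
  assumes [measurable]: "\<rho> \<in> borel_measurable M" "q \<in> borel_measurable M"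
    and nn: "\<And>x. 0 \<le> \<rho> x" "\<And>x. 0 \<le> q x" and "0 < a" "0 < m"
    and R: "(\<integral>\<^sup>+x. ennreal (\<rho> x) \<partial>M) \<le> ennreal R" "0 \<le> R"
    and le: "(\<integral>\<^sup>+x. ennreal (\<rho> x * q x ^ m) \<partial>M) \<le> ennreal (a ^ m * R)"
  shows "(\<integral>\<^sup>+x. ennreal (\<rho> x * q x) \<partial>M) \<le> ennreal (a * R)"
proof -
  have pw: "real m * a ^ (m - 1) * q x \<le> q x ^ m + (real m - 1) * a ^ m" for x
  proof -
    have "1 + real m * (q x / a - 1) \<le> (1 + (q x / a - 1)) ^ m"
      using nn(2)[of x] \<open>0 < a\<close> by (intro Bernoulli_inequality) simp
    then have "a ^ m * (1 + real m * (q x / a - 1)) \<le> a ^ m * (q x / a) ^ m"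
      using \<open>0 < a\<close> by (intro mult_left_mono) auto
    moreover have "a ^ m * (q x / a) ^ m = q x ^ m" using \<open>0 < a\<close> by (simp add: power_divide)
    moreover have "a ^ m * (1 + real m * (q x / a - 1)) = real m * a ^ (m - 1) * q x - (real m - 1) * a ^ m"
      using \<open>0 < a\<close> \<open>0 < m\<close> by (cases m) (auto simp: field_simps)
    ultimately show ?thesis by simp
  qed
  define c where "c = real m * a ^ (m - 1)"
  have c: "0 < c" using \<open>0 < a\<close> \<open>0 < m\<close> by (simp add: c_def)
  have "ennreal c * (\<integral>\<^sup>+x. ennreal (\<rho> x * q x) \<partial>M) = (\<integral>\<^sup>+x. ennreal (\<rho> x * (c * q x)) \<partial>M)"
    using c nn by (subst nn_integral_cmult[symmetric]) (auto simp: ennreal_mult' mult_ac)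
  also have "\<dots> \<le> (\<integral>\<^sup>+x. ennreal (\<rho> x * q x ^ m) + ennreal ((real m - 1) * a ^ m) * ennreal (\<rho> x) \<partial>M)"
  proof (rule nn_integral_mono)
    fix x
    have "0 \<le> (real m - 1) * a ^ m" using \<open>0 < m\<close> \<open>0 < a\<close> by (intro mult_nonneg_nonneg) auto
    then have eq: "ennreal (\<rho> x * q x ^ m) + ennreal ((real m - 1) * a ^ m) * ennreal (\<rho> x)
       = ennreal (\<rho> x * q x ^ m + (real m - 1) * a ^ m * \<rho> x)"
      using nn by (simp add: ennreal_plus ennreal_mult del: ennreal_plus[symmetric])
    have "\<rho> x * (c * q x) \<le> \<rho> x * (q x ^ m + (real m - 1) * a ^ m)"
      unfolding c_def using pw nn by (intro mult_left_mono)
    then show "ennreal (\<rho> x * (c * q x)) \<le> ennreal (\<rho> x * q x ^ m) + ennreal ((real m - 1) * a ^ m) * ennreal (\<rho> x)"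
      unfolding eq by (intro ennreal_leI) (simp add: algebra_simps)
  qed
  also have "\<dots> = (\<integral>\<^sup>+x. ennreal (\<rho> x * q x ^ m) \<partial>M) + ennreal ((real m - 1) * a ^ m) * (\<integral>\<^sup>+x. ennreal (\<rho> x) \<partial>M)"
    by (subst nn_integral_add) (auto simp: nn_integral_cmult)
  also have "\<dots> \<le> ennreal (a ^ m * R) + ennreal ((real m - 1) * a ^ m) * ennreal R"
    using le R by (intro add_mono mult_left_mono) auto
  also have "\<dots> = ennreal (c * (a * R))"
    using R \<open>0 < a\<close> \<open>0 < m\<close>
    by (cases m) (auto simp: c_def ennreal_mult[symmetric] ennreal_plus[symmetric] algebra_simps simp del: ennreal_plus)
  also have "\<dots> = ennreal c * ennreal (a * R)"
    using c R \<open>0 < a\<close> by (intro ennreal_mult) auto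
  finally show ?thesis
    using c by (subst (asm) ennreal_mult_le_mult_iff) auto
qed

text \<open>If j is least with |\<xi>| < 2^j, the integrand is at most \<open>C\<close> 2^(-2
  \<delta> j), and the ball of radius 2^j has volume of order 2^(d j): a geometric series of ratio
  2^(d - 2 \<delta>). Summing over full balls instead of shells avoids disjointness at no cost. The
  constant \<open>C\<close> pays for the step from |\<xi>| >= 2^(j-1) to 2^j and covers j =
  0.\<close>

lemma nn_integral_bessel_finite:
  fixes \<delta> :: real
  assumes "real DIM('a::euclidean_space) < 2 * \<delta>"
  shows "(\<integral>\<^sup>+\<xi>. ennreal ((1 + (norm \<xi>)\<^sup>2) powr (- \<delta>)) \<partial>(lborel :: 'a measure)) < \<infinity>"
proof -
  define C where "C = 2 powr (2 * \<delta>)"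
  let ?c = "\<lambda>j::nat. ennreal (C * 2 powr (- 2 * \<delta> * real j))"
  define r where "r = 2 powr (real DIM('a) - 2 * \<delta>)"
  have r: "0 < r" "r < 1" using assms by (auto simp: r_def powr_less_one)
  have \<delta>: "0 < \<delta>" using assms by (smt (verit) of_nat_0_le_iff)
  have pw: "ennreal ((1 + (norm \<xi>)\<^sup>2) powr (- \<delta>)) \<le>
      (\<Sum>j. ?c j * indicator (ball 0 (2 ^ j)) \<xi>)" for \<xi> :: 'a
  proof -
    have ex: "\<exists>j. norm \<xi> < 2 ^ j" by (simp add: real_arch_pow)
    define j where "j = (LEAST j. norm \<xi> < 2 ^ j)"
    have j: "norm \<xi> < 2 ^ j" unfolding j_def by (rule LeastI_ex[OF ex])
    have "(1 + (norm \<xi>)\<^sup>2) powr (- \<delta>) \<le> C * 2 powr (- 2 * \<delta> * real j)"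
    proof (cases j)
      case 0
      have "(1 + (norm \<xi>)\<^sup>2) powr (- \<delta>) \<le> 1 powr (-\<delta>)"
        using \<delta> by (intro powr_mono2') auto
      also have "\<dots> \<le> C" using \<delta> by (simp add: C_def ge_one_powr_ge_zero)
      finally show ?thesis using 0 by simp
    next
      case (Suc i)
      have "\<not> norm \<xi> < 2 ^ i" using not_less_Least[of i "\<lambda>j. norm \<xi> < 2 ^ j"] Suc by (simp add: j_def)
      then have "(2 ^ i)\<^sup>2 \<le> (norm \<xi>)\<^sup>2" by (intro power_mono) auto
      then have "(1 + (norm \<xi>)\<^sup>2) powr (- \<delta>) \<le> ((2 ^ i)\<^sup>2) powr (-\<delta>)"
        using \<delta> by (intro powr_mono2') (auto intro: add_increasing)
      also have "((2::real) ^ i)\<^sup>2 = 2 powr (2 * real i)"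
        by (metis (no_types) mult.commute of_nat_mult of_nat_numeral power_mult powr_realpow zero_less_numeral)
      also have "(2 powr (2 * real i)) powr (-\<delta>) = C * 2 powr (- 2 * \<delta> * real j)"
        by (simp add: C_def powr_powr powr_add[symmetric] Suc algebra_simps)
      finally show ?thesis .
    qed
    then have "ennreal ((1 + (norm \<xi>)\<^sup>2) powr (- \<delta>))
        \<le> ?c j * indicator (ball 0 (2 ^ j)) \<xi>"
      using j by (auto intro: ennreal_leI)
    also have "\<dots> \<le> (\<Sum>j. ?c j * indicator (ball 0 (2 ^ j)) \<xi>)"
    proof -
      define f :: "nat \<Rightarrow> ennreal"
        where "f = (\<lambda>j. ?c j * indicator (ball 0 (2 ^ j)) \<xi>)"
      have "sum f {j} \<le> suminf f" by (intro sum_le_suminf) auto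
      then have "f j \<le> suminf f" by simp
      then show ?thesis by (simp only: f_def)
    qed
    finally show ?thesis .
  qed
  have "(\<integral>\<^sup>+\<xi>. ennreal ((1 + (norm \<xi>)\<^sup>2) powr (- \<delta>)) \<partial>(lborel :: 'a measure))
     \<le> (\<integral>\<^sup>+\<xi>. (\<Sum>j. ?c j * indicator (ball 0 (2 ^ j)) \<xi>) \<partial>(lborel :: 'a measure))"
    by (rule nn_integral_mono) (rule pw)
  also have "\<dots> = (\<Sum>j. \<integral>\<^sup>+\<xi>. ?c j * indicator (ball 0 (2 ^ j)) \<xi> \<partial>(lborel :: 'a measure))"
  proof (rule nn_integral_suminf)
    fix j
    have "ball (0::'a) (2 ^ j) \<in> sets lborel" by simp
    then show "(\<lambda>\<xi>::'a. ?c j * indicator (ball 0 (2 ^ j)) \<xi>) \<in> borel_measurable lborel"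
      by (intro borel_measurable_times_ennreal borel_measurable_const borel_measurable_indicator)
  qed
  also have "\<dots> = (\<Sum>j. ennreal (C * unit_ball_vol (real DIM('a)) * r ^ j))"
  proof (rule suminf_cong)
    fix j
    have "(\<integral>\<^sup>+\<xi>. ?c j * indicator (ball 0 (2 ^ j)) \<xi> \<partial>(lborel :: 'a measure))
        = ?c j * ennreal (unit_ball_vol (real DIM('a)) * (2 ^ j) ^ DIM('a))"
      by (simp add: nn_integral_cmult_indicator emeasure_ball)
    also have "\<dots> = ennreal (C * 2 powr (- 2 * \<delta> * real j) * (unit_ball_vol (real DIM('a)) * (2 ^ j) ^ DIM('a)))"
      by (rule ennreal_mult[symmetric]) (auto simp: C_def)
    also have "C * 2 powr (- 2 * \<delta> * real j) * (unit_ball_vol (real DIM('a)) * (2 ^ j) ^ DIM('a))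
        = C * unit_ball_vol (real DIM('a)) * r ^ j"
    proof -
      have "((2::real) ^ j) ^ DIM('a) = 2 powr (real DIM('a) * real j)"
        by (metis (no_types) mult.commute of_nat_mult power_mult powr_realpow zero_less_numeral)
      moreover have "r ^ j = 2 powr ((real DIM('a) - 2 * \<delta>) * real j)"
        by (metis powr_powr powr_realpow r(1) r_def)
      ultimately show ?thesis by (simp add: powr_add[symmetric] algebra_simps)
    qed
    finally show "(\<integral>\<^sup>+\<xi>. ?c j * indicator (ball 0 (2 ^ j)) \<xi> \<partial>(lborel :: 'a measure))
       = ennreal (C * unit_ball_vol (real DIM('a)) * r ^ j)" .
  qed
  also have "\<dots> < \<infinity>"
  proof -
    have s: "summable (\<lambda>j. C * unit_ball_vol (real DIM('a)) * r ^ j)"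
      using r by (intro summable_mult summable_geometric) auto
    have "(\<Sum>j. ennreal (C * unit_ball_vol (real DIM('a)) * r ^ j)) \<noteq> \<top>"
    proof (rule ennreal_suminf_neq_top[OF s])
      show "0 \<le> C * unit_ball_vol (real DIM('a)) * r ^ i" for i using r by (simp add: C_def)
    qed
    then show ?thesis by (simp add: less_top)
  qed
  finally show ?thesis .
qed

section \<open>Measures with square integrable Fourier transform\<close>

text \<open>The centred Gaussian density with standard deviation \<open>R\<close> in each direction.
  The product form reduces its Fourier transform to dimension one.\<close>

definition gauss_kernel :: "real \<Rightarrow> 'a::euclidean_space \<Rightarrow> real" where
  "gauss_kernel R \<xi> = (\<Prod>b\<in>Basis. normal_density 0 R (\<xi> \<bullet> b))"

lemma gauss_kernel_measurable[measurable]: "gauss_kernel R \<in> borel_measurable borel"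
  unfolding gauss_kernel_def[abs_def] by measurable

lemma gauss_kernel_nonneg: "0 \<le> gauss_kernel R \<xi>"
  unfolding gauss_kernel_def by (intro prod_nonneg) (simp add: normal_density_nonneg)

lemma gauss_kernel_le:
  assumes "0 < R"
  shows "gauss_kernel R (\<xi>::'a::euclidean_space) \<le> (1 / R) ^ DIM('a)"
proof -
  have "normal_density 0 R x \<le> 1 / R" for x
  proof -
    have "R = sqrt (R\<^sup>2)" using assms by simp
    also have "\<dots> \<le> sqrt (2 * pi * R\<^sup>2)"
      using pi_gt3 by (intro real_sqrt_le_mono) (simp add: mult_le_cancel_right1)
    finally have "1 / sqrt (2 * pi * R\<^sup>2) \<le> 1 / R"
      using assms by (intro divide_left_mono) auto
    moreover have "exp (-(x - 0)\<^sup>2/ (2 * R\<^sup>2)) \<le> 1" by simp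
    ultimately have "1 / sqrt (2 * pi * R\<^sup>2) * exp (-(x - 0)\<^sup>2/ (2 * R\<^sup>2)) \<le> 1 / R * 1"
      using assms by (intro mult_mono) auto
    then show ?thesis by (simp add: normal_density_def)
  qed
  then have "gauss_kernel R \<xi> \<le> (\<Prod>b\<in>(Basis::'a set). 1 / R)"
    unfolding gauss_kernel_def by (intro prod_mono) (simp add: normal_density_nonneg)
  then show ?thesis by simp
qed

text \<open>The substitution x = R y leads back to the standard normal law and its known
  characteristic function.\<close>

lemma normal_char_1d:
  assumes "0 < R"
  shows "(CLINT x|lborel. complex_of_real (normal_density 0 R x) * iexp (x * t))
    = complex_of_real (exp (- (R\<^sup>2 * t\<^sup>2) / 2))"
    and "integrable lborel (\<lambda>x. complex_of_real (normal_density 0 R x) * iexp (x * t))"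
proof -
  show "integrable lborel (\<lambda>x. complex_of_real (normal_density 0 R x) * iexp (x * t))"
    by (rule Bochner_Integration.integrable_bound[of _ "normal_density 0 R"])
       (use assms in \<open>auto simp: norm_mult\<close>)
  have "(CLINT x|lborel. complex_of_real (normal_density 0 R x) * iexp (x * t))
      = \<bar>R\<bar> *\<^sub>R (CLINT x|lborel. complex_of_real (normal_density 0 R (0 + R * x)) * iexp ((0 + R * x) * t))"
    using assms by (intro lborel_integral_real_affine) auto
  also have "\<dots> = (CLINT x|lborel. \<bar>R\<bar> *\<^sub>R (complex_of_real (normal_density 0 R (0 + R * x)) * iexp ((0 + R * x) * t)))"
    by simp
  also have "\<dots> = (CLINT x|lborel. std_normal_density x *\<^sub>R iexp (R * t * x))"
  proof (rule Bochner_Integration.integral_cong[OF refl])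
    fix x :: real
    have "R * normal_density 0 R (R * x) = std_normal_density x"
      using assms by (simp add: normal_density_def real_sqrt_mult power_mult_distrib)
    then have "complex_of_real R * complex_of_real (normal_density 0 R (R * x)) = complex_of_real (std_normal_density x)"
      by (metis of_real_mult)
    then show "\<bar>R\<bar> *\<^sub>R (complex_of_real (normal_density 0 R (0 + R * x)) * iexp ((0 + R * x) * t)) =
         std_normal_density x *\<^sub>R iexp (R * t * x)"
      using assms by (simp add: scaleR_conv_of_real mult.assoc[symmetric]) (simp add: mult_ac)
  qed
  also have "\<dots> = char std_normal_distribution (R * t)"
    unfolding char_def by (subst integral_density) (auto simp: normal_density_nonneg)
  also have "\<dots> = complex_of_real (exp (- (R\<^sup>2 * t\<^sup>2) / 2))"
    by (simp add: char_std_normal_distribution power_mult_distrib)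
  finally show "(CLINT x|lborel. complex_of_real (normal_density 0 R x) * iexp (x * t))
    = complex_of_real (exp (- (R\<^sup>2 * t\<^sup>2) / 2))" .
qed

lemma iexp_inner_prod:
  fixes \<xi> x :: "'a::euclidean_space"
  shows "iexp (\<xi> \<bullet> x) = (\<Prod>b\<in>Basis. iexp ((\<xi> \<bullet> b) * (x \<bullet> b)))"
  by (subst euclidean_inner) (simp add: exp_sum sum_distrib_left)

text \<open>Lebesgue measure is the image of the product measure indexed by \<open>Basis\<close>, so
  the integral factors over the coordinates; the squared coordinates of \<open>x\<close> in the
  exponents then add up to its squared norm.\<close>

lemma gauss_kernel_integral:
  fixes x :: "'a::euclidean_space"
  assumes "0 < R"
  shows "(CLINT \<xi>|lborel. complex_of_real (gauss_kernel R \<xi>) * iexp (\<xi> \<bullet> x))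
      = complex_of_real (exp (- (R\<^sup>2 * (norm x)\<^sup>2) / 2))"
    and "integrable lborel (gauss_kernel R :: 'a \<Rightarrow> real)"
proof -
  interpret product_sigma_finite "\<lambda>_::'a. lborel :: real measure" by standard
  have comp: "(\<Sum>b\<in>Basis. f b *\<^sub>R b) \<bullet> c = f c" if "c \<in> Basis" for f and c :: 'a
    using that by simp
  have "(CLINT \<xi>|lborel. complex_of_real (gauss_kernel R \<xi>) * iexp (\<xi> \<bullet> x))
     = (CLINT \<xi>|distr (\<Pi>\<^sub>M b\<in>Basis. lborel) borel (\<lambda>f. \<Sum>b\<in>Basis. f b *\<^sub>R b).
           complex_of_real (gauss_kernel R \<xi>) * iexp (\<xi> \<bullet> x))"
    by (subst (1) lborel_eq) (rule refl)
  also have "\<dots> = (CLINT f|(\<Pi>\<^sub>M b\<in>(Basis::'a set). lborel).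
        (\<Prod>b\<in>Basis. complex_of_real (normal_density 0 R (f b)) * iexp (f b * (x \<bullet> b))))"
    by (subst integral_distr)
       (auto simp: gauss_kernel_def iexp_inner_prod[of _ x] prod.distrib[symmetric] comp
          intro!: Bochner_Integration.integral_cong prod.cong)
  also have "\<dots> = (\<Prod>b\<in>(Basis::'a set). CLINT y|lborel. complex_of_real (normal_density 0 R y) * iexp (y * (x \<bullet> b)))"
    by (rule product_integral_prod) (use normal_char_1d(2)[OF assms] in simp_all)
  also have "\<dots> = complex_of_real (exp (- (R\<^sup>2 * (norm x)\<^sup>2) / 2))"
  proof -
    have "(\<Prod>b\<in>(Basis::'a set). complex_of_real (exp (- (R\<^sup>2 * (x \<bullet> b)\<^sup>2) / 2)))
        = complex_of_real (exp (\<Sum>b\<in>(Basis::'a set). - (R\<^sup>2 * (x \<bullet> b)\<^sup>2) / 2))"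
      by (subst exp_sum) auto
    also have "(\<Sum>b\<in>(Basis::'a set). - (R\<^sup>2 * (x \<bullet> b)\<^sup>2) / 2) = - (R\<^sup>2 * (\<Sum>b\<in>(Basis::'a set). (x \<bullet> b)\<^sup>2)) / 2"
      by (simp add: sum_distrib_left sum_negf sum_divide_distrib)
    also have "(\<Sum>b\<in>(Basis::'a set). (x \<bullet> b)\<^sup>2) = (norm x)\<^sup>2"
      by (subst power2_norm_eq_inner, subst (2) euclidean_inner) (simp add: power2_eq_square)
    finally show ?thesis unfolding normal_char_1d(1)[OF assms] .
  qed
  finally show "(CLINT \<xi>|lborel. complex_of_real (gauss_kernel R \<xi>) * iexp (\<xi> \<bullet> x))
      = complex_of_real (exp (- (R\<^sup>2 * (norm x)\<^sup>2) / 2))" .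
  have "integrable (distr (\<Pi>\<^sub>M b\<in>(Basis::'a set). lborel) borel (\<lambda>f. \<Sum>b\<in>Basis. f b *\<^sub>R b)) (gauss_kernel R)"
    using product_integrable_prod[of Basis "\<lambda>_. normal_density 0 R"] assms
    by (subst integrable_distr_eq) (auto simp: gauss_kernel_def comp cong: prod.cong)
  then show "integrable lborel (gauss_kernel R :: 'a \<Rightarrow> real)"
    by (subst lborel_eq)
qed

text \<open>Integrating \<open>\<bar>FT \<mu>\<bar>\<^sup>2\<close> against the Gaussian density of standard deviation \<open>1 / \<epsilon>\<close> gives the energy of
  \<open>\<mu>\<close> for the kernel \<open>exp (- dist\<^sup>2 / (2 \<epsilon>\<^sup>2))\<close>; the density itself is at most \<open>\<epsilon>\<^sup>d\<close>.\<close>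

lemma pair_measure_near_diagonal:
  fixes \<mu> :: "'a::euclidean_space measure"
  assumes fin: "finite_measure \<mu>" and sets[measurable_cong]: "sets \<mu> = sets borel" and "0 < \<epsilon>"
    and L2: "(\<integral>\<^sup>+\<xi>. ennreal ((cmod (CLINT x|\<mu>. iexp (- (\<xi> \<bullet> x))))\<^sup>2) \<partial>lborel) \<le> ennreal \<Lambda>" "0 \<le> \<Lambda>"
  shows "emeasure (\<mu> \<Otimes>\<^sub>M \<mu>) {p\<in>space (\<mu> \<Otimes>\<^sub>M \<mu>). dist (fst p) (snd p) < 2 * \<epsilon>} \<le> ennreal (exp 2 * \<Lambda> * \<epsilon> ^ DIM('a))"
proof -
  interpret finite_measure \<mu> by fact
  interpret P: finite_measure "\<mu> \<Otimes>\<^sub>M \<mu>" by (intro finite_measure_pair_measure fin)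
  interpret mm: pair_sigma_finite \<mu> \<mu> by standard
  interpret LP: pair_sigma_finite "lborel :: 'a measure" "\<mu> \<Otimes>\<^sub>M \<mu>" by standard
  define R where "R = 1 / \<epsilon>"
  have R: "0 < R" using \<open>0 < \<epsilon>\<close> by (simp add: R_def)
  define h where "h = (\<lambda>\<xi>. CLINT x|\<mu>. iexp (- (\<xi> \<bullet> x)))"
  have [measurable]: "h \<in> borel_measurable borel" unfolding h_def by measurable
  define F where "F = (\<lambda>\<xi> (p::'a \<times> 'a). complex_of_real (gauss_kernel R \<xi>) * iexp (\<xi> \<bullet> (snd p - fst p)))"
  \<comment> \<open>The Gaussian weight is what permits Fubini: the bare exponential has modulus 1
    on a space of infinite measure.\<close>
  have Fint: "integrable (lborel \<Otimes>\<^sub>M (\<mu> \<Otimes>\<^sub>M \<mu>)) (\<lambda>(\<xi>, p). F \<xi> p)"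
  proof (rule LP.Fubini_integrable)
    show "(\<lambda>(\<xi>, p). F \<xi> p) \<in> borel_measurable (lborel \<Otimes>\<^sub>M \<mu> \<Otimes>\<^sub>M \<mu>)" unfolding F_def by measurable
    show "integrable lborel (\<lambda>\<xi>. \<integral>p. norm (case (\<xi>, p) of (\<xi>, p) \<Rightarrow> F \<xi> p) \<partial>(\<mu> \<Otimes>\<^sub>M \<mu>))"
      using gauss_kernel_integral(2)[OF R, where 'a='a] by (simp add: F_def norm_mult gauss_kernel_nonneg)
    have "integrable (\<mu> \<Otimes>\<^sub>M \<mu>) (F \<xi>)" for \<xi>
      by (rule P.integrable_const_bound[where B="gauss_kernel R \<xi>"])
         (auto simp: F_def norm_mult gauss_kernel_nonneg)
    then show "AE \<xi> in lborel. integrable (\<mu> \<Otimes>\<^sub>M \<mu>) (\<lambda>p. case (\<xi>, p) of (\<xi>, p) \<Rightarrow> F \<xi> p)"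
      by simp
  qed
  \<comment> \<open>The exponential of the difference splits into two factors, so integrating over
    pairs gives h times its conjugate.\<close>
  have inner: "(CLINT p|\<mu> \<Otimes>\<^sub>M \<mu>. F \<xi> p) = complex_of_real (gauss_kernel R \<xi> * (cmod (h \<xi>))\<^sup>2)" for \<xi>
  proof -
    have int: "integrable (\<mu> \<Otimes>\<^sub>M \<mu>) (\<lambda>(x, y). iexp (- (\<xi> \<bullet> x)) * iexp (\<xi> \<bullet> y))"
      by (rule P.integrable_const_bound[where B=1]) (auto simp: norm_mult)
    have c: "(CLINT y|\<mu>. iexp (\<xi> \<bullet> y)) = cnj (h \<xi>)"
    proof -
      have "cnj (h \<xi>) = (CLINT x|\<mu>. cnj (iexp (- (\<xi> \<bullet> x))))"
        unfolding h_def by simp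
      then show ?thesis by (simp add: exp_cnj del: integral_cnj)
    qed
    have "(CLINT p|\<mu> \<Otimes>\<^sub>M \<mu>. F \<xi> p)
        = complex_of_real (gauss_kernel R \<xi>) * (CLINT p|\<mu> \<Otimes>\<^sub>M \<mu>. (case p of (x, y) \<Rightarrow> iexp (- (\<xi> \<bullet> x)) * iexp (\<xi> \<bullet> y)))"
      unfolding F_def integral_mult_right_zero
      by (auto intro!: arg_cong2[where f="(*)"] Bochner_Integration.integral_cong
           simp: exp_add[symmetric] inner_diff_right algebra_simps)
    also have "(CLINT p|\<mu> \<Otimes>\<^sub>M \<mu>. (case p of (x, y) \<Rightarrow> iexp (- (\<xi> \<bullet> x)) * iexp (\<xi> \<bullet> y)))
        = (CLINT x|\<mu>. CLINT y|\<mu>. iexp (- (\<xi> \<bullet> x)) * iexp (\<xi> \<bullet> y))"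
      using mm.integral_fst'[OF int] by simp
    also have "\<dots> = h \<xi> * cnj (h \<xi>)"
      by (simp add: c h_def)
    finally show ?thesis by (simp add: complex_norm_square[symmetric] del: of_real_power)
  qed
  have outer: "(CLINT \<xi>|lborel. F \<xi> p) = complex_of_real (exp (- (R\<^sup>2 * (norm (snd p - fst p))\<^sup>2) / 2))" for p
    unfolding F_def by (rule gauss_kernel_integral[OF R])
  have intK: "integrable lborel (\<lambda>\<xi>. gauss_kernel R \<xi> * (cmod (h \<xi>))\<^sup>2)"
    using LP.integrable_fst'[OF Fint] unfolding split_conv inner complex_of_real_integrable_eq .
  have "(CLINT \<xi>|lborel. CLINT p|\<mu> \<Otimes>\<^sub>M \<mu>. F \<xi> p) = (CLINT p|\<mu> \<Otimes>\<^sub>M \<mu>. CLINT \<xi>|lborel. F \<xi> p)"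
    using LP.Fubini_integral[OF Fint] by simp
  then have "complex_of_real (\<integral>\<xi>. gauss_kernel R \<xi> * (cmod (h \<xi>))\<^sup>2 \<partial>lborel)
     = complex_of_real (\<integral>p. exp (- (R\<^sup>2 * (norm (snd p - fst p))\<^sup>2) / 2) \<partial>(\<mu> \<Otimes>\<^sub>M \<mu>))"
    unfolding inner outer integral_complex_of_real .
  then have eq: "(\<integral>p. exp (- (R\<^sup>2 * (norm (snd p - fst p))\<^sup>2) / 2) \<partial>(\<mu> \<Otimes>\<^sub>M \<mu>))
      = (\<integral>\<xi>. gauss_kernel R \<xi> * (cmod (h \<xi>))\<^sup>2 \<partial>lborel)" by simp
  have intE: "integrable (\<mu> \<Otimes>\<^sub>M \<mu>) (\<lambda>p. exp (- (R\<^sup>2 * (norm (snd p - fst p))\<^sup>2) / 2))"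
    by (rule P.integrable_const_bound[where B=1]) auto
  let ?D = "{p\<in>space (\<mu> \<Otimes>\<^sub>M \<mu>). dist (fst p) (snd p) < 2 * \<epsilon>}"
  \<comment> \<open>Within distance 2 \<epsilon> the kernel exp (- dist^2 / (2 \<epsilon>^2)) is at
    least exp (-2); this is the origin of the factor \<open>exp 2\<close>.\<close>
  have "ennreal (exp (-2)) * emeasure (\<mu> \<Otimes>\<^sub>M \<mu>) ?D = (\<integral>\<^sup>+p. ennreal (exp (-2)) * indicator ?D p \<partial>(\<mu> \<Otimes>\<^sub>M \<mu>))"
    by (subst nn_integral_cmult_indicator) auto
  also have "\<dots> \<le> (\<integral>\<^sup>+p. ennreal (exp (- (R\<^sup>2 * (norm (snd p - fst p))\<^sup>2) / 2)) \<partial>(\<mu> \<Otimes>\<^sub>M \<mu>))"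
  proof (rule nn_integral_mono)
    fix p :: "'a \<times> 'a"
    show "ennreal (exp (-2)) * indicator ?D p \<le> ennreal (exp (- (R\<^sup>2 * (norm (snd p - fst p))\<^sup>2) / 2))"
    proof (cases "p \<in> ?D")
      case True
      then have "norm (snd p - fst p) \<le> 2 * \<epsilon>" by (simp add: dist_norm norm_minus_commute)
      then have "R * norm (snd p - fst p) \<le> 2" using \<open>0 < \<epsilon>\<close> by (simp add: R_def field_simps)
      then have "(R * norm (snd p - fst p))\<^sup>2 \<le> 2\<^sup>2" using R by (intro power_mono) auto
      then show ?thesis using True by (auto simp: power_mult_distrib intro!: ennreal_leI)
    qed simp
  qed
  also have "\<dots> = ennreal (\<integral>\<xi>. gauss_kernel R \<xi> * (cmod (h \<xi>))\<^sup>2 \<partial>lborel)"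
    unfolding eq[symmetric] by (rule nn_integral_eq_integral[OF intE]) auto
  also have "\<dots> = (\<integral>\<^sup>+\<xi>. ennreal (gauss_kernel R \<xi> * (cmod (h \<xi>))\<^sup>2) \<partial>lborel)"
    by (rule nn_integral_eq_integral[OF intK, symmetric]) (auto simp: gauss_kernel_nonneg)
  also have "\<dots> \<le> (\<integral>\<^sup>+\<xi>. ennreal (\<epsilon> ^ DIM('a)) * ennreal ((cmod (h \<xi>))\<^sup>2) \<partial>lborel)"
  proof (rule nn_integral_mono)
    fix \<xi> :: 'a
    have "gauss_kernel R \<xi> \<le> \<epsilon> ^ DIM('a)" using gauss_kernel_le[OF R, of \<xi>] by (simp add: R_def)
    then have "gauss_kernel R \<xi> * (cmod (h \<xi>))\<^sup>2 \<le> \<epsilon> ^ DIM('a) * (cmod (h \<xi>))\<^sup>2" by (intro mult_right_mono) auto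
    then show "ennreal (gauss_kernel R \<xi> * (cmod (h \<xi>))\<^sup>2) \<le> ennreal (\<epsilon> ^ DIM('a)) * ennreal ((cmod (h \<xi>))\<^sup>2)"
      using \<open>0 < \<epsilon>\<close> by (subst ennreal_mult[symmetric]) (auto intro: ennreal_leI)
  qed
  also have "\<dots> = ennreal (\<epsilon> ^ DIM('a)) * (\<integral>\<^sup>+\<xi>. ennreal ((cmod (h \<xi>))\<^sup>2) \<partial>lborel)"
    by (rule nn_integral_cmult) measurable
  also have "\<dots> \<le> ennreal (\<epsilon> ^ DIM('a)) * ennreal \<Lambda>"
    using L2(1) unfolding h_def by (intro mult_left_mono) auto
  also have "\<dots> = ennreal (exp (-2)) * ennreal (exp 2 * \<Lambda> * \<epsilon> ^ DIM('a))"
    using \<open>0 < \<epsilon>\<close> L2(2) by (simp add: ennreal_mult[symmetric] exp_minus field_simps)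
  finally show ?thesis by (subst (asm) ennreal_mult_le_mult_iff) auto
qed


lemma ennreal_mult_add_mult:
  assumes "0 \<le> a" "0 \<le> b" "0 \<le> c" "0 \<le> d"
  shows "ennreal a * ennreal b + ennreal c * ennreal d = ennreal (a * b + c * d)"
  using assms by (simp add: ennreal_plus ennreal_mult)

text \<open>The averages \<open>\<mu> (ball x \<epsilon>) / vol (ball x \<epsilon>)\<close> are bounded in \<open>L\<^sup>2\<close> uniformly in \<open>\<epsilon>\<close>, hence
  \<open>\<mu> U\<close> is at most a constant times the square root of the volume of \<open>U\<close> for open \<open>U\<close>.\<close>

lemma absolutely_continuous_if_fourier_L2:
  fixes \<mu> :: "'a::euclidean_space measure"
  assumes fin: "finite_measure \<mu>" and sets[measurable_cong]: "sets \<mu> = sets borel"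
    and L2: "(\<integral>\<^sup>+\<xi>. ennreal ((cmod (CLINT x|\<mu>. iexp (- (\<xi> \<bullet> x))))\<^sup>2) \<partial>lborel) < \<infinity>"
  shows "absolutely_continuous lborel \<mu>"
proof -
  interpret finite_measure \<mu> by fact
  interpret mm: pair_sigma_finite \<mu> \<mu> by standard
  interpret lm: pair_sigma_finite "lborel :: 'a measure" \<mu> by standard
  obtain \<Lambda> where \<Lambda>: "0 \<le> \<Lambda>"
    "(\<integral>\<^sup>+\<xi>. ennreal ((cmod (CLINT x|\<mu>. iexp (- (\<xi> \<bullet> x))))\<^sup>2) \<partial>lborel) = ennreal \<Lambda>"
    using L2 by (cases "\<integral>\<^sup>+\<xi>. ennreal ((cmod (CLINT x|\<mu>. iexp (- (\<xi> \<bullet> x))))\<^sup>2) \<partial>lborel") auto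
  let ?d = "DIM('a)"
  let ?b = "\<lambda>\<epsilon> (x::'a) y. indicator {0..<\<epsilon>} (dist x y) :: ennreal"
  define v where "v = unit_ball_vol (real ?d)"
  have v: "0 < v" by (simp add: v_def)
  define V where "V = (\<lambda>\<epsilon>::real. v * \<epsilon> ^ ?d)"
  have V: "0 < \<epsilon> \<Longrightarrow> 0 < V \<epsilon>" for \<epsilon> using v by (simp add: V_def)
  have vol: "0 < \<epsilon> \<Longrightarrow> emeasure lborel (ball x \<epsilon>) = ennreal (V \<epsilon>)" for x :: 'a and \<epsilon>
    by (simp add: emeasure_ball V_def v_def)
  define m where "m = (\<lambda>\<epsilon> x::'a. emeasure \<mu> (ball x \<epsilon>))"
  have m_int: "m \<epsilon> x = (\<integral>\<^sup>+y. ?b \<epsilon> x y \<partial>\<mu>)" for \<epsilon> x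
  proof -
    have "m \<epsilon> x = (\<integral>\<^sup>+y. indicator (ball x \<epsilon>) y \<partial>\<mu>)" by (simp add: m_def sets)
    also have "\<dots> = (\<integral>\<^sup>+y. ?b \<epsilon> x y \<partial>\<mu>)"
      by (rule nn_integral_cong) (simp split: split_indicator)
    finally show ?thesis .
  qed
  have m_meas[measurable]: "m \<epsilon> \<in> borel_measurable lborel" for \<epsilon>
    unfolding m_int[abs_def] by measurable
  \<comment> \<open>By Fubini the square becomes an integral over pairs (y, y') of the volume of the
    intersection of two \<epsilon>-balls. It vanishes unless the centres are closer than 2
    \<epsilon>, so the estimate near the diagonal applies.\<close>
  have msq: "(\<integral>\<^sup>+x. m \<epsilon> x * m \<epsilon> x \<partial>lborel) \<le> ennreal (V \<epsilon> * (exp 2 * \<Lambda> * \<epsilon> ^ ?d))" if "0 < \<epsilon>" for \<epsilon>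
  proof -
    have "(\<integral>\<^sup>+x. m \<epsilon> x * m \<epsilon> x \<partial>lborel)
       = (\<integral>\<^sup>+x. (\<integral>\<^sup>+y. (\<integral>\<^sup>+y'. ?b \<epsilon> x y * ?b \<epsilon> x y' \<partial>\<mu>) \<partial>\<mu>) \<partial>lborel)"
      unfolding m_int by (simp add: nn_integral_cmult nn_integral_multc)
    also have "\<dots> = (\<integral>\<^sup>+y. (\<integral>\<^sup>+x. (\<integral>\<^sup>+y'. ?b \<epsilon> x y * ?b \<epsilon> x y' \<partial>\<mu>) \<partial>lborel) \<partial>\<mu>)"
      by (rule lm.Fubini'[symmetric]) measurable
    also have "\<dots> = (\<integral>\<^sup>+y. (\<integral>\<^sup>+y'. (\<integral>\<^sup>+x. ?b \<epsilon> x y * ?b \<epsilon> x y' \<partial>lborel) \<partial>\<mu>) \<partial>\<mu>)"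
    proof (rule nn_integral_cong)
      fix y :: 'a
      show "(\<integral>\<^sup>+x. (\<integral>\<^sup>+y'. ?b \<epsilon> x y * ?b \<epsilon> x y' \<partial>\<mu>) \<partial>lborel)
        = (\<integral>\<^sup>+y'. (\<integral>\<^sup>+x. ?b \<epsilon> x y * ?b \<epsilon> x y' \<partial>lborel) \<partial>\<mu>)"
        by (rule lm.Fubini'[symmetric]) measurable
    qed
    also have "\<dots> \<le> (\<integral>\<^sup>+y. (\<integral>\<^sup>+y'. ennreal (V \<epsilon>) * indicator {0..<2 * \<epsilon>} (dist y y') \<partial>\<mu>) \<partial>\<mu>)"
    proof (intro nn_integral_mono)
      fix y y' :: 'a
      show "(\<integral>\<^sup>+x. ?b \<epsilon> x y * ?b \<epsilon> x y' \<partial>lborel)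
           \<le> ennreal (V \<epsilon>) * indicator {0..<2 * \<epsilon>} (dist y y')"
      proof (cases "dist y y' < 2 * \<epsilon>")
        case True
        have "(\<integral>\<^sup>+x. ?b \<epsilon> x y * ?b \<epsilon> x y' \<partial>lborel)
            \<le> (\<integral>\<^sup>+x. indicator (ball y \<epsilon>) x \<partial>lborel)"
          by (intro nn_integral_mono) (auto simp: dist_commute split: split_indicator)
        also have "\<dots> = ennreal (V \<epsilon>)" using that by (simp add: vol)
        finally show ?thesis using True by simp
      next
        case False
        have "?b \<epsilon> x y * ?b \<epsilon> x y' = 0" for x
          using False dist_triangle[of y y' x] by (auto simp: dist_commute split: split_indicator)
        then have "(\<integral>\<^sup>+x. ?b \<epsilon> x y * ?b \<epsilon> x y' \<partial>lborel) = integral\<^sup>N lborel (\<lambda>_::'a. 0)"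
          by (intro nn_integral_cong)
        then show ?thesis by simp
      qed
    qed
    also have "\<dots> = ennreal (V \<epsilon>) * (\<integral>\<^sup>+p. indicator {0..<2 * \<epsilon>} (dist (fst p) (snd p)) \<partial>(\<mu> \<Otimes>\<^sub>M \<mu>))"
      by (subst nn_integral_fst[symmetric]) (auto simp: nn_integral_cmult)
    also have "(\<integral>\<^sup>+p. indicator {0..<2 * \<epsilon>} (dist (fst p) (snd p)) \<partial>(\<mu> \<Otimes>\<^sub>M \<mu>))
       = emeasure (\<mu> \<Otimes>\<^sub>M \<mu>) {p\<in>space (\<mu> \<Otimes>\<^sub>M \<mu>). dist (fst p) (snd p) < 2 * \<epsilon>}"
    proof -
      have "(\<integral>\<^sup>+p. indicator {0..<2 * \<epsilon>} (dist (fst p) (snd p)) \<partial>(\<mu> \<Otimes>\<^sub>M \<mu>))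
        = (\<integral>\<^sup>+p. indicator {p\<in>space (\<mu> \<Otimes>\<^sub>M \<mu>). dist (fst p) (snd p) < 2 * \<epsilon>} p \<partial>(\<mu> \<Otimes>\<^sub>M \<mu>))"
        by (rule nn_integral_cong) (simp split: split_indicator)
      also have "\<dots> = emeasure (\<mu> \<Otimes>\<^sub>M \<mu>) {p\<in>space (\<mu> \<Otimes>\<^sub>M \<mu>). dist (fst p) (snd p) < 2 * \<epsilon>}"
        by (rule nn_integral_indicator) measurable
      finally show ?thesis .
    qed
    also have "ennreal (V \<epsilon>) * \<dots> \<le> ennreal (V \<epsilon>) * ennreal (exp 2 * \<Lambda> * \<epsilon> ^ ?d)"
      using pair_measure_near_diagonal[OF fin sets that _ \<Lambda>(1)] \<Lambda>(2) by (intro mult_left_mono) auto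
    also have "\<dots> = ennreal (V \<epsilon> * (exp 2 * \<Lambda> * \<epsilon> ^ ?d))"
      using V[OF that] \<Lambda>(1) that by (intro ennreal_mult[symmetric]) auto
    finally show ?thesis .
  qed
  \<comment> \<open>Since \<open>V \<epsilon>\<close> = v \<epsilon>^d, the bound \<open>msq\<close>
    equals \<open>C\<close> times the square of \<open>V \<epsilon>\<close>: the averages
    \<open>m \<epsilon>\<close> / \<open>V \<epsilon>\<close> satisfy an L^2 bound free of
    \<epsilon>.\<close>
  define C where "C = exp 2 * \<Lambda> / v"
  have C: "0 \<le> C" using v \<Lambda> by (simp add: C_def)
  have open_le: "emeasure \<mu> U \<le> ennreal ((C + 1) * \<eta>)"
    if U: "open U" "emeasure lborel U \<le> ennreal (\<eta>\<^sup>2)" "0 < \<eta>" for U \<eta>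
  proof -
    have [measurable]: "U \<in> sets borel" using U by simp
    have eqU: "(\<integral>\<^sup>+x. indicator U x * ?b \<epsilon> x y \<partial>lborel) = emeasure lborel (U \<inter> ball y \<epsilon>)" for y \<epsilon>
    proof -
      have "(\<integral>\<^sup>+x. indicator U x * ?b \<epsilon> x y \<partial>lborel) = (\<integral>\<^sup>+x. indicator (U \<inter> ball y \<epsilon>) x \<partial>lborel)"
        by (rule nn_integral_cong) (simp add: dist_commute split: split_indicator)
      also have "\<dots> = emeasure lborel (U \<inter> ball y \<epsilon>)" by simp
      finally show ?thesis .
    qed
    have ms: "(\<lambda>y. emeasure lborel (U \<inter> ball y \<epsilon>)) \<in> borel_measurable \<mu>" for \<epsilon>
      unfolding eqU[symmetric] by measurable
    have bound: "(\<integral>\<^sup>+y. emeasure lborel (U \<inter> ball y \<epsilon>) / ennreal (V \<epsilon>) \<partial>\<mu>) \<le> ennreal ((C + 1) * \<eta>)"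
      if \<epsilon>: "0 < \<epsilon>" for \<epsilon>
    proof -
      \<comment> \<open>A pointwise substitute for Cauchy-Schwarz, from 0 <= (a q - 1)^2 + a q with
        a = \<eta> / \<open>V \<epsilon>\<close>. After integration the quadratic term contributes C
        \<eta> \<open>V \<epsilon>\<close> and the constant one, over a set of volume at most
        \<eta>^2, contributes \<eta> \<open>V \<epsilon>\<close>.\<close>
      have ptw: "m \<epsilon> x \<le> ennreal (\<eta> / V \<epsilon>) * (m \<epsilon> x * m \<epsilon> x) + ennreal (V \<epsilon> / \<eta>)" for x
      proof -
        obtain q where q: "m \<epsilon> x = ennreal q" "0 \<le> q"
          using emeasure_finite unfolding m_def by (metis ennreal_cases infinity_ennreal_def)
        define a where "a = \<eta> / V \<epsilon>"
        have a: "0 < a" using U(3) V[OF \<epsilon>] by (simp add: a_def)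
        have "0 \<le> (a * q - 1)\<^sup>2 + a * q" using a q by simp
        then have "a * q \<le> (a * q)\<^sup>2 + 1" by (simp add: power2_eq_square algebra_simps)
        then have "q \<le> a * (q * q) + 1 / a" using a by (simp add: field_simps power2_eq_square)
        then have "ennreal q \<le> ennreal (a * (q * q) + 1 / a)" by (rule ennreal_leI)
        also have "\<dots> = ennreal a * (ennreal q * ennreal q) + ennreal (1 / a)"
          using a q(2) by (simp add: ennreal_plus ennreal_mult)
        finally show ?thesis by (simp add: a_def q)
      qed
      have "(\<integral>\<^sup>+y. emeasure lborel (U \<inter> ball y \<epsilon>) \<partial>\<mu>)
          = (\<integral>\<^sup>+y. (\<integral>\<^sup>+x. indicator U x * ?b \<epsilon> x y \<partial>lborel) \<partial>\<mu>)"
        by (simp only: eqU)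
      also have "\<dots> = (\<integral>\<^sup>+x. (\<integral>\<^sup>+y. indicator U x * ?b \<epsilon> x y \<partial>\<mu>) \<partial>lborel)"
        by (rule lm.Fubini') measurable
      also have "\<dots> = (\<integral>\<^sup>+x. indicator U x * m \<epsilon> x \<partial>lborel)"
        by (simp add: nn_integral_cmult m_int)
      also have "\<dots> \<le> (\<integral>\<^sup>+x. ennreal (\<eta> / V \<epsilon>) * (m \<epsilon> x * m \<epsilon> x) + ennreal (V \<epsilon> / \<eta>) * indicator U x \<partial>lborel)"
        using ptw by (intro nn_integral_mono) (auto split: split_indicator)
      also have "\<dots> = ennreal (\<eta> / V \<epsilon>) * (\<integral>\<^sup>+x. m \<epsilon> x * m \<epsilon> x \<partial>lborel) + ennreal (V \<epsilon> / \<eta>) * emeasure lborel U"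
        by (subst nn_integral_add) (auto simp: nn_integral_cmult nn_integral_cmult_indicator)
      also have "\<dots> \<le> ennreal (\<eta> / V \<epsilon>) * ennreal (V \<epsilon> * (exp 2 * \<Lambda> * \<epsilon> ^ ?d)) + ennreal (V \<epsilon> / \<eta>) * ennreal (\<eta>\<^sup>2)"
        using msq[OF \<epsilon>] U(2) by (intro add_mono mult_left_mono) auto
      also have "\<dots> = ennreal (\<eta> / V \<epsilon> * (V \<epsilon> * (exp 2 * \<Lambda> * \<epsilon> ^ ?d)) + V \<epsilon> / \<eta> * \<eta>\<^sup>2)"
        using V[OF \<epsilon>] U(3) \<Lambda>(1) \<epsilon> by (intro ennreal_mult_add_mult) auto
      also have "\<eta> / V \<epsilon> * (V \<epsilon> * (exp 2 * \<Lambda> * \<epsilon> ^ ?d)) + V \<epsilon> / \<eta> * \<eta>\<^sup>2 = V \<epsilon> * ((C + 1) * \<eta>)"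
        using U(3) v \<epsilon> by (simp add: V_def C_def field_simps power2_eq_square)
      finally have le: "(\<integral>\<^sup>+y. emeasure lborel (U \<inter> ball y \<epsilon>) \<partial>\<mu>) \<le> ennreal (V \<epsilon> * ((C + 1) * \<eta>))" .
      have "(\<integral>\<^sup>+y. emeasure lborel (U \<inter> ball y \<epsilon>) / ennreal (V \<epsilon>) \<partial>\<mu>)
          = (\<integral>\<^sup>+y. emeasure lborel (U \<inter> ball y \<epsilon>) \<partial>\<mu>) / ennreal (V \<epsilon>)"
        by (rule nn_integral_divide[OF ms])
      also have "\<dots> \<le> ennreal (V \<epsilon> * ((C + 1) * \<eta>)) / ennreal (V \<epsilon>)"
        by (intro divide_right_mono_ennreal le)
      also have "\<dots> = ennreal ((C + 1) * \<eta>)"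
        using V[OF \<epsilon>] C U(3) by (subst divide_ennreal) auto
      finally show ?thesis .
    qed
    define e where "e = (\<lambda>n. 1 / real (Suc n))"
    have e: "0 < e n" "e \<longlonglongrightarrow> 0" for n
      using LIMSEQ_inverse_real_of_nat unfolding e_def by (auto simp: inverse_eq_divide)
    have "emeasure \<mu> U = (\<integral>\<^sup>+y. indicator U y \<partial>\<mu>)" by (simp add: sets)
    \<comment> \<open>For y in the open set \<open>U\<close> the small balls around y eventually lie
      inside \<open>U\<close>, so the volume ratio is eventually 1. Fatou then transfers the bound
      that is uniform in the radius.\<close>
    also have "\<dots> \<le> (\<integral>\<^sup>+y. liminf (\<lambda>n. emeasure lborel (U \<inter> ball y (e n)) / ennreal (V (e n))) \<partial>\<mu>)"
    proof (rule nn_integral_mono)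
      fix y
      show "indicator U y \<le> liminf (\<lambda>n. emeasure lborel (U \<inter> ball y (e n)) / ennreal (V (e n)))"
      proof (cases "y \<in> U")
        case True
        then obtain r where r: "0 < r" "ball y r \<subseteq> U" using U(1) by (meson openE)
        have "eventually (\<lambda>n. e n < r) sequentially" using order_tendstoD(2)[OF e(2) r(1)] .
        then have "eventually (\<lambda>n. 1 \<le> emeasure lborel (U \<inter> ball y (e n)) / ennreal (V (e n))) sequentially"
        proof eventually_elim
          case (elim n)
          then have "U \<inter> ball y (e n) = ball y (e n)" using r(2) by (force)
          then show ?case using V[OF e(1)[of n]] e(1)[of n] by (simp add: vol divide_ennreal)
        qed
        then show ?thesis using True by (simp add: Liminf_bounded)
      qed simp
    qed
    also have "\<dots> \<le> liminf (\<lambda>n. \<integral>\<^sup>+y. emeasure lborel (U \<inter> ball y (e n)) / ennreal (V (e n)) \<partial>\<mu>)"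
      by (intro nn_integral_liminf borel_measurable_divide_ennreal ms borel_measurable_const)
    also have "\<dots> \<le> liminf (\<lambda>n. ennreal ((C + 1) * \<eta>))"
      by (intro Liminf_mono always_eventually allI bound e)
    also have "\<dots> = ennreal ((C + 1) * \<eta>)" by (simp add: Liminf_const)
    finally show ?thesis .
  qed
  show ?thesis
  proof (unfold absolutely_continuous_def, rule subsetI)
    fix A :: "'a set" assume A: "A \<in> null_sets lborel"
    have "emeasure \<mu> A \<le> ennreal c" if "0 < c" for c
    proof -
      define \<eta> where "\<eta> = c / (C + 1)"
      have \<eta>: "0 < \<eta>" using that C by (simp add: \<eta>_def)
      have "A \<in> sets lebesgue" using A by (intro sets_completionI_sets null_setsD2)
      moreover have "0 < \<eta>\<^sup>2" using \<eta> by simp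
      ultimately obtain U where U: "open U" "A \<subseteq> U" "(U - A) \<in> lmeasurable" "emeasure lebesgue (U - A) < ennreal (\<eta>\<^sup>2)"
        by (rule sets_lebesgue_outer_open)
      have [measurable]: "A \<in> sets borel" "U \<in> sets borel" using A U by auto
      have "emeasure lborel U = emeasure lborel (U - A)"
        using A by (intro emeasure_Diff_null_set[symmetric]) auto
      also have "\<dots> = emeasure lebesgue (U - A)" by simp
      finally have "emeasure \<mu> U \<le> ennreal ((C + 1) * \<eta>)"
        using U \<eta> by (intro open_le) auto
      also have "(C + 1) * \<eta> = c" using C by (simp add: \<eta>_def)
      finally show ?thesis
        using emeasure_mono[OF U(2), of \<mu>] by (simp add: sets)
    qed
    then have "emeasure \<mu> A \<le> 0"
      using ennreal_le_epsilon[of 0 "emeasure \<mu> A"] by simp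
    then show "A \<in> null_sets \<mu>" using null_setsD2[OF A] by (intro null_setsI) (auto simp: sets)
  qed
qed

section \<open>Dyadic chaining\<close>

text \<open>A bound on a weighted L^2 norm, written with squares and nonnegative integrals: no
  integrability has to be known in advance, and the bound is compatible with Fatou's lemma. As only
  the square of \<open>C\<close> occurs, the sign of \<open>C\<close> is controlled
  separately.\<close>

definition L2_le :: "'a measure \<Rightarrow> ('a \<Rightarrow> real) \<Rightarrow> ('a \<Rightarrow> complex) \<Rightarrow> real \<Rightarrow> bool" where
  "L2_le M w f C \<longleftrightarrow> (\<integral>\<^sup>+x. ennreal (w x * (cmod (f x))\<^sup>2) \<partial>M) \<le> ennreal (C\<^sup>2)"

lemma L2_le_mono: "L2_le M w f C \<Longrightarrow> 0 \<le> C \<Longrightarrow> C \<le> D \<Longrightarrow> L2_le M w f D"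
  unfolding L2_le_def by (meson ennreal_leI order_trans power_mono)

text \<open>Minkowski's inequality. With the known bounds as weights, (a + b)^2 <= (1 + D/C) a^2 +
  (1 + C/D) b^2 integrates to exactly (C + D)^2, so Hoelder's inequality is avoided; the division
  explains the strict positivity of \<open>C\<close> and \<open>D\<close>.\<close>

lemma L2_le_add:
  assumes [measurable]: "w \<in> borel_measurable M" "f \<in> borel_measurable M" "g \<in> borel_measurable M"
    and w: "\<And>x. 0 \<le> w x" and "0 < C" "0 < D" and f: "L2_le M w f C" and g: "L2_le M w g D"
  shows "L2_le M w (\<lambda>x. f x + g x) (C + D)"
proof -
  have pw: "w x * (cmod (f x + g x))\<^sup>2
      \<le> (1 + D / C) * (w x * (cmod (f x))\<^sup>2) + (1 + C / D) * (w x * (cmod (g x))\<^sup>2)" for x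
  proof -
    define a b where "a = cmod (f x)" and "b = cmod (g x)"
    have "(cmod (f x + g x))\<^sup>2 \<le> (a + b)\<^sup>2"
      unfolding a_def b_def by (intro power_mono norm_triangle_ineq) auto
    also have "\<dots> \<le> (1 + D / C) * a\<^sup>2 + (1 + C / D) * b\<^sup>2"
    proof -
      have "0 \<le> (D * a - C * b)\<^sup>2 / (C * D)" using assms by simp
      also have "(D * a - C * b)\<^sup>2 / (C * D) = D / C * a\<^sup>2 + C / D * b\<^sup>2 - 2 * a * b"
        using assms by (simp add: field_simps power2_eq_square)
      finally show ?thesis by (simp add: power2_eq_square algebra_simps)
    qed
    finally have "w x * (cmod (f x + g x))\<^sup>2 \<le> w x * ((1 + D / C) * a\<^sup>2 + (1 + C / D) * b\<^sup>2)"
      using w by (intro mult_left_mono)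
    then show ?thesis unfolding a_def b_def by (simp add: algebra_simps)
  qed
  have c: "0 \<le> 1 + D / C" "0 \<le> 1 + C / D" using assms by auto
  have "(\<integral>\<^sup>+x. ennreal (w x * (cmod (f x + g x))\<^sup>2) \<partial>M)
     \<le> (\<integral>\<^sup>+x. ennreal (1 + D / C) * ennreal (w x * (cmod (f x))\<^sup>2) + ennreal (1 + C / D) * ennreal (w x * (cmod (g x))\<^sup>2) \<partial>M)"
  proof (rule nn_integral_mono)
    fix x
    have "ennreal (1 + D / C) * ennreal (w x * (cmod (f x))\<^sup>2) + ennreal (1 + C / D) * ennreal (w x * (cmod (g x))\<^sup>2)
      = ennreal ((1 + D / C) * (w x * (cmod (f x))\<^sup>2) + (1 + C / D) * (w x * (cmod (g x))\<^sup>2))"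
      using c w by (simp add: ennreal_plus ennreal_mult del: ennreal_plus[symmetric])
    then show "ennreal (w x * (cmod (f x + g x))\<^sup>2) \<le> ennreal (1 + D / C) * ennreal (w x * (cmod (f x))\<^sup>2) + ennreal (1 + C / D) * ennreal (w x * (cmod (g x))\<^sup>2)"
      using pw by (simp only: ennreal_leI)
  qed
  also have "\<dots> = ennreal (1 + D / C) * (\<integral>\<^sup>+x. ennreal (w x * (cmod (f x))\<^sup>2) \<partial>M)
      + ennreal (1 + C / D) * (\<integral>\<^sup>+x. ennreal (w x * (cmod (g x))\<^sup>2) \<partial>M)"
    by (subst nn_integral_add) (auto simp: nn_integral_cmult)
  also have "\<dots> \<le> ennreal (1 + D / C) * ennreal (C\<^sup>2) + ennreal (1 + C / D) * ennreal (D\<^sup>2)"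
    using f g unfolding L2_le_def by (intro add_mono mult_left_mono) auto
  also have "\<dots> = ennreal ((1 + D / C) * C\<^sup>2 + (1 + C / D) * D\<^sup>2)"
    using c by (simp only: ennreal_plus ennreal_mult mult_nonneg_nonneg zero_le_power2)
  also have "(1 + D / C) * C\<^sup>2 + (1 + C / D) * D\<^sup>2 = (C + D)\<^sup>2"
    using assms by (simp add: field_simps power2_eq_square)
  finally show ?thesis unfolding L2_le_def .
qed

text \<open>\<open>Q x y C\<close> is read as ``the increment between \<open>x\<close> and \<open>y\<close> has norm at most \<open>C\<close>''.\<close>

lemma dyadic_chaining_aux:
  fixes Q :: "real \<Rightarrow> real \<Rightarrow> real \<Rightarrow> bool" and T :: real
  assumes refl: "\<And>x C. 0 < C \<Longrightarrow> Q x x C"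
    and mono: "\<And>x y C D. Q x y C \<Longrightarrow> 0 < C \<Longrightarrow> C \<le> D \<Longrightarrow> Q x y D"
    and trans: "\<And>x y z C D. x \<in> {0..T} \<Longrightarrow> y \<in> {0..T} \<Longrightarrow> z \<in> {0..T} \<Longrightarrow> x \<le> y \<Longrightarrow> y \<le> z \<Longrightarrow>
        0 < C \<Longrightarrow> 0 < D \<Longrightarrow> Q x y C \<Longrightarrow> Q y z D \<Longrightarrow> Q x z (C + D)"
    and step: "\<And>n k. k < 2 ^ n \<Longrightarrow> Q (T * real k / 2 ^ n) (T * real (Suc k) / 2 ^ n) (d n)"
    and d: "\<And>n. 0 < d n" and T: "0 < T"
  shows "i \<le> j \<Longrightarrow> j \<le> 2 ^ (n + p) \<Longrightarrow> j - i \<le> 2 ^ p \<Longrightarrow>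
     Q (T * real i / 2 ^ (n + p)) (T * real j / 2 ^ (n + p)) (2 * (\<Sum>l\<le>p. d (n + l)))"
proof (induction p arbitrary: i j)
  case 0
  show ?case
  proof (cases "i = j")
    case True
    then show ?thesis using d[of n] refl by simp
  next
    case False
    then have "j = Suc i" using 0 by simp
    then have "Q (T * real i / 2 ^ n) (T * real j / 2 ^ n) (d n)" using 0 step[of i n] by simp
    from mono[OF this d, of "2 * d n"] show ?thesis using d[of n] by simp
  qed
next
  case (Suc p)
  define N where "N = n + p"
  have NS: "n + Suc p = Suc N" by (simp add: N_def)
  \<comment> \<open>Rounding \<open>i\<close> up and \<open>j\<close> down to even indices costs at
    most one interval of the finest level at each end, which is what the factor 2 in the bound pays
    for. The rest belongs to the next coarser level, where the index distance has halved.\<close>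
  define i' where "i' = (i + 1) div 2"
  define j' where "j' = j div 2"
  define P where "P = (\<lambda>k. T * real k / 2 ^ Suc N)"
  have P': "T * real k / 2 ^ N = P (2 * k)" for k by (simp add: P_def)
  have j: "j \<le> 2 ^ Suc N" using Suc.prems(2) by (simp add: N_def)
  have inT: "P k \<in> {0..T}" if "k \<le> 2 ^ Suc N" for k
  proof -
    have "real k \<le> 2 ^ Suc N" using that by (metis of_nat_le_iff of_nat_numeral of_nat_power)
    then show ?thesis using T by (auto simp: P_def divide_simps)
  qed
  have Pmono: "k \<le> l \<Longrightarrow> P k \<le> P l" for k l using T by (auto simp: P_def divide_simps)
  have adj: "Q (P k) (P l) (d (Suc N))" if "k \<le> l" "l \<le> Suc k" "l \<le> 2 ^ Suc N" for k l
  proof (cases "k = l")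
    case False
    then have "l = Suc k" using that by simp
    then show ?thesis using step[of k "Suc N"] that by (simp add: P_def)
  qed (simp add: refl d)
  let ?S = "\<Sum>l\<le>p. d (n + l)"
  have Spos: "0 < ?S" using d by (intro sum_pos) auto
  have total: "d (Suc N) + 2 * ?S + d (Suc N) = 2 * (\<Sum>l\<le>Suc p. d (n + l))"
    by (simp add: N_def)
  have "Q (P i) (P j) (d (Suc N) + 2 * ?S + d (Suc N))"
  proof (cases "i' \<le> j'")
    case True
    have ii: "i \<le> 2 * i'" "2 * i' \<le> Suc i" "2 * j' \<le> j" "j \<le> Suc (2 * j')"
      unfolding i'_def j'_def by auto
    have mid: "Q (P (2 * i')) (P (2 * j')) (2 * ?S)"
    proof -
      have "j' \<le> 2 ^ (n + p)" using j by (simp add: j'_def N_def)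
      moreover have "j' - i' \<le> 2 ^ p" using Suc.prems(3) ii by simp
      ultimately show ?thesis using Suc.IH[OF True] unfolding N_def[symmetric] P' by simp
    qed
    have le: "i \<le> 2 ^ Suc N" "2 * i' \<le> 2 ^ Suc N" "2 * j' \<le> 2 ^ Suc N" "2 * i' \<le> 2 * j'"
      using ii j True Suc.prems(1) by auto
    have left: "Q (P i) (P (2 * i')) (d (Suc N))" using ii j True by (intro adj) auto
    have right: "Q (P (2 * j')) (P j) (d (Suc N))" using ii j by (intro adj) auto
    have "Q (P i) (P (2 * j')) (d (Suc N) + 2 * ?S)"
      using Spos by (intro trans[OF inT inT inT Pmono Pmono d _ left mid] le ii) auto
    then show ?thesis
      using Spos d[of "Suc N"] le(4) ii(1)
      by (intro trans[OF inT inT inT Pmono Pmono _ d _ right] le ii j) auto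
  next
    case False
    \<comment> \<open>The rounded indices cross only if \<open>i\<close> and \<open>j\<close> are
      the same odd number.\<close>
    then have "i = j" using Suc.prems(1) unfolding i'_def j'_def by presburger
    then show ?thesis using refl d[of "Suc N"] Spos by (simp add: add_pos_pos)
  qed
  then show ?case unfolding NS P_def total .
qed

text \<open>The level n is chosen with T / 2^(n+1) < y - x <= T / 2^n. Rounding x and y down to
  level n + p gives indices at most 2^p apart, so the bound along the chain is a tail of a geometric
  series, uniform in p. Semicontinuity \<open>lsc\<close> then lets p tend to infinity.\<close>

lemma dyadic_chaining:
  fixes Q :: "real \<Rightarrow> real \<Rightarrow> real \<Rightarrow> bool" and T :: real
  assumes refl: "\<And>x C. 0 < C \<Longrightarrow> Q x x C"
    and mono: "\<And>x y C D. Q x y C \<Longrightarrow> 0 < C \<Longrightarrow> C \<le> D \<Longrightarrow> Q x y D"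
    and trans: "\<And>x y z C D. x \<in> {0..T} \<Longrightarrow> y \<in> {0..T} \<Longrightarrow> z \<in> {0..T} \<Longrightarrow> x \<le> y \<Longrightarrow> y \<le> z \<Longrightarrow>
        0 < C \<Longrightarrow> 0 < D \<Longrightarrow> Q x y C \<Longrightarrow> Q y z D \<Longrightarrow> Q x z (C + D)"
    and step: "\<And>n k. k < 2 ^ n \<Longrightarrow> Q (T * real k / 2 ^ n) (T * real (Suc k) / 2 ^ n) (K * 2 powr (- \<gamma> * real n))"
    and lsc: "\<And>x y xs ys C. \<lbrakk>x \<in> {0..T}; y \<in> {0..T}; x \<le> y; \<And>n. xs n \<in> {0..T}; \<And>n. ys n \<in> {0..T}; \<And>n. xs n \<le> ys n;
        xs \<longlonglongrightarrow> x; ys \<longlonglongrightarrow> y; 0 < C; \<And>n. Q (xs n) (ys n) C\<rbrakk> \<Longrightarrow> Q x y C"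
    and K: "0 < K" and T: "0 < T" and \<gamma>: "0 < \<gamma>"
  obtains C where "0 < C" "\<And>x y. x \<in> {0..T} \<Longrightarrow> y \<in> {0..T} \<Longrightarrow> x < y \<Longrightarrow> Q x y (C * (y - x) powr \<gamma>)"
proof
  define r where "r = 2 powr (- \<gamma>)"
  have r: "0 < r" "r < 1" using \<gamma> by (auto simp: r_def powr_less_one)
  have rp: "2 powr (- \<gamma> * real n) = r ^ n" for n
    by (metis powr_powr powr_realpow r(1) r_def)
  \<comment> \<open>The chain costs at most 2 K r^n / (1 - r), and r^n = (1 / 2^n)^\<gamma> is at
    most (2 (y - x) / T)^\<gamma> by the choice of n.\<close>
  define C where "C = 2 * K / (1 - r) * (2 / T) powr \<gamma>"
  show "0 < C" using K r T by (simp add: C_def)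
  fix x y assume x: "x \<in> {0..T}" and y: "y \<in> {0..T}" and xy: "x < y"
  have "y - x \<le> T" using x y by auto
  have ex: "\<exists>n. T / 2 ^ n < y - x"
  proof -
    obtain n where "T / (y - x) < 2 ^ n" using real_arch_pow[of 2 "T / (y - x)"] by auto
    then show ?thesis using xy by (intro exI[of _ n]) (simp add: field_simps)
  qed
  define n0 where "n0 = (LEAST n. T / 2 ^ n < y - x)"
  have n0: "T / 2 ^ n0 < y - x" unfolding n0_def by (rule LeastI_ex[OF ex])
  have "n0 \<noteq> 0" using n0 \<open>y - x \<le> T\<close> by (cases n0) auto
  then obtain n where n: "n0 = Suc n" by (cases n0) auto
  have "\<not> T / 2 ^ n < y - x" using not_less_Least[of n "\<lambda>n. T / 2 ^ n < y - x"] n by (simp add: n0_def)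
  then have up: "y - x \<le> T / 2 ^ n" by simp
  have lo: "T / 2 ^ Suc n < y - x" using n0 n by simp
  define B where "B = 2 * K / (1 - r) * r ^ n"
  have B: "0 < B" using K r by (simp add: B_def)
  define i where "i = (\<lambda>u p. nat \<lfloor>u * 2 ^ (n + p) / T\<rfloor>)"
  define g where "g = (\<lambda>u p. T * real (i u p) / 2 ^ (n + p))"
  have i_real: "real (i u p) = of_int \<lfloor>u * 2 ^ (n + p) / T\<rfloor>" if "u \<in> {0..T}" for u p
    using that T by (simp add: i_def)
  have g_le: "g u p \<le> u" "u - T / 2 ^ (n + p) \<le> g u p" if "u \<in> {0..T}" for u p
  proof -
    have "real (i u p) \<le> u * 2 ^ (n + p) / T" unfolding i_real[OF that] by simp
    then show "g u p \<le> u" using T by (simp add: g_def field_simps)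
    have "u * 2 ^ (n + p) / T - 1 \<le> real (i u p)" unfolding i_real[OF that] by linarith
    then have "T * (u * 2 ^ (n + p) / T - 1) / 2 ^ (n + p) \<le> g u p"
      unfolding g_def using T by (intro divide_right_mono mult_left_mono) auto
    moreover have "T * (u * 2 ^ (n + p) / T - 1) / 2 ^ (n + p) = u - T / 2 ^ (n + p)"
      using T by (simp add: field_simps)
    ultimately show "u - T / 2 ^ (n + p) \<le> g u p" by simp
  qed
  have g_in: "g u p \<in> {0..T}" if "u \<in> {0..T}" for u p
    using g_le(1)[OF that, of p] that T by (auto simp: g_def)
  have g_lim: "(\<lambda>p. g u p) \<longlonglongrightarrow> u" if "u \<in> {0..T}" for u
  proof (rule tendsto_sandwich)
    show "(\<lambda>p. u - T / 2 ^ (n + p)) \<longlonglongrightarrow> u"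
    proof -
      have "(\<lambda>p. u - T / 2 ^ n * (1/2) ^ p) \<longlonglongrightarrow> u - T / 2 ^ n * 0"
        by (intro tendsto_intros LIMSEQ_power_zero) auto
      moreover have "T / 2 ^ n * (1 / 2) ^ p = T / 2 ^ (n + p)" for p
        by (simp add: power_add power_one_over)
      ultimately show ?thesis by simp
    qed
    show "(\<lambda>_. u) \<longlonglongrightarrow> u" by simp
  qed (use g_le[OF that] in auto)
  have i_mono: "i x p \<le> i y p" for p
    using xy T unfolding i_def by (intro nat_mono floor_mono divide_right_mono mult_right_mono) auto
  have Qg: "Q (g x p) (g y p) B" for p
  proof -
    have "y * 2 ^ (n + p) / T - x * 2 ^ (n + p) / T \<le> 2 ^ p"
    proof -
      have "(y - x) * 2 ^ (n + p) \<le> T / 2 ^ n * 2 ^ (n + p)" using up by (intro mult_right_mono) auto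
      also have "\<dots> = T * 2 ^ p" by (simp add: power_add)
      finally show ?thesis using T by (simp add: field_simps)
    qed
    \<comment> \<open>Because 2^p is an integer, it passes through the floor and no extra index is
      lost by rounding.\<close>
    then have "\<lfloor>y * 2 ^ (n + p) / T\<rfloor> - \<lfloor>x * 2 ^ (n + p) / T\<rfloor> \<le> 2 ^ p"
    proof -
      assume a: "y * 2 ^ (n + p) / T - x * 2 ^ (n + p) / T \<le> 2 ^ p"
      then have "y * 2 ^ (n + p) / T \<le> x * 2 ^ (n + p) / T + of_int (2 ^ p)" by simp
      then have "\<lfloor>y * 2 ^ (n + p) / T\<rfloor> \<le> \<lfloor>x * 2 ^ (n + p) / T + of_int (2 ^ p)\<rfloor>" by (rule floor_mono)
      then show ?thesis by (simp add: floor_add_int[symmetric] del: of_int_power)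
    qed
    then have "real (i y p) - real (i x p) \<le> 2 ^ p"
      unfolding i_real[OF x] i_real[OF y] by (metis of_int_diff of_int_le_iff of_int_numeral of_int_power)
    then have dif: "i y p - i x p \<le> 2 ^ p"
      using i_mono[of p] by (metis of_nat_diff of_nat_le_iff of_nat_numeral of_nat_power)
    have "g y p \<le> T" using g_in[OF y] by auto
    then have "real (i y p) \<le> 2 ^ (n + p)" using T by (simp add: g_def field_simps)
    then have "i y p \<le> 2 ^ (n + p)" by (metis of_nat_le_iff of_nat_numeral of_nat_power)
    then have Q1: "Q (g x p) (g y p) (2 * (\<Sum>l\<le>p. K * 2 powr (- \<gamma> * real (n + l))))"
      unfolding g_def using i_mono dif K
      by (intro dyadic_chaining_aux[OF refl mono trans step _ T]) auto
    have "(\<Sum>l\<le>p. K * 2 powr (- \<gamma> * real (n + l))) = K * r ^ n * (\<Sum>l\<le>p. r ^ l)"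
      unfolding rp by (simp add: power_add sum_distrib_left mult.assoc)
    also have "(\<Sum>l\<le>p. r ^ l) \<le> (\<Sum>l. r ^ l)"
      using r by (intro sum_le_suminf summable_geometric) auto
    also have "(\<Sum>l. r ^ l) = 1 / (1 - r)" using r by (intro suminf_geometric) auto
    finally have "2 * (\<Sum>l\<le>p. K * 2 powr (- \<gamma> * real (n + l))) \<le> B"
      using K r by (simp add: B_def field_simps)
    moreover have "0 < 2 * (\<Sum>l\<le>p. K * 2 powr (- \<gamma> * real (n + l)))"
      using K by (intro mult_pos_pos sum_pos) auto
    ultimately show ?thesis using mono[OF Q1] by blast
  qed
  have "Q x y B"
  proof (rule lsc[OF x y])
    show "g x p \<le> g y p" for p using i_mono[of p] T by (simp add: g_def divide_right_mono)
  qed (use xy g_in[OF x] g_in[OF y] g_lim[OF x] g_lim[OF y] B Qg in auto)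
  moreover have "B \<le> C * (y - x) powr \<gamma>"
  proof -
    have "r ^ n = (1 / 2 ^ n) powr \<gamma>"
    proof -
      have "(1::real) / 2 ^ n = 2 powr (- real n)" by (simp add: powr_minus_divide powr_realpow)
      then show ?thesis unfolding rp[symmetric] by (simp add: powr_powr mult.commute)
    qed
    also have "\<dots> \<le> (2 / T * (y - x)) powr \<gamma>"
      using lo T \<gamma> by (intro powr_mono2) (auto simp: field_simps)
    also have "\<dots> = (2 / T) powr \<gamma> * (y - x) powr \<gamma>"
      by (rule powr_mult)
    finally have "2 * K / (1 - r) * r ^ n \<le> 2 * K / (1 - r) * ((2 / T) powr \<gamma> * (y - x) powr \<gamma>)"
      using K r by (intro mult_left_mono) auto
    then show ?thesis by (simp add: B_def C_def)
  qed
  ultimately show "Q x y (C * (y - x) powr \<gamma>)" using mono[of x y B] B by blast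
qed

section \<open>Approximation by step functions\<close>

lemma step_nodes_mono: "step_nodes t n s \<Longrightarrow> i \<le> j \<Longrightarrow> j \<le> n \<Longrightarrow> s i \<le> s j"
proof (induction j)
  case (Suc j)
  then show ?case
    unfolding step_nodes_def by (metis Suc_le_eq Suc_leD le_SucE order_refl order_trans)
qed auto

lemma step_fun_eq:
  assumes "step_nodes t n s" "j < n" "x \<in> {s j<..s (Suc j)}"
  shows "step_fun n a s x = a j"
proof -
  have "a i * indicator {s i<..s (Suc i)} x = (if i = j then a j else 0)" if "i < n" for i
  proof (cases i j rule: linorder_cases)
    case less
    then have "s (Suc i) \<le> s j" using step_nodes_mono[OF assms(1)] assms(2) by simp
    then show ?thesis using assms(3) less by auto
  next
    case greater
    then have "s (Suc j) \<le> s i" using step_nodes_mono[OF assms(1)] that by simp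
    then show ?thesis using assms(3) greater by auto
  qed (use assms in auto)
  then have "step_fun n a s x = (\<Sum>i<n. if i = j then a j else 0)"
    unfolding step_fun_def by (intro sum.cong) auto
  also have "\<dots> = a j" using assms(2) by simp
  finally show ?thesis .
qed

lemma step_fun_cases:
  assumes "step_nodes t n s"
  obtains j where "j < n" "x \<in> {s j<..s (Suc j)}" "step_fun n a s x = a j"
  | "step_fun n a s x = 0" "\<And>j. j < n \<Longrightarrow> x \<notin> {s j<..s (Suc j)}"
proof (cases "\<exists>j<n. x \<in> {s j<..s (Suc j)}")
  case True
  then show ?thesis using step_fun_eq[OF assms] that(1) by blast
next
  case False
  then have "step_fun n a s x = 0" unfolding step_fun_def by (intro sum.neutral) auto
  then show ?thesis using False that(2) by blast
qed

lemma step_fun_measurable[measurable]: "step_fun n a s \<in> borel_measurable borel"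
  unfolding step_fun_def[abs_def] by measurable

lemma abs_step_fun_le: "\<bar>step_fun n a s x\<bar> \<le> (\<Sum>j<n. \<bar>a j\<bar>)"
  unfolding step_fun_def by (rule order_trans[OF sum_abs]) (auto intro!: sum_mono split: split_indicator)

lemma borel_lebesgue_on: "f \<in> borel_measurable borel \<Longrightarrow> f \<in> borel_measurable (lebesgue_on S)"
  by (simp add: measurable_completion measurable_restrict_space1)

text \<open>Estimating the sum by twice the maximum gives the constant 2^p for all positive p at
  once, including p < 1 where the power is not convex.\<close>

lemma norm_add_powr_le:
  fixes a b :: "'v::real_normed_vector"
  assumes "0 < p"
  shows "norm (a + b) powr p \<le> 2 powr p * (norm a powr p + norm b powr p)"
proof -
  have "norm (a + b) \<le> 2 * max (norm a) (norm b)"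
    using norm_triangle_ineq[of a b] by linarith
  then have "norm (a + b) powr p \<le> (2 * max (norm a) (norm b)) powr p"
    using assms by (intro powr_mono2) auto
  also have "\<dots> = 2 powr p * max (norm a) (norm b) powr p" by (rule powr_mult)
  also have "max (norm a) (norm b) powr p \<le> norm a powr p + norm b powr p"
    by (auto simp: max_def)
  finally show ?thesis by simp
qed

lemma nn_integral_powr_tendsto:
  fixes u :: "nat \<Rightarrow> 'a \<Rightarrow> real"
  assumes [measurable]: "\<And>n. u n \<in> borel_measurable M" "f \<in> borel_measurable M"
    and lim: "AE x in M. (\<lambda>n. u n x) \<longlonglongrightarrow> f x"
    and bnd: "\<And>n. AE x in M. \<bar>u n x\<bar> \<le> g x" "AE x in M. \<bar>f x\<bar> \<le> g x"
    and g[measurable]: "g \<in> borel_measurable M" "(\<integral>\<^sup>+x. ennreal (g x powr p) \<partial>M) < \<infinity>" and p: "0 < p"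
  shows "(\<lambda>n. \<integral>\<^sup>+x. ennreal (\<bar>u n x - f x\<bar> powr p) \<partial>M) \<longlonglongrightarrow> 0"
proof -
  have "(\<lambda>n. \<integral>\<^sup>+x. ennreal (\<bar>u n x - f x\<bar> powr p) \<partial>M) \<longlonglongrightarrow> (\<integral>\<^sup>+x. 0 \<partial>M)"
  proof (rule nn_integral_dominated_convergence[where w="\<lambda>x. ennreal (2 powr p) * ennreal (g x powr p)"])
    show "AE x in M. ennreal (\<bar>u n x - f x\<bar> powr p) \<le> ennreal (2 powr p) * ennreal (g x powr p)" for n
      using bnd(1)[of n] bnd(2)
    proof eventually_elim
      case (elim x)
      then have "\<bar>u n x - f x\<bar> powr p \<le> (2 * g x) powr p" using p by (intro powr_mono2) auto
      also have "\<dots> = 2 powr p * g x powr p" by (rule powr_mult)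
      finally show ?case by (simp add: ennreal_mult[symmetric] ennreal_leI)
    qed
    show "AE x in M. (\<lambda>n. ennreal (\<bar>u n x - f x\<bar> powr p)) \<longlonglongrightarrow> 0"
      using lim
    proof eventually_elim
      case (elim x)
      then have "(\<lambda>n. \<bar>u n x - f x\<bar>) \<longlonglongrightarrow> 0" by (rule tendsto_rabs_zero[OF LIM_zero])
      then have "(\<lambda>n. \<bar>u n x - f x\<bar> powr p) \<longlonglongrightarrow> 0" using p by (intro tendsto_zero_powrI) auto
      then show ?case by (metis ennreal_0 tendsto_ennrealI)
    qed
    show "(\<integral>\<^sup>+x. ennreal (2 powr p) * ennreal (g x powr p) \<partial>M) < \<infinity>"
      using g(2) by (simp add: nn_integral_cmult ennreal_mult_less_top)
  qed auto
  then show ?thesis by simp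
qed

text \<open>Density of step functions in \<epsilon>-form. It speaks of a single step function rather
  than a sequence, so closure under limits takes one quasi-triangle inequality and no diagonal
  sequence.\<close>

definition step_approximable :: "real \<Rightarrow> real \<Rightarrow> (real \<Rightarrow> real) \<Rightarrow> bool" where
  "step_approximable p t f \<longleftrightarrow> (\<forall>e>0. \<exists>n a s. step_nodes t n s \<and>
      (\<integral>\<^sup>+x. ennreal (\<bar>step_fun n a s x - f x\<bar> powr p) \<partial>lebesgue_on {0..t}) < ennreal e)"

lemma step_approximable_limit:
  assumes p: "0 < p" and u: "\<And>k. step_approximable p t (u k)"
    and [measurable]: "\<And>k. u k \<in> borel_measurable (lebesgue_on {0..t})" "f \<in> borel_measurable (lebesgue_on {0..t})"
    and lim: "(\<lambda>k. \<integral>\<^sup>+x. ennreal (\<bar>u k x - f x\<bar> powr p) \<partial>lebesgue_on {0..t}) \<longlonglongrightarrow> 0"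
  shows "step_approximable p t f"
  unfolding step_approximable_def
proof (intro allI impI)
  fix e :: real assume e: "0 < e"
  let ?N = "lebesgue_on {0..t}"
  define e' where "e' = e / (2 * 2 powr p)"
  have e': "0 < e'" using e by (simp add: e'_def)
  from order_tendstoD(2)[OF lim, of "ennreal e'"] e' obtain k
    where k: "(\<integral>\<^sup>+x. ennreal (\<bar>u k x - f x\<bar> powr p) \<partial>?N) < ennreal e'"
    by (auto simp: eventually_sequentially)
  obtain n a s where s: "step_nodes t n s"
      "(\<integral>\<^sup>+x. ennreal (\<bar>step_fun n a s x - u k x\<bar> powr p) \<partial>?N) < ennreal e'"
    using u[of k] e' unfolding step_approximable_def by blast
  have [measurable]: "step_fun n a s \<in> borel_measurable ?N" by (intro borel_lebesgue_on step_fun_measurable)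
  have "(\<integral>\<^sup>+x. ennreal (\<bar>step_fun n a s x - f x\<bar> powr p) \<partial>?N)
     \<le> (\<integral>\<^sup>+x. ennreal (2 powr p) * (ennreal (\<bar>step_fun n a s x - u k x\<bar> powr p) + ennreal (\<bar>u k x - f x\<bar> powr p)) \<partial>?N)"
  proof (rule nn_integral_mono)
    fix x
    have "\<bar>step_fun n a s x - f x\<bar> powr p \<le> 2 powr p * (\<bar>step_fun n a s x - u k x\<bar> powr p + \<bar>u k x - f x\<bar> powr p)"
      using norm_add_powr_le[OF p, of "step_fun n a s x - u k x" "u k x - f x"] by simp
    then have "ennreal (\<bar>step_fun n a s x - f x\<bar> powr p) \<le> ennreal (2 powr p * (\<bar>step_fun n a s x - u k x\<bar> powr p + \<bar>u k x - f x\<bar> powr p))"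
      by (rule ennreal_leI)
    then show "ennreal (\<bar>step_fun n a s x - f x\<bar> powr p) \<le>
        ennreal (2 powr p) * (ennreal (\<bar>step_fun n a s x - u k x\<bar> powr p) + ennreal (\<bar>u k x - f x\<bar> powr p))"
      by (simp add: ennreal_mult)
  qed
  also have "\<dots> = ennreal (2 powr p) * ((\<integral>\<^sup>+x. ennreal (\<bar>step_fun n a s x - u k x\<bar> powr p) \<partial>?N)
        + (\<integral>\<^sup>+x. ennreal (\<bar>u k x - f x\<bar> powr p) \<partial>?N))"
    by (simp add: nn_integral_cmult nn_integral_add)
  also have "\<dots> < ennreal (2 powr p) * (ennreal e' + ennreal e')"
    by (intro ennreal_mult_strict_left_mono add_strict_mono k s) auto
  also have "\<dots> = ennreal e"
    using e' by (simp add: ennreal_mult[symmetric] ennreal_plus[symmetric] del: ennreal_plus) (simp add: e'_def)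
  finally show "\<exists>n a s. step_nodes t n s \<and>
      (\<integral>\<^sup>+x. ennreal (\<bar>step_fun n a s x - f x\<bar> powr p) \<partial>?N) < ennreal e"
    using s(1) by blast
qed

lemma finite_measure_lebesgue_on_Icc: "finite_measure (lebesgue_on {0..t::real})"
  by (rule finite_measureI) (cases "0 \<le> t", auto simp: emeasure_restrict_space)

lemma nn_integral_const_lebesgue_on_Icc: "(\<integral>\<^sup>+x. ennreal c \<partial>lebesgue_on {0..t::real}) < \<infinity>"
proof -
  interpret finite_measure "lebesgue_on {0..t}" by (rule finite_measure_lebesgue_on_Icc)
  have "emeasure (lebesgue_on {0..t}) {0..t} \<noteq> \<top>" using emeasure_finite by blast
  then show ?thesis by (simp add: ennreal_mult_eq_top_iff less_top[symmetric])
qed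

text \<open>Sampling at the left endpoints of a uniform mesh converges pointwise by continuity, and
  the bound on \<open>g\<close> dominates. The left-open steps miss the point 0, which is a null
  set.\<close>

lemma step_approximable_continuous:
  assumes p: "0 < p" and t: "0 \<le> t" and g: "continuous_on UNIV g" "\<And>x. \<bar>g x\<bar> \<le> B"
  shows "step_approximable p t g"
proof -
  let ?N = "lebesgue_on {0..t}"
  define s where "s = (\<lambda>m j. t * real j / real (Suc m))"
  define h where "h = (\<lambda>m. step_fun (Suc m) (\<lambda>j. g (s m j)) (s m))"
  have s_diff: "s m (Suc j) = s m j + t / real (Suc m)" for m j 
    by (simp add: s_def add_divide_distrib[symmetric] algebra_simps)
  have nodes: "step_nodes t (Suc m) (s m)" for m
    unfolding step_nodes_def
  proof (intro conjI allI impI)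
    fix j
    show "s m j \<le> s m (Suc j)" using t unfolding s_diff by simp
    assume j: "j \<le> Suc m"
    then have "t * real j \<le> t * real (Suc m)" using t by (intro mult_left_mono) auto
    then show "s m j \<in> {0..t}" using t by (auto simp: s_def divide_simps mult.commute)
  qed
  have B: "0 \<le> B" using g(2)[of 0] by simp
  have [measurable]: "h m \<in> borel_measurable ?N" for m
    unfolding h_def by (intro borel_lebesgue_on step_fun_measurable)
  have [measurable]: "g \<in> borel_measurable ?N"
    using g(1) by (intro borel_lebesgue_on borel_measurable_continuous_onI)
  have loc: "\<exists>j<Suc m. x \<in> {s m j<..s m (Suc j)}" if x: "0 < x" "x \<le> t" for x m
  proof -
    have t0: "0 < t" using x by simp
    define y where "y = x * real (Suc m) / t"
    have y: "0 < y" using x t0 by (simp add: y_def)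
    have y2: "y \<le> real (Suc m)"
    proof -
      have "x * real (Suc m) \<le> t * real (Suc m)" using x by (intro mult_right_mono) auto
      then show ?thesis using t0 by (simp add: y_def divide_le_eq mult.commute)
    qed
    \<comment> \<open>The ceiling is needed because the steps are open on the left: a mesh point
      belongs to the interval that ends there.\<close>
    define j where "j = nat (\<lceil>y\<rceil> - 1)"
    have j: "real j < y" "y \<le> real (Suc j)" "j < Suc m"
      using y y2 unfolding j_def by linarith+
    have "x = t * y / real (Suc m)" using t0 by (simp add: y_def)
    moreover have "t * real j / real (Suc m) < t * y / real (Suc m)"
      using j t0 by (intro divide_strict_right_mono mult_strict_left_mono) auto
    moreover have "t * y / real (Suc m) \<le> t * real (Suc j) / real (Suc m)"
      using j t0 by (intro divide_right_mono mult_left_mono) auto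
    ultimately show ?thesis using j(3) by (intro exI[of _ j]) (auto simp: s_def)
  qed
  have conv: "(\<lambda>m. h m x) \<longlonglongrightarrow> g x" if x: "0 < x" "x \<le> t" for x
  proof -
    have "\<forall>m. \<exists>j<Suc m. x \<in> {s m j<..s m (Suc j)}" using loc[OF x] by blast
    then obtain j where j: "\<And>m. j m < Suc m" "\<And>m. x \<in> {s m (j m)<..s m (Suc (j m))}" by metis
    have "h m x = g (s m (j m))" for m
      unfolding h_def by (rule step_fun_eq[OF nodes j])
    moreover have "(\<lambda>m. s m (j m)) \<longlonglongrightarrow> x"
    proof (rule tendsto_sandwich)
      have "(\<lambda>m. x - t * inverse (real (Suc m))) \<longlonglongrightarrow> x - t * 0"
        by (intro tendsto_intros LIMSEQ_inverse_real_of_nat)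
      then show "(\<lambda>m. x - t / real (Suc m)) \<longlonglongrightarrow> x" by (simp add: divide_inverse)
      show "\<forall>\<^sub>F m in sequentially. x - t / real (Suc m) \<le> s m (j m)"
        using j(2) s_diff by (auto simp: algebra_simps)
      show "\<forall>\<^sub>F m in sequentially. s m (j m) \<le> x" using j(2) by (auto intro!: always_eventually less_imp_le)
    qed auto
    moreover have "isCont g x" using g(1) by (simp add: continuous_on_eq_continuous_at)
    ultimately show ?thesis using isCont_tendsto_compose by auto
  qed
  have "(\<lambda>m. \<integral>\<^sup>+x. ennreal (\<bar>h m x - g x\<bar> powr p) \<partial>?N) \<longlonglongrightarrow> 0"
  proof (rule nn_integral_powr_tendsto[where g="\<lambda>_. B"])
    have "AE x in lebesgue. x \<noteq> (0::real)" by (intro AE_completion AE_lborel_singleton)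
    then have "AE x in ?N. x \<noteq> 0" by (subst AE_restrict_space_iff) (auto elim: eventually_mono)
    moreover have "AE x in ?N. x \<in> {0..t}" by (rule AE_I2) simp
    ultimately show "AE x in ?N. (\<lambda>m. h m x) \<longlonglongrightarrow> g x"
      by eventually_elim (auto intro: conv)
    show "AE x in ?N. \<bar>h m x\<bar> \<le> B" for m
    proof (rule AE_I2)
      fix x
      show "\<bar>h m x\<bar> \<le> B"
        unfolding h_def by (cases x rule: step_fun_cases[OF nodes[of m], where a="\<lambda>j. g (s m j)"]) (use B g(2) in auto)
    qed
    show "(\<integral>\<^sup>+x. ennreal (B powr p) \<partial>?N) < \<infinity>" by (rule nn_integral_const_lebesgue_on_Icc)
  qed (use g p in auto)
  note lim = this
  have "\<exists>m. (\<integral>\<^sup>+x. ennreal (\<bar>h m x - g x\<bar> powr p) \<partial>?N) < ennreal e" if "0 < e" for e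
    using order_tendstoD(2)[OF lim, of "ennreal e"] that by (auto simp: eventually_sequentially)
  then show ?thesis
    unfolding step_approximable_def h_def using nodes by blast
qed

text \<open>Two limits: clipping at level K handles unbounded \<open>f\<close>, with |f| as
  majorant. For clipped \<open>f\<close>, measurability supplies continuous functions converging
  almost everywhere; clipping these as well keeps them continuous and makes the constant K a
  majorant.\<close>

lemma step_approximable_Lp:
  assumes p: "0 < p" and t: "0 \<le> t" and f: "in_Lp (lebesgue_on {0..t}) p f"
  shows "step_approximable p t f"
proof -
  let ?N = "lebesgue_on {0..t}"
  have [measurable]: "f \<in> borel_measurable ?N" using f by (simp add: in_Lp_def)
  define cl where "cl = (\<lambda>(K::nat) y. max (- real K) (min (real K) y))"
  have cl_bnd: "\<bar>cl K y\<bar> \<le> real K" for K y by (auto simp: cl_def)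
  have cl_cont: "continuous_on UNIV (cl K)" for K
    unfolding cl_def by (intro continuous_intros)
  have [measurable]: "cl K \<in> borel_measurable borel" for K unfolding cl_def by measurable
  have bdd: "step_approximable p t (\<lambda>x. cl K (f x))" for K
  proof -
    have "f measurable_on {0..t}" by (simp add: measurable_on_iff_borel_measurable)
    then obtain Z g where Z: "negligible Z" and g: "\<And>n. continuous_on UNIV (g n)"
      and lim: "\<And>x. x \<notin> Z \<Longrightarrow> (\<lambda>n. g n x) \<longlonglongrightarrow> (if x \<in> {0..t} then f x else 0)"
      unfolding measurable_on_def by blast
    have gc: "continuous_on UNIV (\<lambda>x. cl K (g n x))" for n
      by (rule continuous_on_compose2[OF cl_cont g]) simp
    have gm[measurable]: "(\<lambda>x. cl K (g n x)) \<in> borel_measurable ?N" for n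
      using gc by (intro borel_lebesgue_on borel_measurable_continuous_onI)
    have AEZ: "AE x in ?N. x \<notin> Z"
    proof -
      have "AE x in lebesgue. x \<notin> Z" using Z by (simp add: negligible_iff_null_sets AE_not_in)
      then show ?thesis by (subst AE_restrict_space_iff) (auto elim: eventually_mono)
    qed
    show ?thesis
    proof (rule step_approximable_limit[OF p, where u="\<lambda>n x. cl K (g n x)"])
      show "step_approximable p t (\<lambda>x. cl K (g n x))" for n
        by (rule step_approximable_continuous[OF p t gc cl_bnd])
      show "(\<lambda>n. \<integral>\<^sup>+x. ennreal (\<bar>cl K (g n x) - cl K (f x)\<bar> powr p) \<partial>?N) \<longlonglongrightarrow> 0"
      proof (rule nn_integral_powr_tendsto[where g="\<lambda>_. real K"])
        have "AE x in ?N. x \<in> {0..t}" by (rule AE_I2) simp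
        with AEZ show "AE x in ?N. (\<lambda>n. cl K (g n x)) \<longlonglongrightarrow> cl K (f x)"
        proof eventually_elim
          case (elim x)
          have "isCont (cl K) (f x)" using cl_cont by (simp add: continuous_on_eq_continuous_at)
          moreover have "(\<lambda>n. g n x) \<longlonglongrightarrow> f x" using lim[OF elim(1)] elim(2) by simp
          ultimately show ?case by (rule isCont_tendsto_compose)
        qed
        show "(\<integral>\<^sup>+x. ennreal (real K powr p) \<partial>?N) < \<infinity>" by (rule nn_integral_const_lebesgue_on_Icc)
      qed (use cl_bnd p in auto)
    qed measurable
  qed
  show ?thesis
  proof (rule step_approximable_limit[OF p, where u="\<lambda>K x. cl K (f x)"])
    show "(\<lambda>K. \<integral>\<^sup>+x. ennreal (\<bar>cl K (f x) - f x\<bar> powr p) \<partial>?N) \<longlonglongrightarrow> 0"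
    proof (rule nn_integral_powr_tendsto[where g="\<lambda>x. \<bar>f x\<bar>"])
      show "AE x in ?N. (\<lambda>K. cl K (f x)) \<longlonglongrightarrow> f x"
      proof (rule AE_I2)
        fix x
        obtain K0 :: nat where "\<bar>f x\<bar> \<le> real K0" using real_arch_simple by blast
        then have "cl K (f x) = f x" if "K0 \<le> K" for K using that by (auto simp: cl_def)
        then show "(\<lambda>K. cl K (f x)) \<longlonglongrightarrow> f x"
          by (intro tendsto_eventually) (auto simp: eventually_sequentially)
      qed
      show "(\<integral>\<^sup>+x. ennreal (\<bar>f x\<bar> powr p) \<partial>?N) < \<infinity>" using f by (simp add: in_Lp_def)
    qed (use p in \<open>auto simp: cl_def\<close>)
  qed (use bdd in measurable)
qed

section \<open>Approximating sequences for kernels and their integrals\<close>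

lemma step_fun_in_Lp: "in_Lp (lebesgue_on {0..t}) p (step_fun n a s)" if "0 < p"
proof -
  have "(\<integral>\<^sup>+x. ennreal (norm (step_fun n a s x) powr p) \<partial>lebesgue_on {0..t})
     \<le> (\<integral>\<^sup>+x. ennreal ((\<Sum>j<n. \<bar>a j\<bar>) powr p) \<partial>lebesgue_on {0..t})"
    using that by (intro nn_integral_mono ennreal_leI powr_mono2) (auto intro: abs_step_fun_le)
  also have "\<dots> < \<infinity>" by (rule nn_integral_const_lebesgue_on_Icc)
  finally show ?thesis by (simp add: in_Lp_def borel_lebesgue_on step_fun_measurable)
qed

text \<open>The defining condition of the Levy integral quantifies over approximating sequences;
  existence of one such sequence keeps it from being vacuous and allows it to be applied.\<close>

lemma Lp_step_approximation:
  assumes p: "0 < p" and t: "0 \<le> t" and f: "in_Lp (lebesgue_on {0..t}) p f"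
  shows "\<exists>n a s. (\<forall>m. step_nodes t (n m) (s m)) \<and>
    Lp_tendsto (lebesgue_on {0..t}) p (\<lambda>m. step_fun (n m) (a m) (s m)) f"
proof -
  let ?N = "lebesgue_on {0..t}"
  have "\<forall>m. \<exists>n a s. step_nodes t n s \<and>
      (\<integral>\<^sup>+x. ennreal (\<bar>step_fun n a s x - f x\<bar> powr p) \<partial>?N) < ennreal (1 / real (Suc m))"
  proof
    fix m :: nat
    have "0 < 1 / real (Suc m)" by simp
    then show "\<exists>n a s. step_nodes t n s \<and>
      (\<integral>\<^sup>+x. ennreal (\<bar>step_fun n a s x - f x\<bar> powr p) \<partial>?N) < ennreal (1 / real (Suc m))"
      using step_approximable_Lp[OF assms] unfolding step_approximable_def by blast
  qed
  then obtain n a s where nas: "\<And>m. step_nodes t (n m) (s m)"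
    "\<And>m. (\<integral>\<^sup>+x. ennreal (\<bar>step_fun (n m) (a m) (s m) x - f x\<bar> powr p) \<partial>?N) < ennreal (1 / real (Suc m))"
    by metis
  have "(\<lambda>m. \<integral>\<^sup>+x. ennreal (\<bar>step_fun (n m) (a m) (s m) x - f x\<bar> powr p) \<partial>?N) \<longlonglongrightarrow> 0"
  proof (rule tendsto_sandwich[of "\<lambda>_. 0" _ _ "\<lambda>m. ennreal (1 / real (Suc m))"])
    have "(\<lambda>m. 1 / real (Suc m)) \<longlonglongrightarrow> 0"
      using LIMSEQ_inverse_real_of_nat by (simp add: inverse_eq_divide)
    from tendsto_ennrealI[OF this] show "(\<lambda>m. ennreal (1 / real (Suc m))) \<longlonglongrightarrow> 0" by simp
    show "\<forall>\<^sub>F m in sequentially. (\<integral>\<^sup>+x. ennreal (\<bar>step_fun (n m) (a m) (s m) x - f x\<bar> powr p) \<partial>?N) \<le> ennreal (1 / real (Suc m))"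
      using nas(2) by (intro always_eventually allI less_imp_le)
  qed auto
  then have "Lp_tendsto ?N p (\<lambda>m. step_fun (n m) (a m) (s m)) f"
    using f step_fun_in_Lp[OF p] by (simp add: Lp_tendsto_def)
  with nas(1) show ?thesis by blast
qed

text \<open>The p-th powers of the distances converge to 0 in L^1, also for p < 1, so the L^1 result
  on almost everywhere convergent subsequences applies to them.\<close>

lemma Lp_tendsto_AE_subseq:
  assumes lim: "Lp_tendsto M p u g" and p: "0 < p"
  obtains r :: "nat \<Rightarrow> nat" where "strict_mono r" "AE x in M. (\<lambda>n. u (r n) x) \<longlonglongrightarrow> g x"
proof -
  have [measurable]: "\<And>n. u n \<in> borel_measurable M" "g \<in> borel_measurable M"
    and fin: "\<And>n. (\<integral>\<^sup>+x. ennreal (norm (u n x) powr p) \<partial>M) < \<infinity>" "(\<integral>\<^sup>+x. ennreal (norm (g x) powr p) \<partial>M) < \<infinity>"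
    and conv: "(\<lambda>n. \<integral>\<^sup>+x. ennreal (norm (u n x - g x) powr p) \<partial>M) \<longlonglongrightarrow> 0"
    using lim by (auto simp: Lp_tendsto_def in_Lp_def)
  define w where "w = (\<lambda>n x. norm (u n x - g x) powr p)"
  have [measurable]: "w n \<in> borel_measurable M" for n unfolding w_def by measurable
  have wint: "integrable M (w n)" for n
  proof (rule integrableI_bounded)
    have "(\<integral>\<^sup>+x. ennreal (norm (w n x)) \<partial>M)
       \<le> (\<integral>\<^sup>+x. ennreal (2 powr p) * (ennreal (norm (u n x) powr p) + ennreal (norm (g x) powr p)) \<partial>M)"
    proof (rule nn_integral_mono)
      fix x
      have "norm (w n x) \<le> 2 powr p * (norm (u n x) powr p + norm (g x) powr p)"
        using norm_add_powr_le[OF p, of "u n x" "- g x"] by (simp add: w_def)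
      then have "ennreal (norm (w n x)) \<le> ennreal (2 powr p * (norm (u n x) powr p + norm (g x) powr p))"
        by (rule ennreal_leI)
      then show "ennreal (norm (w n x)) \<le> ennreal (2 powr p) * (ennreal (norm (u n x) powr p) + ennreal (norm (g x) powr p))"
        by (simp add: ennreal_mult)
    qed
    also have "\<dots> = ennreal (2 powr p) * ((\<integral>\<^sup>+x. ennreal (norm (u n x) powr p) \<partial>M) + (\<integral>\<^sup>+x. ennreal (norm (g x) powr p) \<partial>M))"
      by (simp add: nn_integral_cmult nn_integral_add)
    also have "\<dots> < \<infinity>" using fin by (simp add: ennreal_mult_less_top)
    finally show "(\<integral>\<^sup>+x. ennreal (norm (w n x)) \<partial>M) < \<infinity>" .
  qed measurable
  have "(\<lambda>n. \<integral>x. norm (w n x) \<partial>M) \<longlonglongrightarrow> 0"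
  proof -
    have "ennreal (\<integral>x. norm (w n x) \<partial>M) = (\<integral>\<^sup>+x. ennreal (norm (u n x - g x) powr p) \<partial>M)" for n
      using nn_integral_eq_integral[OF integrable_norm[OF wint[of n]]] by (simp add: w_def)
    then have "(\<lambda>n. ennreal (\<integral>x. norm (w n x) \<partial>M)) \<longlonglongrightarrow> ennreal 0" using conv by simp
    then show ?thesis by (subst (asm) tendsto_ennreal_iff) auto
  qed
  from tendsto_L1_AE_subseq[OF wint this] obtain r :: "nat \<Rightarrow> nat" where r: "strict_mono r"
    "AE x in M. (\<lambda>n. w (r n) x) \<longlonglongrightarrow> 0" by blast
  have "AE x in M. (\<lambda>n. u (r n) x) \<longlonglongrightarrow> g x"
    using r(2)
  proof eventually_elim
    case (elim x)
    have "(\<lambda>n. w (r n) x powr (1 / p)) \<longlonglongrightarrow> 0"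
      using p by (intro tendsto_zero_powrI[OF elim tendsto_const]) (auto simp: w_def)
    then have "(\<lambda>n. norm (u (r n) x - g x)) \<longlonglongrightarrow> 0"
      using p by (simp add: w_def powr_powr)
    then show ?case by (simp add: LIM_zero_iff tendsto_norm_zero_iff)
  qed
  with r(1) show ?thesis by (rule that)
qed

text \<open>Two successive subsequences make the kernels and the integrals converge almost
  everywhere along the same sequence. Both are needed together: the kernels for the exponents of the
  characteristic functions, the integrals for the phases.\<close>

lemma levy_integral_approximation:
  assumes \<alpha>: "0 < \<alpha>" and t: "0 \<le> t" and f: "in_Lp (lebesgue_on {0..t}) \<alpha> f"
    and Y: "is_levy_integral M \<alpha> X t f Y"
  shows "Y \<in> borel_measurable M"
    and "\<exists>n a s. (\<forall>m. step_nodes t (n m) (s m)) \<and>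
      (AE x in lebesgue_on {0..t}. (\<lambda>m. step_fun (n m) (a m) (s m) x) \<longlonglongrightarrow> f x) \<and>
      (AE \<omega> in M. (\<lambda>m. step_integral X (n m) (a m) (s m) \<omega>) \<longlonglongrightarrow> Y \<omega>)"
proof -
  obtain n a s where nodes: "\<forall>m. step_nodes t (n m) (s m)"
    and lim: "Lp_tendsto (lebesgue_on {0..t}) \<alpha> (\<lambda>m. step_fun (n m) (a m) (s m)) f"
    using Lp_step_approximation[OF \<alpha> t f] by (elim exE conjE) (rule that)
  obtain p where p: "0 < p" and limY: "Lp_tendsto M p (\<lambda>m. step_integral X (n m) (a m) (s m)) Y"
  proof -
    obtain p where p: "p \<in> {0<..\<alpha>}" and all: "\<forall>n a s. (\<forall>m. step_nodes t (n m) (s m)) \<and>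
        Lp_tendsto (lebesgue_on {0..t}) \<alpha> (\<lambda>m. step_fun (n m) (a m) (s m)) f \<longrightarrow>
        Lp_tendsto M p (\<lambda>m. step_integral X (n m) (a m) (s m)) Y"
      using Y unfolding is_levy_integral_def by (elim bexE) (rule that)
    have "Lp_tendsto M p (\<lambda>m. step_integral X (n m) (a m) (s m)) Y"
      using all[THEN spec[of _ n], THEN spec[of _ a], THEN spec[of _ s]] nodes lim by blast
    then show ?thesis using p that[of p] by simp
  qed
  obtain r where r: "strict_mono r"
    "AE x in lebesgue_on {0..t}. (\<lambda>m. step_fun (n (r m)) (a (r m)) (s (r m)) x) \<longlonglongrightarrow> f x"
    by (rule Lp_tendsto_AE_subseq[OF lim \<alpha>])
  have "Lp_tendsto M p (\<lambda>m. step_integral X (n (r m)) (a (r m)) (s (r m))) Y"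
    using limY LIMSEQ_subseq_LIMSEQ[OF _ r(1)] unfolding Lp_tendsto_def by (auto simp: o_def)
  then obtain q where q: "strict_mono q"
    "AE \<omega> in M. (\<lambda>m. step_integral X (n (r (q m))) (a (r (q m))) (s (r (q m))) \<omega>) \<longlonglongrightarrow> Y \<omega>"
    by (rule Lp_tendsto_AE_subseq[OF _ p])
  show "Y \<in> borel_measurable M" using limY by (simp add: Lp_tendsto_def in_Lp_def)
  have "AE x in lebesgue_on {0..t}. (\<lambda>m. step_fun (n (r (q m))) (a (r (q m))) (s (r (q m))) x) \<longlonglongrightarrow> f x"
    using r(2)
  proof eventually_elim
    case (elim x)
    from LIMSEQ_subseq_LIMSEQ[OF elim q(1)] show ?case by (simp add: o_def)
  qed
  with nodes q(2) show "\<exists>n a s. (\<forall>m. step_nodes t (n m) (s m)) \<and>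
      (AE x in lebesgue_on {0..t}. (\<lambda>m. step_fun (n m) (a m) (s m) x) \<longlonglongrightarrow> f x) \<and>
      (AE \<omega> in M. (\<lambda>m. step_integral X (n m) (a m) (s m) \<omega>) \<longlonglongrightarrow> Y \<omega>)"
    by (intro exI[of _ "\<lambda>m. n (r (q m))"] exI[of _ "\<lambda>m. a (r (q m))"] exI[of _ "\<lambda>m. s (r (q m))"]) auto
qed

section \<open>Moments of time integrals of a decorrelating field\<close>

lemma (in finite_measure) integrable_bounded:
  fixes f :: "'a \<Rightarrow> 'b::{banach, second_countable_topology}"
  assumes "f \<in> borel_measurable M" "\<And>x. x \<in> space M \<Longrightarrow> norm (f x) \<le> B"
  shows "integrable M f"
  by (rule integrable_const_bound[where B=B]) (use assms in auto)

lemma integral_norm_bound_AE: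
  fixes f :: "'a \<Rightarrow> 'b::{banach, second_countable_topology}"
  assumes "integrable M g" "AE x in M. norm (f x) \<le> g x"
  shows "norm (integral\<^sup>L M f) \<le> integral\<^sup>L M g"
proof (cases "integrable M f")
  case True
  have "norm (integral\<^sup>L M f) \<le> (\<integral>x. norm (f x) \<partial>M)" by (rule integral_norm_bound)
  also have "\<dots> \<le> integral\<^sup>L M g" using True assms by (intro integral_mono_AE) auto
  finally show ?thesis .
next
  case False
  have "0 \<le> integral\<^sup>L M g"
    using assms(2) by (intro integral_nonneg_AE) (auto elim!: eventually_mono intro: order_trans[OF norm_ge_zero])
  then show ?thesis using False by (simp add: not_integrable_integral_eq)
qed

lemmas integral_abs_bound_AE = integral_norm_bound_AE[where 'b=real, unfolded real_norm_def]

text \<open>Measurability of the identity into the Borel sets leaves room for a larger sigma-algebra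
  on the time axis; the intended time measure is Lebesgue measure on an interval. The number
  \<open>s\<close> is the left end of all time integrals.\<close>

locale bounded_field =
  N: finite_measure N + M: prob_space M
  for N :: "real measure" and M :: "'w measure" +
  fixes f :: "real \<times> 'w \<Rightarrow> real" and s :: real
  assumes id_measurable[measurable]: "(\<lambda>x. x) \<in> borel_measurable N"
    and f_measurable[measurable]: "f \<in> borel_measurable (N \<Otimes>\<^sub>M M)"
    and f_bound: "\<bar>f x\<bar> \<le> 1"
begin

sublocale NM: pair_sigma_finite N M ..
sublocale P: finite_measure "N \<Otimes>\<^sub>M M"
  by (intro finite_measure_pair_measure) unfold_locales

text \<open>Cutting off before \<open>s\<close> turns the integral over [s, r] into one over {..r},
  the form in which \<open>power_primitive\<close> applies.\<close>

definition \<phi> :: "real \<Rightarrow> 'w \<Rightarrow> real" where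
  "\<phi> u \<omega> = (if s \<le> u then f (u, \<omega>) else 0)"

definition S :: "real \<Rightarrow> 'w \<Rightarrow> real" where
  "S r \<omega> = (\<integral>u. indicator {..r} u * \<phi> u \<omega> \<partial>N)"

lemma \<phi>_pair_measurable[measurable]: "(\<lambda>(r, \<omega>). \<phi> r \<omega>) \<in> borel_measurable (N \<Otimes>\<^sub>M M)"
  unfolding \<phi>_def by measurable

lemma \<phi>_measurable: "\<omega> \<in> space M \<Longrightarrow> (\<lambda>u. \<phi> u \<omega>) \<in> borel_measurable N"
  unfolding \<phi>_def by measurable

lemma \<phi>_bound: "\<bar>\<phi> u \<omega>\<bar> \<le> 1"
  using f_bound by (simp add: \<phi>_def)

lemma \<phi>_integrable: "\<omega> \<in> space M \<Longrightarrow> integrable N (\<lambda>u. \<phi> u \<omega>)"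
  by (rule N.integrable_bounded[where B=1]) (auto simp: \<phi>_measurable \<phi>_bound)

lemma S_pair_measurable[measurable]: "(\<lambda>(r, \<omega>). S r \<omega>) \<in> borel_measurable (N \<Otimes>\<^sub>M M)"
  unfolding S_def \<phi>_def atMost_def indicator_def mem_Collect_eq by measurable

lemma S_measurable[measurable]: "S r \<in> borel_measurable M"
  unfolding S_def[abs_def] \<phi>_def atMost_def indicator_def mem_Collect_eq by measurable

definition B :: real where "B = measure N (space N)"

lemma B_nonneg: "0 \<le> B" by (simp add: B_def)

lemma S_bound: "\<bar>S r \<omega>\<bar> \<le> B"
proof -
  have "norm (S r \<omega>) \<le> (\<integral>u. 1 \<partial>N)" unfolding S_def
  proof (rule integral_norm_bound_AE)
    show "AE u in N. norm (indicator {..r} u * \<phi> u \<omega>) \<le> 1"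
      using \<phi>_bound by (auto split: split_indicator)
  qed auto
  then show ?thesis by (simp add: B_def)
qed

lemma S_power_bound: "\<bar>S r \<omega> ^ n\<bar> \<le> B ^ n"
  unfolding power_abs using S_bound by (intro power_mono) auto

text \<open>\<open>power_primitive\<close> for each \<omega>, followed by Fubini. The factor
  \<open>H\<close> allows a second use: once with \<open>H\<close> constant, and once with
  \<open>H\<close> the field at the time already extracted.\<close>

lemma expectation_S_power:
  assumes atom: "\<And>x. emeasure N ({x} \<inter> space N) = 0"
    and H[measurable]: "H \<in> borel_measurable M" "\<And>\<omega>. \<omega> \<in> space M \<Longrightarrow> norm (H \<omega>) \<le> C"
  shows "(\<integral>\<omega>. S r \<omega> ^ Suc n * H \<omega> \<partial>M)
    = Suc n * (\<integral>u. indicator {s..r} u * (\<integral>\<omega>. S u \<omega> ^ n * f (u, \<omega>) * H \<omega> \<partial>M) \<partial>N)"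
proof -
  have "(\<integral>\<omega>. S r \<omega> ^ Suc n * H \<omega> \<partial>M)
      = (\<integral>\<omega>. Suc n * (\<integral>u. indicator {..r} u * \<phi> u \<omega> * S u \<omega> ^ n * H \<omega> \<partial>N) \<partial>M)"
  proof (rule Bochner_Integration.integral_cong[OF refl])
    fix \<omega> assume "\<omega> \<in> space M"
    from power_primitive(2)[OF N.sigma_finite_measure id_measurable atom \<phi>_integrable[OF this], of r n]
    show "S r \<omega> ^ Suc n * H \<omega> = Suc n * (\<integral>u. indicator {..r} u * \<phi> u \<omega> * S u \<omega> ^ n * H \<omega> \<partial>N)"
      unfolding S_def integral_mult_left_zero by (simp only: mult.assoc)
  qed
  also have "\<dots> = Suc n * (\<integral>\<omega>. (\<integral>u. indicator {..r} u * \<phi> u \<omega> * S u \<omega> ^ n * H \<omega> \<partial>N) \<partial>M)"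
    by (rule integral_mult_right_zero)
  also have "(\<integral>\<omega>. (\<integral>u. indicator {..r} u * \<phi> u \<omega> * S u \<omega> ^ n * H \<omega> \<partial>N) \<partial>M)
      = (\<integral>u. (\<integral>\<omega>. indicator {..r} u * \<phi> u \<omega> * S u \<omega> ^ n * H \<omega> \<partial>M) \<partial>N)"
  proof (rule NM.Fubini_integral)
    show "integrable (N \<Otimes>\<^sub>M M) (\<lambda>(u, \<omega>). indicator {..r} u * \<phi> u \<omega> * S u \<omega> ^ n * H \<omega>)"
    proof (rule P.integrable_bounded[where B="B ^ n * C"])
      show "(\<lambda>(u, \<omega>). indicator {..r} u * \<phi> u \<omega> * S u \<omega> ^ n * H \<omega>) \<in> borel_measurable (N \<Otimes>\<^sub>M M)"
        unfolding atMost_def indicator_def mem_Collect_eq by measurable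
      fix x assume x: "x \<in> space (N \<Otimes>\<^sub>M M)"
      then have w: "snd x \<in> space M" by (auto simp: space_pair_measure)
      have "\<bar>indicator {..r} (fst x) * \<phi> (fst x) (snd x) * S (fst x) (snd x) ^ n * H (snd x)\<bar> \<le> 1 * 1 * B ^ n * C"
        unfolding abs_mult using w \<phi>_bound H(2)[OF w] S_power_bound B_nonneg
        by (intro mult_mono) (auto split: split_indicator)
      then show "norm (case x of (u, \<omega>) \<Rightarrow> indicator {..r} u * \<phi> u \<omega> * S u \<omega> ^ n * H \<omega>) \<le> B ^ n * C"
        by (simp add: split_beta)
    qed
  qed
  also have "\<dots> = (\<integral>u. indicator {s..r} u * (\<integral>\<omega>. S u \<omega> ^ n * f (u, \<omega>) * H \<omega> \<partial>M) \<partial>N)"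
    unfolding integral_mult_right_zero[symmetric]
    by (intro Bochner_Integration.integral_cong) (auto simp: \<phi>_def split: split_indicator)
  finally show ?thesis .
qed

text \<open>The iterated primitive formula expresses \<open>E S\<^sup>2\<^sup>m\<^sup>+\<^sup>2\<close> through \<open>E S\<^sup>2\<^sup>m f(u) f(v)\<close> with
  \<open>u < v\<close>, so that decorrelation is only needed for the last time \<open>v\<close>.\<close>

lemma moment_bound:
  assumes atom: "\<And>x. emeasure N ({x} \<inter> space N) = 0"
    and dec: "\<And>n u v. s \<le> u \<Longrightarrow> u < v \<Longrightarrow> v \<le> t \<Longrightarrow> u \<in> space N \<Longrightarrow> v \<in> space N \<Longrightarrow>
       \<bar>\<integral>\<omega>. S u \<omega> ^ (2 * n) * f (u, \<omega>) * f (v, \<omega>) \<partial>M\<bar> \<le> (\<integral>\<omega>. S u \<omega> ^ (2 * n) \<partial>M) * g (v - u)"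
    and g: "\<And>v. s \<le> v \<Longrightarrow> v \<le> t \<Longrightarrow> integrable N (\<lambda>u. indicator {s..v} u * g (v - u))"
       "\<And>v. s \<le> v \<Longrightarrow> v \<le> t \<Longrightarrow> (\<integral>u. indicator {s..v} u * g (v - u) \<partial>N) \<le> G" "\<And>x. 0 \<le> g x"
    and L: "(\<integral>u. indicator {s..t} u \<partial>N) \<le> L" and G: "0 \<le> G"
  shows "r \<le> t \<Longrightarrow> (\<integral>\<omega>. S r \<omega> ^ (2 * m) \<partial>M) \<le> fact (2 * m) * (L * G) ^ m"
proof (induction m arbitrary: r)
  case 0
  show ?case by (simp add: M.prob_space)
next
  case (Suc m)
  define K where "K = fact (2 * m) * (L * G) ^ m"
  have L0: "0 \<le> L" by (rule order_trans[OF _ L]) (auto intro: Bochner_Integration.integral_nonneg)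
  have K0: "0 \<le> K" using L0 G by (simp add: K_def)
  have ind_meas[measurable]: "(\<lambda>u. indicator {a..b} u :: real) \<in> borel_measurable N" for a b :: real
    unfolding atLeastAtMost_iff indicator_def by measurable
  have ind_int: "integrable N (\<lambda>u. indicator {a..b} u :: real)" for a b :: real
    by (rule N.integrable_bounded[where B=1]) (auto split: split_indicator)
  define E2 where "E2 = (\<lambda>u v. \<integral>\<omega>. S u \<omega> ^ (2 * m) * f (u, \<omega>) * f (v, \<omega>) \<partial>M)"
  define E1 where "E1 = (\<lambda>v. \<integral>\<omega>. S v \<omega> ^ Suc (2 * m) * f (v, \<omega>) \<partial>M)"
  \<comment> \<open>With the last time v frozen, one more application of the primitive formula
    leaves the even power 2m at time u. Being nonnegative, its expectation is a moment to which the
    induction hypothesis applies; integrating g (v - u) over u yields \<open>G\<close>.\<close>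
  have E1_le: "\<bar>E1 v\<bar> \<le> Suc (2 * m) * (K * G)" if v: "s \<le> v" "v \<le> t" "v \<in> space N" for v
  proof -
    have [measurable]: "(\<lambda>\<omega>. f (v, \<omega>)) \<in> borel_measurable M" using v(3) by measurable
    have E1_eq: "E1 v = Suc (2 * m) * (\<integral>u. indicator {s..v} u * E2 u v \<partial>N)"
      unfolding E1_def E2_def by (rule expectation_S_power[OF atom, where C=1]) (auto simp: f_bound)
    have E2_le: "\<bar>E2 u v\<bar> \<le> K * g (v - u)" if u: "s \<le> u" "u < v" "u \<in> space N" for u
    proof -
      have "\<bar>E2 u v\<bar> \<le> (\<integral>\<omega>. S u \<omega> ^ (2 * m) \<partial>M) * g (v - u)"
        unfolding E2_def using u v by (intro dec) auto
      also have "\<dots> \<le> K * g (v - u)"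
        using Suc.IH[of u] u v g(3) by (intro mult_right_mono) (auto simp: K_def)
      finally show ?thesis .
    qed
    have "\<bar>\<integral>u. indicator {s..v} u * E2 u v \<partial>N\<bar> \<le> (\<integral>u. K * (indicator {s..v} u * g (v - u)) \<partial>N)"
    proof (rule integral_abs_bound_AE)
      have "AE u in N. u \<noteq> v" using id_measurable atom by (rule AE_neq_atomless)
      then show "AE u in N. \<bar>indicator {s..v} u * E2 u v\<bar> \<le> K * (indicator {s..v} u * g (v - u))"
      proof (rule AE_mp[OF _ AE_I2], intro impI)
        fix u assume "u \<in> space N" "u \<noteq> v"
        then show "\<bar>indicator {s..v} u * E2 u v\<bar> \<le> K * (indicator {s..v} u * g (v - u))"
          using E2_le[of u] by (auto split: split_indicator)
      qed
      show "integrable N (\<lambda>u. K * (indicator {s..v} u * g (v - u)))" using g(1)[OF v(1,2)] by simp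
    qed
    also have "\<dots> \<le> K * G" using g(2)[OF v(1,2)] K0 by (simp add: mult_left_mono)
    finally show ?thesis unfolding E1_eq abs_mult by (simp add: mult_left_mono del: of_nat_Suc)
  qed
  have "(\<integral>\<omega>. S r \<omega> ^ (2 * Suc m) \<partial>M) = Suc (Suc (2 * m)) * (\<integral>v. indicator {s..r} v * E1 v \<partial>N)"
    using expectation_S_power[OF atom, of "\<lambda>_. 1" 1 r "Suc (2 * m)"] by (simp add: E1_def)
  also have "(\<integral>v. indicator {s..r} v * E1 v \<partial>N) \<le> (\<integral>v. (Suc (2 * m) * (K * G)) * indicator {s..t} v \<partial>N)"
  proof -
    have "\<bar>\<integral>v. indicator {s..r} v * E1 v \<partial>N\<bar> \<le> (\<integral>v. (Suc (2 * m) * (K * G)) * indicator {s..t} v \<partial>N)"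
    proof (rule integral_abs_bound_AE)
      have nn: "0 \<le> real (Suc (2 * m)) * (K * G)" using K0 G by simp
      show "AE v in N. \<bar>indicator {s..r} v * E1 v\<bar> \<le> (Suc (2 * m) * (K * G)) * indicator {s..t} v"
      proof (rule AE_I2)
        fix v assume "v \<in> space N"
        then show "\<bar>indicator {s..r} v * E1 v\<bar> \<le> (Suc (2 * m) * (K * G)) * indicator {s..t} v"
          using E1_le[of v] Suc.prems nn by (cases "s \<le> v \<and> v \<le> r") (auto split: split_indicator)
      qed
      show "integrable N (\<lambda>v. (Suc (2 * m) * (K * G)) * indicator {s..t} v)" using ind_int by simp
    qed
    then show ?thesis by simp
  qed
  also have "\<dots> \<le> (Suc (2 * m) * (K * G)) * L"
    unfolding integral_mult_right_zero using L K0 G by (intro mult_left_mono) auto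
  finally have "(\<integral>\<omega>. S r \<omega> ^ (2 * Suc m) \<partial>M) \<le> Suc (Suc (2 * m)) * ((Suc (2 * m) * (K * G)) * L)"
    by (simp add: mult_left_mono)
  \<comment> \<open>Each application of the primitive formula contributes its exponent: (2m + 2) (2m
    + 1) (2m)! = (2m + 2)!.\<close>
  also have "\<dots> = fact (2 * Suc m) * (L * G) ^ Suc m"
    by (simp add: K_def algebra_simps)
  finally show ?case .
qed

text \<open>\<open>S r\<close> is not known to be \<open>\<FF>\<close>-measurable, as only each single \<open>f (u, _)\<close> is (up to null sets); the
  factorisation is therefore moved under the time integrals by Fubini, one power at a time.\<close>

lemma factor_power:
  fixes e :: "'w \<Rightarrow> complex" and c :: complex
  assumes sub: "subalgebra M \<FF>"
    and adapted: "\<And>u. s \<le> u \<Longrightarrow> u \<le> r \<Longrightarrow> u \<in> space N \<Longrightarrow> 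
        \<exists>h\<in>borel_measurable \<FF>. (\<forall>\<omega>. \<bar>h \<omega>\<bar> \<le> 1) \<and> (AE \<omega> in M. f (u, \<omega>) = h \<omega>)"
    and e[measurable]: "e \<in> borel_measurable M" "\<And>\<omega>. cmod (e \<omega>) \<le> 1"
    and factor: "\<And>H. H \<in> borel_measurable \<FF> \<Longrightarrow> (\<And>\<omega>. cmod (H \<omega>) \<le> 1) \<Longrightarrow>
        (CLINT \<omega>|M. H \<omega> * e \<omega>) = c * (CLINT \<omega>|M. H \<omega>)"
    and H: "H \<in> borel_measurable \<FF>" "\<And>\<omega>. cmod (H \<omega>) \<le> 1"
  shows "(CLINT \<omega>|M. of_real (S r \<omega> ^ n) * H \<omega> * e \<omega>) = c * (CLINT \<omega>|M. of_real (S r \<omega> ^ n) * H \<omega>)"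
  using H
proof (induction n arbitrary: H)
  case 0
  then show ?case using factor by simp
next
  case (Suc n)
  have [measurable]: "H \<in> borel_measurable M" by (rule measurable_from_subalg[OF sub Suc.prems(1)])
  \<comment> \<open>Here one factor of the power is written as a time integral while the others keep
    the same upper limit r. Unlike in the moment bound no time ordering is needed, as all times up
    to r belong to the past.\<close>
  have exchange: "(CLINT \<omega>|M. of_real (S r \<omega> ^ Suc n) * E \<omega>)
      = (CLINT u|N. of_real (indicator {s..r} u) * (CLINT \<omega>|M. of_real (S r \<omega> ^ n) * of_real (f (u, \<omega>)) * E \<omega>))"
    if [measurable]: "E \<in> borel_measurable M" and E: "\<And>\<omega>. cmod (E \<omega>) \<le> 1" for E
  proof -
    have "(CLINT \<omega>|M. of_real (S r \<omega> ^ Suc n) * E \<omega>)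
        = (CLINT \<omega>|M. CLINT u|N. of_real (indicator {..r} u * \<phi> u \<omega>) * (of_real (S r \<omega> ^ n) * E \<omega>))"
    proof (rule Bochner_Integration.integral_cong[OF refl])
      fix \<omega>
      have "of_real (S r \<omega>) = (CLINT u|N. complex_of_real (indicator {..r} u * \<phi> u \<omega>))"
        unfolding S_def by (rule integral_complex_of_real[symmetric])
      then show "of_real (S r \<omega> ^ Suc n) * E \<omega>
          = (CLINT u|N. of_real (indicator {..r} u * \<phi> u \<omega>) * (of_real (S r \<omega> ^ n) * E \<omega>))"
        unfolding integral_mult_left_zero by (simp only: power_Suc of_real_mult mult.assoc)
    qed
    also have "\<dots> = (CLINT u|N. CLINT \<omega>|M. of_real (indicator {..r} u * \<phi> u \<omega>) * (of_real (S r \<omega> ^ n) * E \<omega>))"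
    proof (rule NM.Fubini_integral)
      show "complex_integrable (N \<Otimes>\<^sub>M M) (\<lambda>(u, \<omega>). of_real (indicator {..r} u * \<phi> u \<omega>) * (of_real (S r \<omega> ^ n) * E \<omega>))"
      proof (rule P.integrable_bounded[where B="B ^ n"])
        show "(\<lambda>(u, \<omega>). complex_of_real (indicator {..r} u * \<phi> u \<omega>) * (of_real (S r \<omega> ^ n) * E \<omega>)) \<in> borel_measurable (N \<Otimes>\<^sub>M M)"
          unfolding atMost_def indicator_def mem_Collect_eq by measurable
        fix x assume x: "x \<in> space (N \<Otimes>\<^sub>M M)"
        then have w: "snd x \<in> space M" by (auto simp: space_pair_measure)
        have "\<bar>indicator {..r} (fst x) * \<phi> (fst x) (snd x)\<bar> * (\<bar>S r (snd x) ^ n\<bar> * cmod (E (snd x))) \<le> 1 * (B ^ n * 1)"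
          using w \<phi>_bound E S_power_bound B_nonneg
          by (intro mult_mono) (auto split: split_indicator)
        then show "cmod (case x of (u, \<omega>) \<Rightarrow> of_real (indicator {..r} u * \<phi> u \<omega>) * (of_real (S r \<omega> ^ n) * E \<omega>)) \<le> B ^ n"
          by (simp add: split_beta norm_mult abs_mult norm_power power_abs)
      qed
    qed
    also have "\<dots> = (CLINT u|N. of_real (indicator {s..r} u) * (CLINT \<omega>|M. of_real (S r \<omega> ^ n) * of_real (f (u, \<omega>)) * E \<omega>))"
      unfolding integral_mult_right_zero[symmetric]
      by (intro Bochner_Integration.integral_cong) (auto simp: \<phi>_def split: split_indicator)
    finally show ?thesis .
  qed
  have inner: "of_real (indicator {s..r} u) * (CLINT \<omega>|M. of_real (S r \<omega> ^ n) * of_real (f (u, \<omega>)) * (H \<omega> * e \<omega>))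
     = c * (of_real (indicator {s..r} u) * (CLINT \<omega>|M. of_real (S r \<omega> ^ n) * of_real (f (u, \<omega>)) * H \<omega>))"
    if u: "u \<in> space N" for u
  proof (cases "s \<le> u \<and> u \<le> r")
    case True
    then obtain h where h[measurable]: "h \<in> borel_measurable \<FF>" and hb: "\<And>\<omega>. \<bar>h \<omega>\<bar> \<le> 1"
      and ae: "AE \<omega> in M. f (u, \<omega>) = h \<omega>"
      using adapted u by blast
    have hM[measurable]: "h \<in> borel_measurable M" by (rule measurable_from_subalg[OF sub h])
    have [measurable]: "(\<lambda>\<omega>. f (u, \<omega>)) \<in> borel_measurable M" using u by measurable
    have repl: "(CLINT \<omega>|M. of_real (S r \<omega> ^ n) * of_real (f (u, \<omega>)) * E \<omega>)
        = (CLINT \<omega>|M. of_real (S r \<omega> ^ n) * (of_real (h \<omega>) * E \<omega>))"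
      if [measurable]: "E \<in> borel_measurable M" for E
    proof (rule integral_cong_AE)
      show "AE \<omega> in M. complex_of_real (S r \<omega> ^ n) * of_real (f (u, \<omega>)) * E \<omega> = of_real (S r \<omega> ^ n) * (of_real (h \<omega>) * E \<omega>)"
        using ae by eventually_elim simp
    qed measurable
    \<comment> \<open>The version h of the field at time u is absorbed into \<open>H\<close>, which
      remains measurable for the past and bounded by 1. This is why the induction runs over
      arbitrary \<open>H\<close>.\<close>
    have bnd: "cmod (of_real (h \<omega>) * H \<omega>) \<le> 1" for \<omega>
      using mult_mono[OF hb Suc.prems(2)[of \<omega>]] by (simp add: norm_mult)
    have "(CLINT \<omega>|M. of_real (S r \<omega> ^ n) * (of_real (h \<omega>) * H \<omega>) * e \<omega>)
       = c * (CLINT \<omega>|M. of_real (S r \<omega> ^ n) * (of_real (h \<omega>) * H \<omega>))"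
    proof (rule Suc.IH[OF _ bnd])
      note [measurable] = Suc.prems(1)
      show "(\<lambda>\<omega>. complex_of_real (h \<omega>) * H \<omega>) \<in> borel_measurable \<FF>" by measurable
    qed
    moreover have "(CLINT \<omega>|M. of_real (S r \<omega> ^ n) * of_real (f (u, \<omega>)) * (H \<omega> * e \<omega>))
        = (CLINT \<omega>|M. of_real (S r \<omega> ^ n) * (of_real (h \<omega>) * (H \<omega> * e \<omega>)))"
      by (rule repl) measurable
    moreover have "(CLINT \<omega>|M. of_real (S r \<omega> ^ n) * of_real (f (u, \<omega>)) * H \<omega>)
        = (CLINT \<omega>|M. of_real (S r \<omega> ^ n) * (of_real (h \<omega>) * H \<omega>))"
      by (rule repl) measurable
    ultimately show ?thesis by (simp only: mult_ac)
  qed auto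
  have "(CLINT \<omega>|M. of_real (S r \<omega> ^ Suc n) * (H \<omega> * e \<omega>))
     = (CLINT u|N. of_real (indicator {s..r} u) * (CLINT \<omega>|M. of_real (S r \<omega> ^ n) * of_real (f (u, \<omega>)) * (H \<omega> * e \<omega>)))"
  proof (rule exchange)
    show "cmod (H \<omega> * e \<omega>) \<le> 1" for \<omega>
      using mult_mono[OF Suc.prems(2)[of \<omega>] e(2)[of \<omega>]] by (simp add: norm_mult)
  qed measurable
  also have "\<dots> = (CLINT u|N. c * (of_real (indicator {s..r} u) * (CLINT \<omega>|M. of_real (S r \<omega> ^ n) * of_real (f (u, \<omega>)) * H \<omega>)))"
    by (rule Bochner_Integration.integral_cong[OF refl]) (rule inner)
  also have "\<dots> = c * (CLINT \<omega>|M. of_real (S r \<omega> ^ Suc n) * H \<omega>)"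
    unfolding integral_mult_right_zero using exchange[of H] Suc.prems(2) by simp
  finally show ?case by (simp only: mult.assoc)
qed

end

section \<open>Increments of a Levy process\<close>

locale levy =
  fixes T :: real and M :: "'w measure" and F :: "real \<Rightarrow> 'w measure"
    and X :: "real \<Rightarrow> 'w \<Rightarrow> 'v::euclidean_space" and \<psi> :: "'v \<Rightarrow> complex"
  assumes T_pos: "0 < T"
    and X_levy: "levy_process T M F X"
    and X_char: "levy_characteristic T M X \<psi>"
begin

lemma filtered: "filtered_prob_space T M F"
  using X_levy by (simp add: levy_process_def)

sublocale prob_space M
  using filtered by (simp add: filtered_prob_space_def)

lemma subalg: "t \<in> {0..T} \<Longrightarrow> subalgebra M (F t)"
  using filtered by (simp add: filtered_prob_space_def)

lemma F_mono: "s \<in> {0..T} \<Longrightarrow> t \<in> {s..T} \<Longrightarrow> subalgebra (F t) (F s)"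
proof -
  assume s: "s \<in> {0..T}" and t: "t \<in> {s..T}"
  have "sets (F s) \<subseteq> sets (F t)" using filtered s t unfolding filtered_prob_space_def by blast
  moreover have "space (F s) = space (F t)"
    using subalg[of s] subalg[of t] s t by (auto simp: subalgebra_def)
  ultimately show ?thesis by (simp add: subalgebra_def)
qed

lemma X_adapted: "s \<in> {0..T} \<Longrightarrow> t \<in> {s..T} \<Longrightarrow> X s \<in> borel_measurable (F t)"
  using X_levy measurable_from_subalg[OF F_mono] unfolding levy_process_def by blast

lemma X_measurable: "t \<in> {0..T} \<Longrightarrow> X t \<in> borel_measurable M"
  using measurable_from_subalg[OF subalg X_adapted] by auto

lemma increment_char:
  assumes "0 \<le> s" "s \<le> t" "t \<le> T"
  shows "(CLINT \<omega>|M. iexp (\<xi> \<bullet> (X t \<omega> - X s \<omega>))) = exp (- (of_real (t - s) * \<psi> \<xi>))"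
proof -
  define h where "h = t - s"
  have h: "0 \<le> h" "h \<le> T" "s + h = t" using assms by (auto simp: h_def)
  have [measurable]: "X t \<in> borel_measurable M" "X s \<in> borel_measurable M" "X h \<in> borel_measurable M" "X 0 \<in> borel_measurable M"
    using assms h T_pos by (auto intro!: X_measurable)
  have "0 \<le> s \<and> 0 \<le> (0::real) \<and> 0 \<le> h \<and> s + h \<le> T \<and> 0 + h \<le> T" using assms h by auto
  then have D: "distr M borel (\<lambda>\<omega>. X (s + h) \<omega> - X s \<omega>) = distr M borel (\<lambda>\<omega>. X (0 + h) \<omega> - X 0 \<omega>)"
    using X_levy unfolding levy_process_def by blast
  have "(CLINT \<omega>|M. iexp (\<xi> \<bullet> (X t \<omega> - X s \<omega>)))
      = (CLINT x|distr M borel (\<lambda>\<omega>. X (s + h) \<omega> - X s \<omega>). iexp (\<xi> \<bullet> x))"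
    unfolding h(3) by (rule integral_distr[symmetric]) measurable
  also have "\<dots> = (CLINT \<omega>|M. iexp (\<xi> \<bullet> (X h \<omega> - X 0 \<omega>)))"
    unfolding D by (subst integral_distr) auto
  also have "\<dots> = (CLINT \<omega>|M. iexp (\<xi> \<bullet> X h \<omega>))"
  proof (rule integral_cong_AE)
    have "AE \<omega> in M. X 0 \<omega> = 0" using X_levy by (simp add: levy_process_def)
    then show "AE \<omega> in M. iexp (\<xi> \<bullet> (X h \<omega> - X 0 \<omega>)) = iexp (\<xi> \<bullet> X h \<omega>)" by eventually_elim simp
  qed measurable
  also have "\<dots> = exp (- (of_real h * \<psi> \<xi>))"
    using X_char h unfolding levy_characteristic_def by simp
  finally show ?thesis by (simp add: h_def)
qed

lemma increment_indep:
  assumes s: "0 \<le> s" "s \<le> t" "t \<le> T"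
    and H: "H \<in> borel_measurable (F s)" "\<And>\<omega>. cmod (H \<omega>) \<le> 1"
  shows "(CLINT \<omega>|M. H \<omega> * iexp (\<xi> \<bullet> (X t \<omega> - X s \<omega>))) = (CLINT \<omega>|M. H \<omega>) * exp (- (of_real (t - s) * \<psi> \<xi>))"
proof -
  have sT: "s \<in> {0..T}" "t \<in> {s..T}" "t \<in> {0..T}" using s by auto
  define D where "D = (\<lambda>\<omega>. X t \<omega> - X s \<omega>)"
  have [measurable]: "X t \<in> borel_measurable M" "X s \<in> borel_measurable M" using sT by (auto intro!: X_measurable)
  have Dm[measurable]: "D \<in> borel_measurable M" unfolding D_def by measurable
  have Hm[measurable]: "H \<in> borel_measurable M" by (rule measurable_from_subalg[OF subalg[OF sT(1)] H(1)])
  have spF: "space (F s) = space M" "sets (F s) \<subseteq> sets M" using subalg[OF sT(1)] by (auto simp: subalgebra_def)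
  have ind: "indep_set (sets (F s)) (sets (vimage_algebra (space M) D borel))"
    using X_levy sT unfolding levy_process_def D_def by blast
  define V where "V = vimage_algebra (space M) D borel"
  have spV: "space V = space M" by (simp add: V_def)
  have "D \<in> borel_measurable V" unfolding V_def by (rule measurable_vimage_algebra1) auto
  then have YV: "(\<lambda>\<omega>. iexp (\<xi> \<bullet> D \<omega>)) \<in> borel_measurable V" by measurable
  \<comment> \<open>Independence is given for the sigma-algebra of the past and the one generated by
    the increment; it passes to the smaller ones generated by \<open>H\<close> and by the
    phase.\<close>
  have iv: "indep_var borel H borel (\<lambda>\<omega>. iexp (\<xi> \<bullet> D \<omega>))"
    unfolding indep_var_eq
  proof (intro conjI)
    have a: "sigma_sets (space M) {H -` A \<inter> space M |A. A \<in> sets borel} \<subseteq> sets (F s)"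
      unfolding spF(1)[symmetric]
      using H(1) by (intro sets.sigma_sets_subset) (auto simp: measurable_def)
    have b: "sigma_sets (space M) {(\<lambda>\<omega>. iexp (\<xi> \<bullet> D \<omega>)) -` A \<inter> space M |A. A \<in> sets borel} \<subseteq> sets V"
      unfolding spV[symmetric]
      using YV by (intro sets.sigma_sets_subset) (auto simp: measurable_def)
    show "indep_set (sigma_sets (space M) {H -` A \<inter> space M |A. A \<in> sets borel})
        (sigma_sets (space M) {(\<lambda>\<omega>. iexp (\<xi> \<bullet> D \<omega>)) -` A \<inter> space M |A. A \<in> sets borel})"
      unfolding indep_set_def
      by (rule indep_sets_mono_sets[OF ind[unfolded indep_set_def V_def[symmetric]]])
         (use a b in \<open>auto split: bool.split\<close>)
  qed measurable
  have "(CLINT \<omega>|M. H \<omega> * iexp (\<xi> \<bullet> D \<omega>)) = (CLINT \<omega>|M. H \<omega>) * (CLINT \<omega>|M. iexp (\<xi> \<bullet> D \<omega>))"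
  proof (rule indep_var_lebesgue_integral[OF iv])
    show "complex_integrable M H" by (rule integrable_bounded[where B=1]) (auto simp: H(2))
    show "complex_integrable M (\<lambda>\<omega>. iexp (\<xi> \<bullet> D \<omega>))" by (rule integrable_bounded[where B=1]) auto
  qed
  then show ?thesis using increment_char[OF s] by (simp add: D_def)
qed

lemma step_integral_adapted:
  assumes "\<And>j. j \<le> n \<Longrightarrow> s j \<in> {0..t}" "t \<le> T"
  shows "step_integral X n a s \<in> borel_measurable (F t)"
  unfolding step_integral_def[abs_def]
proof (intro borel_measurable_sum borel_measurable_scaleR borel_measurable_const borel_measurable_diff)
  fix j assume "j \<in> {..<n}"
  then show "X (s (Suc j)) \<in> borel_measurable (F t)" "X (s j) \<in> borel_measurable (F t)"
    using assms(1)[of j] assms(1)[of "Suc j"] assms(2) by (auto intro!: X_adapted)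
qed

text \<open>Increments are removed from the last one backwards: \<open>H\<close> times the phase of
  the earlier steps is measurable at the last left node and bounded by 1, so it is again an
  admissible factor for \<open>increment_indep\<close>.\<close>

lemma step_integral_char:
  assumes r: "0 \<le> r"
    and nodes: "\<And>j. j \<le> n \<Longrightarrow> s j \<in> {r..T}" "\<And>j. j < n \<Longrightarrow> s j \<le> s (Suc j)"
    and H: "H \<in> borel_measurable (F r)" "\<And>\<omega>. cmod (H \<omega>) \<le> 1"
  shows "(CLINT \<omega>|M. H \<omega> * iexp (\<xi> \<bullet> step_integral X n a s \<omega>))
    = (CLINT \<omega>|M. H \<omega>) * exp (- (\<Sum>j<n. of_real (s (Suc j) - s j) * \<psi> (a j *\<^sub>R \<xi>)))"
  using nodes
proof (induction n)
  case 0
  then show ?case by (simp add: step_integral_def)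
next
  case (Suc n)
  define H' where "H' = (\<lambda>\<omega>. H \<omega> * iexp (\<xi> \<bullet> step_integral X n a s \<omega>))"
  have mono: "s i \<le> s j" if "i \<le> j" "j \<le> n" for i j
    using that
  proof (induction j)
    case (Suc j)
    then show ?case using Suc.prems \<open>\<And>j. j < Suc n \<Longrightarrow> s j \<le> s (Suc j)\<close>[of j] by (cases "i = Suc j") auto
  qed simp
  have sn: "s n \<in> {r..T}" "s (Suc n) \<in> {r..T}" "s n \<le> s (Suc n)" using Suc.prems by auto
  have [measurable]: "step_integral X n a s \<in> borel_measurable (F (s n))"
    using Suc.prems(1) sn r mono by (intro step_integral_adapted) (auto intro: order_trans)
  have [measurable]: "H \<in> borel_measurable (F (s n))"
    using r sn by (intro measurable_from_subalg[OF F_mono H(1)]) auto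
  have H'm: "H' \<in> borel_measurable (F (s n))" unfolding H'_def by measurable
  have H'b: "cmod (H' \<omega>) \<le> 1" for \<omega> using H(2) by (simp add: H'_def norm_mult)
  have "(CLINT \<omega>|M. H \<omega> * iexp (\<xi> \<bullet> step_integral X (Suc n) a s \<omega>))
     = (CLINT \<omega>|M. H' \<omega> * iexp ((a n *\<^sub>R \<xi>) \<bullet> (X (s (Suc n)) \<omega> - X (s n) \<omega>)))"
    by (simp add: H'_def step_integral_def inner_add_right exp_add[symmetric] algebra_simps)
  also have "\<dots> = (CLINT \<omega>|M. H' \<omega>) * exp (- (of_real (s (Suc n) - s n) * \<psi> (a n *\<^sub>R \<xi>)))"
    using r sn by (intro increment_indep H'm H'b) auto
  also have "(CLINT \<omega>|M. H' \<omega>) = (CLINT \<omega>|M. H \<omega>) * exp (- (\<Sum>j<n. of_real (s (Suc j) - s j) * \<psi> (a j *\<^sub>R \<xi>)))"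
    unfolding H'_def using Suc.prems by (intro Suc.IH) auto
  also have "\<dots> * exp (- (of_real (s (Suc n) - s n) * \<psi> (a n *\<^sub>R \<xi>)))
     = (CLINT \<omega>|M. H \<omega>) * exp (- (\<Sum>j<Suc n. of_real (s (Suc j) - s j) * \<psi> (a j *\<^sub>R \<xi>)))"
    by (simp only: mult.assoc exp_add[symmetric] sum.lessThan_Suc minus_add_distrib)
  finally show ?case .
qed

text \<open>Clamping the nodes from above and from below divides the integral at \<open>r\<close>
  without inserting a node; steps lying wholly on the wrong side collapse to zero
  increments.\<close>

lemma step_integral_split:
  "step_integral X n a s \<omega> = step_integral X n a (\<lambda>j. min r (s j)) \<omega> + step_integral X n a (\<lambda>j. max r (s j)) \<omega>"
proof -
  have "X q \<omega> - X p \<omega> = (X (min r q) \<omega> - X (min r p) \<omega>) + (X (max r q) \<omega> - X (max r p) \<omega>)" for p q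
    by (auto simp: min_def max_def)
  then show ?thesis
    unfolding step_integral_def sum.distrib[symmetric] scaleR_add_right[symmetric] by metis
qed

text \<open>The modulus of the characteristic function at time T is exp (- T Re \<psi>). It is at
  most 1 and depends continuously on \<xi>, and passing to the modulus avoids choosing a branch of
  the complex logarithm.\<close>

lemma Re_psi:
  shows Re_psi_nonneg: "0 \<le> Re (\<psi> \<xi>)"
    and Re_psi_0: "Re (\<psi> 0) = 0"
    and Re_psi_continuous: "continuous_on UNIV (\<lambda>\<xi>. Re (\<psi> \<xi>))"
proof -
  define \<Phi> where "\<Phi> = (\<lambda>\<xi>. CLINT \<omega>|M. iexp (\<xi> \<bullet> X T \<omega>))"
  have [measurable]: "X T \<in> borel_measurable M" using T_pos by (intro X_measurable) auto
  have "\<Phi> \<xi> = exp (- (of_real T * \<psi> \<xi>))" for \<xi>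
    using X_char T_pos unfolding levy_characteristic_def \<Phi>_def by auto
  then have n: "cmod (\<Phi> \<xi>) = exp (- (T * Re (\<psi> \<xi>)))" for \<xi> by simp
  have "cmod (\<Phi> \<xi>) \<le> (\<integral>\<omega>. 1 \<partial>M)" unfolding \<Phi>_def
    by (rule integral_norm_bound_AE) auto
  then have "exp (- (T * Re (\<psi> \<xi>))) \<le> 1" using n by (simp add: prob_space)
  then show "0 \<le> Re (\<psi> \<xi>)" using T_pos by (simp add: zero_le_mult_iff)
  have "cmod (\<Phi> 0) = 1" by (simp add: \<Phi>_def prob_space)
  then show "Re (\<psi> 0) = 0" using n[of 0] T_pos by simp
  have cont: "continuous_on UNIV \<Phi>"
    unfolding continuous_on_sequentially
  proof (intro allI ballI impI, elim conjE)
    fix x :: "nat \<Rightarrow> 'v" and a assume "x \<longlonglongrightarrow> a"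
    then show "(\<Phi> \<circ> x) \<longlonglongrightarrow> \<Phi> a"
      unfolding \<Phi>_def o_def
      by (intro integral_dominated_convergence[where w="\<lambda>_. 1"])
         (auto intro!: tendsto_intros)
  qed
  have "Re (\<psi> \<xi>) = - ln (cmod (\<Phi> \<xi>)) / T" for \<xi>
    using T_pos by (simp add: n)
  moreover have "continuous_on UNIV (\<lambda>\<xi>. - ln (cmod (\<Phi> \<xi>)) / T)"
    using cont T_pos by (intro continuous_intros) (auto simp: n)
  ultimately show "continuous_on UNIV (\<lambda>\<xi>. Re (\<psi> \<xi>))" by simp
qed

lemma Re_psi_measurable[measurable]: "(\<lambda>\<xi>. Re (\<psi> \<xi>)) \<in> borel_measurable borel"
  using Re_psi_continuous by (rule borel_measurable_continuous_onI)

text \<open>The right-hand side is the real part of the exponent that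
  \<open>step_integral_char\<close> produces for the nodes clamped at \<open>u\<close>. The upper
  bound is the direction required after Fatou; points outside all steps contribute nothing because
  Re \<psi> vanishes at 0.\<close>

lemma step_fun_exponent_le:
  assumes nodes: "step_nodes v n s" and u: "0 \<le> u" "u \<le> v"
  shows "(\<integral>\<^sup>+x\<in>{u..v}. ennreal (Re (\<psi> (step_fun n a s x *\<^sub>R \<xi>))) \<partial>lebesgue)
     \<le> ennreal (\<Sum>j<n. (max u (s (Suc j)) - max u (s j)) * Re (\<psi> (a j *\<^sub>R \<xi>)))"
proof -
  have "(\<integral>\<^sup>+x\<in>{u..v}. ennreal (Re (\<psi> (step_fun n a s x *\<^sub>R \<xi>))) \<partial>lebesgue)
     \<le> (\<integral>\<^sup>+x. (\<Sum>j<n. ennreal (Re (\<psi> (a j *\<^sub>R \<xi>))) * indicator ({s j<..s (Suc j)} \<inter> {u..v}) x) \<partial>lebesgue)"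
  proof (rule nn_integral_mono)
    fix x
    show "ennreal (Re (\<psi> (step_fun n a s x *\<^sub>R \<xi>))) * indicator {u..v} x
        \<le> (\<Sum>j<n. ennreal (Re (\<psi> (a j *\<^sub>R \<xi>))) * indicator ({s j<..s (Suc j)} \<inter> {u..v}) x)"
    proof (cases x rule: step_fun_cases[OF nodes, where a=a])
      case (1 j)
      have "ennreal (Re (\<psi> (step_fun n a s x *\<^sub>R \<xi>))) * indicator {u..v} x
         = ennreal (Re (\<psi> (a j *\<^sub>R \<xi>))) * indicator ({s j<..s (Suc j)} \<inter> {u..v}) x"
        using 1 by (simp split: split_indicator)
      also have "\<dots> \<le> (\<Sum>j<n. ennreal (Re (\<psi> (a j *\<^sub>R \<xi>))) * indicator ({s j<..s (Suc j)} \<inter> {u..v}) x)"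
        using 1(1) by (intro member_le_sum) auto
      finally show ?thesis .
    qed (simp add: Re_psi_0)
  qed
  also have "\<dots> = (\<Sum>j<n. ennreal (Re (\<psi> (a j *\<^sub>R \<xi>))) * emeasure lebesgue ({s j<..s (Suc j)} \<inter> {u..v}))"
  proof -
    have [measurable]: "{p<..q} \<inter> {u..v} \<in> sets lebesgue" for p q by (intro sets.Int) auto
    show ?thesis by (subst nn_integral_sum) (simp_all add: nn_integral_cmult_indicator)
  qed
  also have "\<dots> \<le> (\<Sum>j<n. ennreal ((max u (s (Suc j)) - max u (s j)) * Re (\<psi> (a j *\<^sub>R \<xi>))))"
  proof (rule sum_mono)
    fix j assume j: "j \<in> {..<n}"
    then have sj: "s j \<le> s (Suc j)" "s (Suc j) \<le> v" using nodes by (auto simp: step_nodes_def)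
    have "emeasure lebesgue ({s j<..s (Suc j)} \<inter> {u..v}) \<le> emeasure lebesgue {max u (s j)..max u (s (Suc j))}"
      by (intro emeasure_mono) auto
    also have "\<dots> = ennreal (max u (s (Suc j)) - max u (s j))" using sj by simp
    finally have "ennreal (Re (\<psi> (a j *\<^sub>R \<xi>))) * emeasure lebesgue ({s j<..s (Suc j)} \<inter> {u..v})
       \<le> ennreal (Re (\<psi> (a j *\<^sub>R \<xi>))) * ennreal (max u (s (Suc j)) - max u (s j))"
      by (intro mult_left_mono) auto
    then show "ennreal (Re (\<psi> (a j *\<^sub>R \<xi>))) * emeasure lebesgue ({s j<..s (Suc j)} \<inter> {u..v})
       \<le> ennreal ((max u (s (Suc j)) - max u (s j)) * Re (\<psi> (a j *\<^sub>R \<xi>)))"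
      using sj Re_psi_nonneg by (subst ennreal_mult') (auto simp: mult.commute)
  qed
  also have "\<dots> = ennreal (\<Sum>j<n. (max u (s (Suc j)) - max u (s j)) * Re (\<psi> (a j *\<^sub>R \<xi>)))"
    using nodes Re_psi_nonneg by (intro sum_ennreal) (auto simp: step_nodes_def intro!: mult_nonneg_nonneg)
  finally show ?thesis .
qed

end

section \<open>Decorrelation of Volterra-Levy processes\<close>

text \<open>From ln x <= x - 1 at x = y / q. The optimal constant (q / e)^q is relaxed to q^q by
  dropping a term.\<close>

lemma exp_minus_le_powr:
  fixes y q :: real
  assumes "0 < y" "0 < q"
  shows "exp (- y) \<le> q powr q * y powr (- q)"
proof -
  have "ln (y / q) \<le> y / q - 1" using assms by (intro ln_le_minus_one) simp
  then have "q * (ln y - ln q) \<le> q * (y / q - 1)" using assms by (intro mult_left_mono) (auto simp: ln_div)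
  then have "q * ln y - q * ln q \<le> y" using assms by (simp add: algebra_simps)
  then have "exp (- y) \<le> exp (q * ln q + (- q) * ln y)" by simp
  also have "\<dots> = q powr q * y powr (- q)" using assms by (simp add: powr_def exp_add[symmetric])
  finally show ?thesis .
qed

text \<open>The singularity at u = v is integrable because the exponent \<theta> - 1 exceeds -1;
  reflecting u moves it to the origin.\<close>

lemma has_bochner_integral_powr_reflect:
  fixes \<theta> s v :: real
  assumes "0 < \<theta>" "s \<le> v"
  shows "has_bochner_integral lborel (\<lambda>u. indicator {s..v} u * (v - u) powr (\<theta> - 1)) ((v - s) powr \<theta> / \<theta>)"
proof -
  define c where "c = v - s"
  have c: "0 \<le> c" using assms by (simp add: c_def)
  have "((\<lambda>x. x powr (\<theta> - 1)) has_integral (c powr (\<theta> - 1 + 1) / (\<theta> - 1 + 1))) {0..c}"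
    using assms c by (intro has_integral_powr_from_0) auto
  then have I: "((\<lambda>x. x powr (\<theta> - 1)) has_integral (c powr \<theta> / \<theta>)) {0..c}" by simp
  have "has_bochner_integral lborel (\<lambda>x. indicator {0..c} x * x powr (\<theta> - 1)) (c powr \<theta> / \<theta>)"
  proof (rule has_bochner_integral_nn_integral)
    show "(\<integral>\<^sup>+x. ennreal (indicator {0..c} x * x powr (\<theta> - 1)) \<partial>lborel) = ennreal (c powr \<theta> / \<theta>)"
      by (rule nn_integral_has_integral_lebesgue[OF _ I]) auto
  qed (use assms in auto)
  then have "has_bochner_integral lborel (\<lambda>x. indicator {0..c} (v + (-1) * x) * (v + (-1) * x) powr (\<theta> - 1)) (c powr \<theta> / \<theta>)"
    by (subst (asm) lborel_has_bochner_integral_real_affine_iff[of "-1" _ _ v]) auto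
  moreover have "indicator {0..c} (v + (-1) * x) = (indicator {s..v} x :: real)" for x
    by (auto simp: c_def indicator_def)
  ultimately show ?thesis by (simp add: c_def)
qed

lemma integral_lebesgue_on_borel:
  fixes h :: "real \<Rightarrow> real"
  assumes h: "h \<in> borel_measurable borel" and "0 \<le> s" "v \<le> T"
  shows "(\<integral>u. indicator {s..v} u * h u \<partial>lebesgue_on {0..T}) = (\<integral>u. indicator {s..v} u * h u \<partial>lborel)"
proof -
  have "(\<integral>u. indicator {s..v} u * h u \<partial>lebesgue_on {0..T}) = (\<integral>u. indicator {0..T} u *\<^sub>R (indicator {s..v} u * h u) \<partial>lebesgue)"
    by (rule integral_restrict_space) simp
  also have "\<dots> = (\<integral>u. indicator {s..v} u * h u \<partial>lebesgue)"
    using assms by (intro Bochner_Integration.integral_cong) (auto split: split_indicator)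
  also have "\<dots> = (\<integral>u. indicator {s..v} u * h u \<partial>lborel)"
    using h by (intro integral_completion) measurable
  finally show ?thesis .
qed

text \<open>For |\<xi>| > 1, exp (- y) <= q^q y^(-q) with q = (1 - \<theta>) / \<zeta>: this choice
  turns x^\<zeta> into x^(\<theta>-1) and |\<xi>|^\<alpha> into |\<xi>|^(-\<beta>). For |\<xi>| <= 1
  that power is useless near 0, and the trivial bound 1 <= T^(1-\<theta>) x^(\<theta>-1) takes its
  place. The factor 2^(\<beta>/2) compares 1 + |\<xi>|^2 with 2 in one case and with 2 |\<xi>|^2 in
  the other.\<close>

lemma stretched_exp_bound:
  fixes c T \<alpha> \<zeta> \<theta> x :: real and \<xi> :: "'v::euclidean_space"
  assumes pos: "0 < c" "0 < \<alpha>" "0 < \<zeta>" "0 < \<theta>" "\<theta> < 1" and x: "0 < x" "x \<le> T"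
  defines "\<beta> \<equiv> (1 - \<theta>) * \<alpha> / \<zeta>"
  defines "q \<equiv> (1 - \<theta>) / \<zeta>"
  defines "C \<equiv> 2 powr (\<beta> / 2) * max (T powr (1 - \<theta>)) (q powr q * c powr (- q))"
  shows "exp (- (c * x powr \<zeta> * norm \<xi> powr \<alpha>)) \<le> C * (1 + (norm \<xi>)\<^sup>2) powr (- \<beta> / 2) * x powr (\<theta> - 1)"
proof -
  have q: "0 < q" and \<beta>: "0 < \<beta>" "\<beta> = \<alpha> * q" and T: "0 < T"
    using pos x by (auto simp: q_def \<beta>_def)
  define A where "A = max (T powr (1 - \<theta>)) (q powr q * c powr (- q))"
  have A: "0 < A" using T by (simp add: A_def less_max_iff_disj)
  define W where "W = (1 + (norm \<xi>)\<^sup>2) powr (- \<beta> / 2)"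
  have "exp (- (c * x powr \<zeta> * norm \<xi> powr \<alpha>)) \<le> 2 powr (\<beta> / 2) * W * A * x powr (\<theta> - 1)"
  proof (cases "norm \<xi> \<le> 1")
    case True
    have "2 powr (- \<beta> / 2) \<le> W"
      unfolding W_def using True \<beta> by (intro powr_mono2') (auto simp: power_le_one intro: add_pos_nonneg)
    then have "2 powr (\<beta> / 2) * 2 powr (- \<beta> / 2) \<le> 2 powr (\<beta> / 2) * W" by (intro mult_left_mono) auto
    then have w: "1 \<le> 2 powr (\<beta> / 2) * W" by (simp add: powr_add[symmetric])
    have "exp (- (c * x powr \<zeta> * norm \<xi> powr \<alpha>)) \<le> 1" using pos by simp
    also have "1 \<le> T powr (1 - \<theta>) * x powr (\<theta> - 1)"
    proof -
      have "x powr (1 - \<theta>) * x powr (\<theta> - 1) \<le> T powr (1 - \<theta>) * x powr (\<theta> - 1)"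
        using x pos by (intro mult_right_mono powr_mono2) auto
      then show ?thesis using x by (simp add: powr_add[symmetric])
    qed
    also have "\<dots> \<le> A * x powr (\<theta> - 1)" by (intro mult_right_mono) (auto simp: A_def)
    also have "\<dots> \<le> (2 powr (\<beta> / 2) * W) * (A * x powr (\<theta> - 1))"
      using mult_right_mono[OF w, of "A * x powr (\<theta> - 1)"] A by simp
    finally show ?thesis by (simp add: mult_ac)
  next
    case False
    then have n: "1 < norm \<xi>" by simp
    then have "\<xi> \<noteq> 0" by auto
    have "exp (- (c * x powr \<zeta> * norm \<xi> powr \<alpha>)) \<le> q powr q * (c * x powr \<zeta> * norm \<xi> powr \<alpha>) powr (- q)"
      using pos x \<open>\<xi> \<noteq> 0\<close> q by (intro exp_minus_le_powr mult_pos_pos) auto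
    also have "(c * x powr \<zeta> * norm \<xi> powr \<alpha>) powr (- q) = c powr (- q) * x powr (\<theta> - 1) * norm \<xi> powr (- \<beta>)"
    proof -
      have "\<zeta> * (- q) = \<theta> - 1" using pos by (simp add: q_def)
      moreover have "\<alpha> * (- q) = - \<beta>" using \<beta> by simp
      ultimately show ?thesis by (simp add: powr_mult powr_powr)
    qed
    also have "q powr q * (c powr (- q) * x powr (\<theta> - 1) * norm \<xi> powr (- \<beta>))
        \<le> q powr q * (c powr (- q) * x powr (\<theta> - 1) * (2 powr (\<beta> / 2) * W))"
    proof (intro mult_left_mono)
      have "(1 + (norm \<xi>)\<^sup>2) / 2 \<le> (norm \<xi>)\<^sup>2" using n by (simp add: power_gt1_lemma one_le_power)
      then have "((norm \<xi>)\<^sup>2) powr (- \<beta> / 2) \<le> ((1 + (norm \<xi>)\<^sup>2) / 2) powr (- \<beta> / 2)"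
        using \<beta> by (intro powr_mono2') (auto intro: add_pos_nonneg)
      also have "((norm \<xi>)\<^sup>2) powr (- \<beta> / 2) = norm \<xi> powr (- \<beta>)"
        using n by (simp add: powr_powr flip: powr_numeral)
      also have "((1 + (norm \<xi>)\<^sup>2) / 2) powr (- \<beta> / 2) = 2 powr (\<beta> / 2) * W"
        by (simp add: W_def powr_divide powr_minus field_simps)
      finally show "norm \<xi> powr (- \<beta>) \<le> 2 powr (\<beta> / 2) * W" .
    qed auto
    finally have "exp (- (c * x powr \<zeta> * norm \<xi> powr \<alpha>)) \<le> (q powr q * c powr (- q)) * (x powr (\<theta> - 1) * (2 powr (\<beta> / 2) * W))"
      by (simp only: mult_ac)
    also have "\<dots> \<le> A * (x powr (\<theta> - 1) * (2 powr (\<beta> / 2) * W))"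
      by (intro mult_right_mono) (auto simp: A_def W_def)
    finally show ?thesis by (simp add: mult_ac)
  qed
  then show ?thesis by (simp add: C_def A_def W_def mult_ac)
qed

section \<open>Volterra-Levy processes under the nondeterminism condition\<close>

locale volterra_levy = levy T M F X \<psi>
  for T :: real and M :: "'w measure" and F :: "real \<Rightarrow> 'w measure"
    and X :: "real \<Rightarrow> 'w \<Rightarrow> 'v::euclidean_space" and \<psi> :: "'v \<Rightarrow> complex" +
  fixes \<alpha> \<zeta> :: real and k :: "real \<Rightarrow> real \<Rightarrow> real" and z :: "real \<Rightarrow> 'w \<Rightarrow> 'v"
  assumes \<alpha>_pos: "0 < \<alpha>" and \<zeta>_pos: "0 < \<zeta>"
    and volterra: "volterra_levy_process T M \<alpha> X k z"
    and nondet: "nondeterminism_const T \<alpha> \<zeta> \<psi> k > 0"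
begin

abbreviation N :: "real measure" where "N \<equiv> lebesgue_on {0..T}"

sublocale N: finite_measure N by (rule finite_measure_lebesgue_on_Icc)

lemma z_joint[measurable]: "(\<lambda>(t, \<omega>). z t \<omega>) \<in> borel_measurable (N \<Otimes>\<^sub>M M)"
  using volterra by (simp add: volterra_levy_process_def)

lemma z_approximation:
  assumes "t \<in> {0..T}"
  shows "z t \<in> borel_measurable M"
    and "\<exists>n a s. (\<forall>m. step_nodes t (n m) (s m)) \<and>
      (AE x in lebesgue_on {0..t}. (\<lambda>m. step_fun (n m) (a m) (s m) x) \<longlonglongrightarrow> k t x) \<and>
      (AE \<omega> in M. (\<lambda>m. step_integral X (n m) (a m) (s m) \<omega>) \<longlonglongrightarrow> z t \<omega>)"
proof -
  have 1: "in_Lp (lebesgue_on {0..t}) \<alpha> (k t)" and 2: "is_levy_integral M \<alpha> X t (k t) (z t)"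
    using volterra assms by (auto simp: volterra_levy_process_def)
  have t: "0 \<le> t" using assms by simp
  show "z t \<in> borel_measurable M"
    by (rule levy_integral_approximation(1)[OF \<alpha>_pos t 1 2])
  show "\<exists>n a s. (\<forall>m. step_nodes t (n m) (s m)) \<and>
      (AE x in lebesgue_on {0..t}. (\<lambda>m. step_fun (n m) (a m) (s m) x) \<longlonglongrightarrow> k t x) \<and>
      (AE \<omega> in M. (\<lambda>m. step_integral X (n m) (a m) (s m) \<omega>) \<longlonglongrightarrow> z t \<omega>)"
    by (rule levy_integral_approximation(2)[OF \<alpha>_pos t 1 2])
qed

text \<open>The operator \<open>lim\<close> applied to adapted step integrals is measurable at time
  \<open>r\<close> whether or not they converge, and it agrees with \<open>z u\<close> where they
  do, that is almost surely.\<close>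

lemma z_adapted:
  assumes u: "u \<in> {0..T}" "r \<in> {u..T}"
  shows "\<exists>h\<in>borel_measurable (F r). AE \<omega> in M. z u \<omega> = h \<omega>"
proof -
  obtain n a s where nodes: "\<forall>m. step_nodes u (n m) (s m)"
    and lim: "AE \<omega> in M. (\<lambda>m. step_integral X (n m) (a m) (s m) \<omega>) \<longlonglongrightarrow> z u \<omega>"
    using z_approximation(2)[OF u(1)] by (elim exE conjE) (rule that)
  have [measurable]: "step_integral X (n m) (a m) (s m) \<in> borel_measurable (F r)" for m
  proof (rule step_integral_adapted)
    fix j assume "j \<le> n m"
    then have "s m j \<in> {0..u}" using nodes by (simp add: step_nodes_def)
    then show "s m j \<in> {0..r}" using u by simp
  qed (use u in simp)
  have "(\<lambda>\<omega>. lim (\<lambda>m. step_integral X (n m) (a m) (s m) \<omega>)) \<in> borel_measurable (F r)"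
    by measurable
  moreover have "AE \<omega> in M. z u \<omega> = lim (\<lambda>m. step_integral X (n m) (a m) (s m) \<omega>)"
    using lim by eventually_elim (simp add: limI)
  ultimately show ?thesis
    by (intro bexI[of _ "\<lambda>\<omega>. lim (\<lambda>m. step_integral X (n m) (a m) (s m) \<omega>)"])
qed

lemma nondeterminism:
  obtains c where "0 < c"
    "\<And>s t \<xi>. 0 \<le> s \<Longrightarrow> s < t \<Longrightarrow> t \<le> T \<Longrightarrow>
      ennreal (c * (t - s) powr \<zeta> * norm \<xi> powr \<alpha>) \<le> (\<integral>\<^sup>+r\<in>{s..t}. ennreal (Re (\<psi> (k t r *\<^sub>R \<xi>))) \<partial>lebesgue)"
proof -
  \<comment> \<open>The infimum may be infinite, so some value strictly between 0 and it is taken;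
    being finite, this value is a real constant.\<close>
  obtain e where e: "0 < e" "e < nondeterminism_const T \<alpha> \<zeta> \<psi> k" using nondet dense by blast
  have "e < \<top>" using e(2) by (meson order.strict_trans2 top_greatest)
  then obtain c where c: "e = ennreal c" "0 \<le> c" by (cases e) auto
  then have c0: "0 < c" using e(1) by simp
  show ?thesis
  proof (rule that[OF c0])
    fix s t \<xi> assume st: "0 \<le> s" "s < t" "t \<le> T"
    show "ennreal (c * (t - s) powr \<zeta> * norm \<xi> powr \<alpha>) \<le> (\<integral>\<^sup>+r\<in>{s..t}. ennreal (Re (\<psi> (k t r *\<^sub>R \<xi>))) \<partial>lebesgue)"
      (is "_ \<le> ?A")
    proof (cases "\<xi> = 0")
      case False
      let ?B = "ennreal ((t - s) powr \<zeta> * norm \<xi> powr \<alpha>)"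
      have B: "?B \<noteq> 0" "?B \<noteq> \<top>" using st False by auto
      have "nondeterminism_const T \<alpha> \<zeta> \<psi> k \<le> ?A / ?B"
        unfolding nondeterminism_const_def
        by (rule INF_lower2[of t], use st in simp, rule INF_lower2[of s], use st in simp,
            rule INF_lower2[of \<xi>], use False in simp, rule order_refl)
      then have "ennreal c \<le> ?A / ?B" using e(2) c by simp
      then have "?B * ennreal c \<le> ?B * (?A / ?B)" by (rule mult_left_mono) simp
      also have "\<dots> = ?A"
        unfolding ennreal_times_divide by (subst mult.commute) (rule mult_divide_eq_ennreal[OF B])
      also have "?B * ennreal c = ennreal (c * (t - s) powr \<zeta> * norm \<xi> powr \<alpha>)"
        using c0 by (subst ennreal_mult[symmetric]) (auto simp: mult_ac)
      finally show ?thesis .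
    qed simp
  qed
qed

text \<open>Fatou's lemma along the almost everywhere convergent kernels, using continuity of Re
  \<psi>. A lower limit only gives eventual bounds by numbers strictly below
  \<open>b\<close>.\<close>

lemma exponent_liminf:
  assumes uv: "0 \<le> u" "u < v" "v \<le> T"
    and nodes: "\<And>m. step_nodes v (n m) (s m)"
    and lim: "AE x in lebesgue_on {0..v}. (\<lambda>m. step_fun (n m) (a m) (s m) x) \<longlonglongrightarrow> k v x"
    and b: "ennreal b \<le> (\<integral>\<^sup>+r\<in>{u..v}. ennreal (Re (\<psi> (k v r *\<^sub>R \<xi>))) \<partial>lebesgue)"
    and b': "b' < b"
  shows "eventually (\<lambda>m. b' < (\<Sum>j<n m. (max u (s m (Suc j)) - max u (s m j)) * Re (\<psi> (a m j *\<^sub>R \<xi>)))) sequentially"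
proof -
  define q where "q = (\<lambda>m. \<Sum>j<n m. (max u (s m (Suc j)) - max u (s m j)) * Re (\<psi> (a m j *\<^sub>R \<xi>)))"
  have q0: "0 \<le> q m" for m
    unfolding q_def using nodes[of m] Re_psi_nonneg
    by (intro sum_nonneg mult_nonneg_nonneg) (auto simp: step_nodes_def)
  let ?g = "\<lambda>m x. ennreal (Re (\<psi> (step_fun (n m) (a m) (s m) x *\<^sub>R \<xi>))) * indicator {u..v} x"
  have gm: "?g m \<in> borel_measurable lebesgue" for m
    by (intro measurable_completion) (use step_fun_measurable in measurable)
  have "AE x in lebesgue. x \<in> {0..v} \<longrightarrow> (\<lambda>m. step_fun (n m) (a m) (s m) x) \<longlonglongrightarrow> k v x"
    using lim by (subst (asm) AE_restrict_space_iff) auto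
  then have ae: "AE x in lebesgue. ennreal (Re (\<psi> (k v x *\<^sub>R \<xi>))) * indicator {u..v} x \<le> liminf (\<lambda>m. ?g m x)"
  proof eventually_elim
    case (elim x)
    show ?case
    proof (cases "x \<in> {u..v}")
      case True
      then have "(\<lambda>m. step_fun (n m) (a m) (s m) x *\<^sub>R \<xi>) \<longlonglongrightarrow> k v x *\<^sub>R \<xi>"
        using elim uv by (intro tendsto_intros) auto
      moreover have "isCont (\<lambda>\<xi>. Re (\<psi> \<xi>)) (k v x *\<^sub>R \<xi>)"
        using Re_psi_continuous by (simp add: continuous_on_eq_continuous_at)
      ultimately have "(\<lambda>m. Re (\<psi> (step_fun (n m) (a m) (s m) x *\<^sub>R \<xi>))) \<longlonglongrightarrow> Re (\<psi> (k v x *\<^sub>R \<xi>))"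
        using isCont_tendsto_compose by fast
      then have "(\<lambda>m. ?g m x) \<longlonglongrightarrow> ennreal (Re (\<psi> (k v x *\<^sub>R \<xi>)))"
        using True by (auto intro: tendsto_ennrealI)
      then show ?thesis using True by (simp add: lim_imp_Liminf)
    qed simp
  qed
  have "ennreal b \<le> (\<integral>\<^sup>+x. liminf (\<lambda>m. ?g m x) \<partial>lebesgue)"
    using b nn_integral_mono_AE[OF ae] by (rule order_trans)
  also have "\<dots> \<le> liminf (\<lambda>m. \<integral>\<^sup>+x. ?g m x \<partial>lebesgue)"
    by (rule nn_integral_liminf[OF gm])
  also have "\<dots> \<le> liminf (\<lambda>m. ennreal (q m))"
    unfolding q_def using uv by (intro Liminf_mono always_eventually allI step_fun_exponent_le nodes) auto
  finally have *: "ennreal b \<le> liminf (\<lambda>m. ennreal (q m))" .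
  have "eventually (\<lambda>m. b' < q m) sequentially"
  proof (cases "b' < 0")
    case True
    then show ?thesis using q0 by (intro always_eventually allI) (rule less_le_trans)
  next
    case False
    then have "ennreal b' < ennreal b" using b' by (simp add: ennreal_less_iff)
    then have "eventually (\<lambda>m. ennreal b' < ennreal (q m)) sequentially"
      using * unfolding le_Liminf_iff by blast
    then show ?thesis using False by (simp add: ennreal_less_iff)
  qed
  then show ?thesis by (simp add: q_def)
qed

text \<open>For c = 1 this is the cosine of \<xi> . z and for c = - \<i> the sine, so one
  real-valued family serves the real and the imaginary part of the transform.\<close>

definition phase :: "complex \<Rightarrow> 'v \<Rightarrow> real \<times> 'w \<Rightarrow> real" where
  "phase c \<xi> p = Re (c * iexp (\<xi> \<bullet> z (fst p) (snd p)))"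

lemma phase_measurable[measurable]: "phase c \<xi> \<in> borel_measurable (N \<Otimes>\<^sub>M M)"
proof -
  have [measurable]: "(\<lambda>p. z (fst p) (snd p)) \<in> borel_measurable (N \<Otimes>\<^sub>M M)"
    using z_joint by (simp add: split_beta')
  show ?thesis unfolding phase_def[abs_def] by measurable
qed

lemma phase_bound: "cmod c = 1 \<Longrightarrow> \<bar>phase c \<xi> p\<bar> \<le> 1"
  unfolding phase_def using abs_Re_le_cmod[of "c * iexp (\<xi> \<bullet> z (fst p) (snd p))"] by (simp add: norm_mult)

lemma phase_field: "cmod c = 1 \<Longrightarrow> bounded_field N M (phase c \<xi>)"
  by unfold_locales (auto intro: borel_lebesgue_on phase_bound)

lemma phase_adapted:
  assumes "cmod c = 1" and u: "u \<in> {0..T}" "r \<in> {u..T}"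
  shows "\<exists>h\<in>borel_measurable (F r). (\<forall>\<omega>. \<bar>h \<omega>\<bar> \<le> 1) \<and> (AE \<omega> in M. phase c \<xi> (u, \<omega>) = h \<omega>)"
proof -
  obtain h where h[measurable]: "h \<in> borel_measurable (F r)" and ae: "AE \<omega> in M. z u \<omega> = h \<omega>"
    using z_adapted[OF u] by blast
  have "(\<lambda>\<omega>. Re (c * iexp (\<xi> \<bullet> h \<omega>))) \<in> borel_measurable (F r)" by measurable
  moreover have "\<bar>Re (c * iexp (\<xi> \<bullet> h \<omega>))\<bar> \<le> 1" for \<omega>
    using abs_Re_le_cmod[of "c * iexp (\<xi> \<bullet> h \<omega>)"] assms(1) by (simp add: norm_mult)
  moreover have "AE \<omega> in M. phase c \<xi> (u, \<omega>) = Re (c * iexp (\<xi> \<bullet> h \<omega>))"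
    using ae by eventually_elim (simp add: phase_def)
  ultimately show ?thesis
    by (intro bexI[of _ "\<lambda>\<omega>. Re (c * iexp (\<xi> \<bullet> h \<omega>))"] conjI allI)
qed

text \<open>Given the past of \<open>u\<close>, the phase at \<open>v\<close> has a conditional mean
  of modulus at most exp (- b). The step integrals approximating \<open>z v\<close> are split at
  \<open>u\<close>, not \<open>z v\<close> itself; the bound survives the limit since the exponents
  do not drop (\<open>exponent_liminf\<close>) and the phases converge boundedly.\<close>

lemma phase_decorrelation:
  fixes s0 :: real
  assumes c: "cmod c = 1" and uv: "0 \<le> s0" "s0 \<le> u" "u < v" "v \<le> T"
    and b: "ennreal b \<le> (\<integral>\<^sup>+r\<in>{u..v}. ennreal (Re (\<psi> (k v r *\<^sub>R \<xi>))) \<partial>lebesgue)"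
  shows "\<bar>\<integral>\<omega>. bounded_field.S N (phase c \<xi>) s0 u \<omega> ^ (2 * l) * phase c \<xi> (u, \<omega>) * phase c \<xi> (v, \<omega>) \<partial>M\<bar>
      \<le> (\<integral>\<omega>. bounded_field.S N (phase c \<xi>) s0 u \<omega> ^ (2 * l) \<partial>M) * exp (- b)"
proof -
  interpret bf: bounded_field N M "phase c \<xi>" s0 by (rule phase_field[OF c])
  let ?S = "\<lambda>\<omega>. bf.S u \<omega> ^ (2 * l)"
  let ?ES = "\<integral>\<omega>. ?S \<omega> \<partial>M"
  have uT: "u \<in> {0..T}" "v \<in> {0..T}" using uv by auto
  have zv[measurable]: "z v \<in> borel_measurable M" by (rule z_approximation(1)[OF uT(2)])
  have zu[measurable]: "z u \<in> borel_measurable M" by (rule z_approximation(1)[OF uT(1)])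
  have pu[measurable]: "(\<lambda>\<omega>. phase c \<xi> (u, \<omega>)) \<in> borel_measurable M" unfolding phase_def fst_conv snd_conv by measurable
  have pv[measurable]: "(\<lambda>\<omega>. phase c \<xi> (v, \<omega>)) \<in> borel_measurable M" unfolding phase_def fst_conv snd_conv by measurable
  have Sint: "integrable M ?S"
    by (rule integrable_bounded[where B="bf.B ^ (2 * l)"]) (auto simp only: real_norm_def bf.S_power_bound, measurable)
  obtain n a s where nodes: "\<forall>m. step_nodes v (n m) (s m)"
    and fun_lim: "AE x in lebesgue_on {0..v}. (\<lambda>m. step_fun (n m) (a m) (s m) x) \<longlonglongrightarrow> k v x"
    and int_lim: "AE \<omega> in M. (\<lambda>m. step_integral X (n m) (a m) (s m) \<omega>) \<longlonglongrightarrow> z v \<omega>"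
    using z_approximation(2)[OF uT(2)] by (elim exE conjE) (rule that)
  obtain h where hF[measurable]: "h \<in> borel_measurable (F u)" and hb: "\<And>\<omega>. \<bar>h \<omega>\<bar> \<le> 1"
    and h_ae: "AE \<omega> in M. phase c \<xi> (u, \<omega>) = h \<omega>"
    using phase_adapted[OF c, of u u] uT by auto
  let ?Y = "\<lambda>\<omega>. of_real (?S \<omega>) * of_real (h \<omega>) * iexp (\<xi> \<bullet> z v \<omega>)"
  have Sh: "?S \<omega> * \<bar>h \<omega>\<bar> \<le> ?S \<omega>" for \<omega>
    using mult_left_mono[OF hb, of "?S \<omega>"] by simp
  have hM[measurable]: "h \<in> borel_measurable M" by (rule measurable_from_subalg[OF subalg[OF uT(1)] hF])
  have node_in: "j \<le> n m \<Longrightarrow> s m j \<in> {0..v}" "j < n m \<Longrightarrow> s m j \<le> s m (Suc j)" for m j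
    using nodes by (auto simp: step_nodes_def)
  define I1 where "I1 = (\<lambda>m. step_integral X (n m) (a m) (\<lambda>j. min u (s m j)))"
  define I2 where "I2 = (\<lambda>m. step_integral X (n m) (a m) (\<lambda>j. max u (s m j)))"
  have I1F[measurable]: "I1 m \<in> borel_measurable (F u)" for m
    unfolding I1_def using node_in uT by (intro step_integral_adapted) auto
  have I1M[measurable]: "I1 m \<in> borel_measurable M" for m
    by (rule measurable_from_subalg[OF subalg[OF uT(1)] I1F])
  have I2M[measurable]: "I2 m \<in> borel_measurable M" for m
  proof -
    have "I2 m \<in> borel_measurable (F v)"
      unfolding I2_def using node_in uv by (intro step_integral_adapted) auto
    then show ?thesis by (rule measurable_from_subalg[OF subalg[OF uT(2)]])
  qed
  define q where "q = (\<lambda>m. \<Sum>j<n m. (max u (s m (Suc j)) - max u (s m j)) * Re (\<psi> (a m j *\<^sub>R \<xi>)))"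
  define Z where "Z = (\<lambda>m. exp (- (\<Sum>j<n m. complex_of_real (max u (s m (Suc j)) - max u (s m j)) * \<psi> (a m j *\<^sub>R \<xi>))))"
  have Znorm: "cmod (Z m) = exp (- q m)" for m by (simp add: Z_def q_def)
  have IM[measurable]: "step_integral X (n m) (a m) (s m) \<in> borel_measurable M" for m
    using node_in uv by (intro measurable_from_subalg[OF subalg[OF uT(2)]] step_integral_adapted) auto
  define E where "E = (\<lambda>m. CLINT \<omega>|M. of_real (?S \<omega>) * of_real (h \<omega>) * iexp (\<xi> \<bullet> step_integral X (n m) (a m) (s m) \<omega>))"
  define Elim where "Elim = (CLINT \<omega>|M. of_real (?S \<omega>) * of_real (h \<omega>) * iexp (\<xi> \<bullet> z v \<omega>))"
  have E_le: "cmod (E m) \<le> exp (- q m) * ?ES" for m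
  proof -
    \<comment> \<open>After the split, the phase of \<open>I1\<close> belongs to the past and joins
      h, while that of \<open>I2\<close> has mean \<open>Z m\<close> independently of the past;
      \<open>factor_power\<close> extracts it despite the power of S in front.\<close>
    have "E m = (CLINT \<omega>|M. of_real (?S \<omega>) * (of_real (h \<omega>) * iexp (\<xi> \<bullet> I1 m \<omega>)) * iexp (\<xi> \<bullet> I2 m \<omega>))"
      unfolding E_def I1_def I2_def
      by (subst step_integral_split[where r=u]) (simp add: inner_add_right exp_add distrib_left mult_ac)
    also have "\<dots> = Z m * (CLINT \<omega>|M. of_real (?S \<omega>) * (of_real (h \<omega>) * iexp (\<xi> \<bullet> I1 m \<omega>)))"
    proof (rule bf.factor_power[OF subalg[OF uT(1)]])
      show "\<exists>h\<in>borel_measurable (F u). (\<forall>\<omega>. \<bar>h \<omega>\<bar> \<le> 1) \<and> (AE \<omega> in M. phase c \<xi> (x, \<omega>) = h \<omega>)"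
        if "s0 \<le> x" "x \<le> u" "x \<in> space N" for x
        using that uv by (intro phase_adapted c) auto
      show "(CLINT \<omega>|M. H \<omega> * iexp (\<xi> \<bullet> I2 m \<omega>)) = Z m * (CLINT \<omega>|M. H \<omega>)"
        if H: "H \<in> borel_measurable (F u)" "\<And>\<omega>. cmod (H \<omega>) \<le> 1" for H
      proof -
        have "(CLINT \<omega>|M. H \<omega> * iexp (\<xi> \<bullet> I2 m \<omega>)) = (CLINT \<omega>|M. H \<omega>) * Z m"
          unfolding I2_def Z_def
          by (rule step_integral_char) (use uT uv node_in H in \<open>auto simp: max_def le_max_iff_disj intro: order_trans\<close>)
        then show ?thesis by (simp add: mult.commute)
      qed
      show "(\<lambda>\<omega>. complex_of_real (h \<omega>) * iexp (\<xi> \<bullet> I1 m \<omega>)) \<in> borel_measurable (F u)" by measurable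
    qed (use hb in \<open>auto simp: norm_mult\<close>)
    finally have "cmod (E m) = exp (- q m) * cmod (CLINT \<omega>|M. of_real (?S \<omega>) * (of_real (h \<omega>) * iexp (\<xi> \<bullet> I1 m \<omega>)))"
      by (simp add: norm_mult Znorm)
    also have "cmod (CLINT \<omega>|M. of_real (?S \<omega>) * (of_real (h \<omega>) * iexp (\<xi> \<bullet> I1 m \<omega>))) \<le> ?ES"
    proof (rule integral_norm_bound_AE[OF Sint], rule AE_I2)
      fix \<omega>
      show "cmod (of_real (?S \<omega>) * (of_real (h \<omega>) * iexp (\<xi> \<bullet> I1 m \<omega>))) \<le> ?S \<omega>"
        using Sh[of \<omega>] by (simp add: norm_mult norm_power power_mult)
    qed
    finally show ?thesis by (simp add: mult_left_mono)
  qed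
  have lim: "E \<longlonglongrightarrow> Elim"
    unfolding E_def Elim_def
  proof (rule integral_dominated_convergence[where w="\<lambda>\<omega>. ?S \<omega>"])
    show "AE \<omega> in M. (\<lambda>m. complex_of_real (?S \<omega>) * of_real (h \<omega>) * iexp (\<xi> \<bullet> step_integral X (n m) (a m) (s m) \<omega>))
        \<longlonglongrightarrow> of_real (?S \<omega>) * of_real (h \<omega>) * iexp (\<xi> \<bullet> z v \<omega>)"
      using int_lim by eventually_elim (intro tendsto_intros)
    show "AE \<omega> in M. cmod (complex_of_real (?S \<omega>) * of_real (h \<omega>) * iexp (\<xi> \<bullet> step_integral X (n m) (a m) (s m) \<omega>)) \<le> ?S \<omega>" for m
    proof (rule AE_I2)
      fix \<omega>
      show "cmod (complex_of_real (?S \<omega>) * of_real (h \<omega>) * iexp (\<xi> \<bullet> step_integral X (n m) (a m) (s m) \<omega>)) \<le> ?S \<omega>"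
        using Sh[of \<omega>] by (simp add: norm_mult norm_power power_mult)
    qed
  qed (use Sint in measurable)
  have S0: "0 \<le> ?ES" by (intro Bochner_Integration.integral_nonneg) (simp add: power_mult)
  \<comment> \<open>Exponents are only known to exceed b' < b eventually; the value b is reached
    afterwards along b - 1 / (i + 1).\<close>
  have Elim_le: "cmod Elim \<le> exp (- b') * ?ES" if "b' < b" for b'
  proof (rule tendsto_upperbound[OF tendsto_norm[OF lim]])
    have "eventually (\<lambda>m. b' < q m) sequentially"
      unfolding q_def using uv nodes that by (intro exponent_liminf[OF _ _ _ _ fun_lim b]) auto
    then show "eventually (\<lambda>m. cmod (E m) \<le> exp (- b') * ?ES) sequentially"
    proof eventually_elim
      case (elim m)
      have "exp (- q m) * ?ES \<le> exp (- b') * ?ES"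
        using elim S0 by (intro mult_right_mono) auto
      then show ?case using E_le[of m] by simp
    qed
  qed simp
  have "cmod Elim \<le> exp (- b) * ?ES"
  proof (rule LIMSEQ_le_const)
    have "(\<lambda>i. exp (- (b - inverse (real (Suc i)))) * ?ES) \<longlonglongrightarrow> exp (- (b - 0)) * ?ES"
      by (intro tendsto_intros LIMSEQ_inverse_real_of_nat)
    then show "(\<lambda>i. exp (- (b - inverse (real (Suc i)))) * ?ES) \<longlonglongrightarrow> exp (- b) * ?ES" by simp
    show "\<exists>i0. \<forall>i\<ge>i0. cmod Elim \<le> exp (- (b - inverse (real (Suc i)))) * ?ES"
      by (intro exI[of _ 0] allI impI Elim_le) simp
  qed
  \<comment> \<open>The power of S and the phase at u are real, so taking the real part affects only
    c and the phase at v.\<close>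
  moreover have "(\<integral>\<omega>. ?S \<omega> * phase c \<xi> (u, \<omega>) * phase c \<xi> (v, \<omega>) \<partial>M) = Re (c * Elim)"
  proof -
    have int: "complex_integrable M (\<lambda>\<omega>. c * ?Y \<omega>)"
    proof (rule Bochner_Integration.integrable_bound[OF Sint])
      show "AE \<omega> in M. norm (c * ?Y \<omega>) \<le> norm (?S \<omega>)"
      proof (rule AE_I2)
        fix \<omega>
        show "norm (c * ?Y \<omega>) \<le> norm (?S \<omega>)"
          using Sh[of \<omega>] by (simp add: norm_mult norm_power power_mult c)
      qed
    qed measurable
    have "Re (c * Elim) = Re (CLINT \<omega>|M. c * ?Y \<omega>)"
      unfolding Elim_def by simp
    also have "\<dots> = (\<integral>\<omega>. Re (c * ?Y \<omega>) \<partial>M)"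
      by (rule integral_Re[OF int, symmetric])
    also have "\<dots> = (\<integral>\<omega>. ?S \<omega> * phase c \<xi> (u, \<omega>) * phase c \<xi> (v, \<omega>) \<partial>M)"
    proof (rule integral_cong_AE)
      show "AE \<omega> in M. Re (c * ?Y \<omega>) = ?S \<omega> * phase c \<xi> (u, \<omega>) * phase c \<xi> (v, \<omega>)"
        using h_ae
      proof eventually_elim
        case (elim \<omega>)
        have "c * ?Y \<omega> = of_real (?S \<omega> * h \<omega>) * (c * iexp (\<xi> \<bullet> z v \<omega>))"
          by (simp add: mult_ac)
        also have "Re \<dots> = ?S \<omega> * h \<omega> * Re (c * iexp (\<xi> \<bullet> z v \<omega>))" 
            unfolding scaleR_conv_of_real[symmetric] by (rule scaleR_complex.simps(1))
        finally show ?case by (simp add: elim phase_def[of _ _ "(v, \<omega>)"])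
      qed
    qed measurable
    finally show ?thesis ..
  qed
  moreover have "\<bar>Re (c * Elim)\<bar> \<le> cmod Elim"
    using abs_Re_le_cmod[of "c * Elim"] by (simp add: norm_mult c)
  ultimately show ?thesis by (simp add: mult.commute)
qed

section \<open>Moment bounds for the transform of the occupation measure\<close>

lemma N_atomless: "emeasure N ({x} \<inter> space N) = 0"
proof -
  have "emeasure N ({x} \<inter> space N) = emeasure lebesgue ({x} \<inter> {0..T})"
    by (subst emeasure_restrict_space) (auto simp: Int_commute)
  also have "\<dots> \<le> emeasure lebesgue {x}" by (intro emeasure_mono) auto
  finally show ?thesis by simp
qed

definition decay :: "real \<Rightarrow> 'v \<Rightarrow> real" where
  "decay \<theta> \<xi> = (1 + (norm \<xi>)\<^sup>2) powr (- ((1 - \<theta>) * \<alpha> / \<zeta>) / 2)"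

text \<open>The decorrelation factor integrates over time to at most \<open>G\<close> = C1 W (t -
  s)^\<theta> / \<theta>, and the outer time integral contributes t - s; their product is the
  quantity raised to the m-th power. The constant depends neither on \<open>m\<close> nor on
  \<xi>.\<close>

lemma phase_moment:
  fixes \<theta> :: real
  assumes \<theta>: "0 < \<theta>" "\<theta> < 1"
  obtains C where "0 \<le> C"
    "\<And>c \<xi> s t m. cmod c = 1 \<Longrightarrow> 0 \<le> s \<Longrightarrow> s \<le> t \<Longrightarrow> t \<le> T \<Longrightarrow>
      (\<integral>\<omega>. bounded_field.S N (phase c \<xi>) s t \<omega> ^ (2 * m) \<partial>M)
        \<le> fact (2 * m) * (C * ((t - s) powr (1 + \<theta>) * decay \<theta> \<xi>)) ^ m"
proof -
  obtain c0 where c0: "0 < c0"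
    "\<And>s t \<xi>. 0 \<le> s \<Longrightarrow> s < t \<Longrightarrow> t \<le> T \<Longrightarrow>
      ennreal (c0 * (t - s) powr \<zeta> * norm \<xi> powr \<alpha>) \<le> (\<integral>\<^sup>+r\<in>{s..t}. ennreal (Re (\<psi> (k t r *\<^sub>R \<xi>))) \<partial>lebesgue)"
    by (rule nondeterminism) (rule that)
  define \<beta> where "\<beta> = (1 - \<theta>) * \<alpha> / \<zeta>"
  define q where "q = (1 - \<theta>) / \<zeta>"
  define C1 where "C1 = 2 powr (\<beta> / 2) * max (T powr (1 - \<theta>)) (q powr q * c0 powr (- q))"
  have C1: "0 \<le> C1" by (simp add: C1_def max_def)
  show ?thesis
  proof (rule that[of "C1 / \<theta>"])
    show "0 \<le> C1 / \<theta>" using C1 \<theta> by simp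
    fix c \<xi> s t m assume c: "cmod c = 1" and st: "0 \<le> s" "s \<le> t" "t \<le> T"
    interpret bf: bounded_field N M "phase c \<xi>" s by (rule phase_field[OF c])
    define W where "W = (1 + (norm \<xi>)\<^sup>2) powr (- \<beta> / 2)"
    have W: "0 \<le> W" by (simp add: W_def)
    define g where "g = (\<lambda>x. exp (- (c0 * x powr \<zeta> * norm \<xi> powr \<alpha>)))"
    define G where "G = C1 * W * ((t - s) powr \<theta> / \<theta>)"
    have gm[measurable]: "g \<in> borel_measurable borel" unfolding g_def by measurable
    have g_le1: "g x \<le> 1" for x using c0(1) by (simp add: g_def)
    have g_le: "g x \<le> C1 * W * x powr (\<theta> - 1)" if "0 < x" "x \<le> T" for x
      unfolding g_def W_def C1_def \<beta>_def q_def
      by (rule stretched_exp_bound[OF c0(1) \<alpha>_pos \<zeta>_pos \<theta> that])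
    have "(\<integral>\<omega>. bf.S t \<omega> ^ (2 * m) \<partial>M) \<le> fact (2 * m) * ((t - s) * G) ^ m"
    proof (rule bf.moment_bound[OF N_atomless _ _ _ _ _ _ order_refl])
      fix n u v assume uv: "s \<le> u" "u < v" "v \<le> t"
      show "\<bar>\<integral>\<omega>. bf.S u \<omega> ^ (2 * n) * phase c \<xi> (u, \<omega>) * phase c \<xi> (v, \<omega>) \<partial>M\<bar>
          \<le> (\<integral>\<omega>. bf.S u \<omega> ^ (2 * n) \<partial>M) * g (v - u)"
        unfolding g_def using uv st by (intro phase_decorrelation[OF c] c0(2)) auto
    next
      fix v assume v: "s \<le> v" "v \<le> t"
      show "integrable N (\<lambda>u. indicator {s..v} u * g (v - u))"
      proof (rule N.integrable_bounded[where B=1])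
        show "(\<lambda>u. indicator {s..v} u * g (v - u)) \<in> borel_measurable N"
          by (intro borel_lebesgue_on) measurable
        fix u
        show "norm (indicator {s..v} u * g (v - u)) \<le> 1"
          using g_le1[of "v - u"] by (auto simp: g_def split: split_indicator)
      qed
      have "(\<integral>u. indicator {s..v} u * g (v - u) \<partial>N) = (\<integral>u. indicator {s..v} u * g (v - u) \<partial>lborel)"
        using st v by (intro integral_lebesgue_on_borel) auto
      also have "\<dots> \<le> \<bar>\<integral>u. indicator {s..v} u * g (v - u) \<partial>lborel\<bar>" by simp
      also have "\<dots> \<le> (\<integral>u. C1 * W * (indicator {s..v} u * (v - u) powr (\<theta> - 1)) \<partial>lborel)"
      proof (rule integral_abs_bound_AE)
        have "AE u in lborel. u \<noteq> v" by (rule AE_lborel_singleton)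
        then show "AE u in lborel. \<bar>indicator {s..v} u * g (v - u)\<bar> \<le> C1 * W * (indicator {s..v} u * (v - u) powr (\<theta> - 1))"
        proof eventually_elim
          case (elim u)
          then show ?case using g_le[of "v - u"] st v by (auto simp: g_def split: split_indicator)
        qed
        show "integrable lborel (\<lambda>u. C1 * W * (indicator {s..v} u * (v - u) powr (\<theta> - 1)))"
          using has_bochner_integral_powr_reflect[OF \<theta>(1) v(1)]
          by (intro integrable_mult_right) (auto simp: has_bochner_integral_iff)
      qed
      also have "\<dots> = C1 * W * ((v - s) powr \<theta> / \<theta>)"
        using has_bochner_integral_powr_reflect[OF \<theta>(1) v(1)] by (simp add: has_bochner_integral_iff)
      also have "\<dots> \<le> G"
        unfolding G_def using v \<theta> C1 W by (intro mult_left_mono divide_right_mono powr_mono2) auto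
      finally show "(\<integral>u. indicator {s..v} u * g (v - u) \<partial>N) \<le> G" .
    next
      show "(\<integral>u. indicator {s..t} u \<partial>N) \<le> t - s"
        using integral_lebesgue_on_borel[of "\<lambda>_. 1" s t T] st by simp
      show "0 \<le> G" using C1 W \<theta> by (simp add: G_def)
    qed (simp add: g_def)
    also have "(t - s) * G = C1 / \<theta> * ((t - s) powr (1 + \<theta>) * W)"
    proof -
      have "(t - s) powr (1 + \<theta>) = (t - s) * (t - s) powr \<theta>"
        using st by (simp add: powr_add)
      then show ?thesis by (simp add: G_def)
    qed
    finally show "(\<integral>\<omega>. bf.S t \<omega> ^ (2 * m) \<partial>M)
        \<le> fact (2 * m) * (C1 / \<theta> * ((t - s) powr (1 + \<theta>) * decay \<theta> \<xi>)) ^ m"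
      by (simp only: W_def \<beta>_def decay_def)
  qed
qed

text \<open>The Fourier transform at \<open>\<xi>\<close> of the occupation measure of \<open>[s, t]\<close>.\<close>

definition occ_hat :: "real \<Rightarrow> real \<Rightarrow> 'w \<Rightarrow> 'v \<Rightarrow> complex" where
  "occ_hat s t \<omega> \<xi> = (CLINT u|N. of_real (indicator {s..t} u) * iexp (- (\<xi> \<bullet> z u \<omega>)))"

lemma occ_hat_measurable[measurable]: "(\<lambda>(\<xi>, \<omega>). occ_hat s t \<omega> \<xi>) \<in> borel_measurable (borel \<Otimes>\<^sub>M M)"
proof -
  have 1: "(\<lambda>p. (snd p, snd (fst p))) \<in> (borel \<Otimes>\<^sub>M M) \<Otimes>\<^sub>M N \<rightarrow>\<^sub>M N \<Otimes>\<^sub>M M" by measurable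
  have [measurable]: "(\<lambda>p::('v \<times> 'w) \<times> real. z (snd p) (snd (fst p))) \<in> borel_measurable ((borel \<Otimes>\<^sub>M M) \<Otimes>\<^sub>M N)"
    using measurable_compose[OF 1 z_joint] by simp
  have [measurable]: "(\<lambda>p::('v \<times> 'w) \<times> real. indicator {s..t} (snd p) :: real) \<in> borel_measurable ((borel \<Otimes>\<^sub>M M) \<Otimes>\<^sub>M N)"
    by (intro measurable_compose[OF measurable_snd] borel_lebesgue_on) measurable
  show ?thesis
    unfolding occ_hat_def split_beta'
    by (rule N.borel_measurable_lebesgue_integral) (unfold split_beta', measurable)
qed

lemma z_path_measurable: "\<omega> \<in> space M \<Longrightarrow> (\<lambda>u. z u \<omega>) \<in> borel_measurable N"
  using measurable_compose[OF measurable_Pair1' z_joint] by simp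

lemma occ_hat_integrable:
  assumes "\<omega> \<in> space M"
  shows "complex_integrable N (\<lambda>u. of_real (indicator {s..t} u) * iexp (- (\<xi> \<bullet> z u \<omega>)))"
proof (rule N.integrable_bounded[where B=1])
  have [measurable]: "(\<lambda>u. z u \<omega>) \<in> borel_measurable N" by (rule z_path_measurable[OF assms])
  have [measurable]: "(\<lambda>u. indicator {s..t} u :: real) \<in> borel_measurable N"
    by (intro borel_lebesgue_on) measurable
  show "(\<lambda>u. complex_of_real (indicator {s..t} u) * iexp (- (\<xi> \<bullet> z u \<omega>))) \<in> borel_measurable N" by measurable
qed (auto simp: norm_mult split: split_indicator)

text \<open>The phases carry +\<xi> and the transform -\<xi>: cosine is even, and the odd sine
  produces the minus sign.\<close>

lemma occ_hat_phase:
  assumes "\<omega> \<in> space M"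
  shows "Re (occ_hat s t \<omega> \<xi>) = bounded_field.S N (phase 1 \<xi>) s t \<omega>"
    and "Im (occ_hat s t \<omega> \<xi>) = - bounded_field.S N (phase (- \<i>) \<xi>) s t \<omega>"
proof -
  interpret c: bounded_field N M "phase 1 \<xi>" s by (rule phase_field) simp
  interpret i: bounded_field N M "phase (- \<i>) \<xi>" s by (rule phase_field) simp
  show "Re (occ_hat s t \<omega> \<xi>) = c.S t \<omega>"
    unfolding occ_hat_def integral_Re[OF occ_hat_integrable[OF assms], symmetric] c.S_def
    by (intro Bochner_Integration.integral_cong) (auto simp: c.\<phi>_def phase_def Re_exp split: split_indicator)
  show "Im (occ_hat s t \<omega> \<xi>) = - i.S t \<omega>"
    unfolding occ_hat_def integral_Im[OF occ_hat_integrable[OF assms], symmetric] i.S_def integral_minus[symmetric]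
    by (intro Bochner_Integration.integral_cong) (auto simp: i.\<phi>_def phase_def Im_exp split: split_indicator)
qed

lemma occ_hat_moment:
  fixes \<theta> :: real and m :: nat
  assumes \<theta>: "0 < \<theta>" "\<theta> < 1"
  obtains C where "0 \<le> C"
    "\<And>\<xi> s t. 0 \<le> s \<Longrightarrow> s \<le> t \<Longrightarrow> t \<le> T \<Longrightarrow>
      (\<integral>\<^sup>+\<omega>. ennreal (cmod (occ_hat s t \<omega> \<xi>) ^ (2 * m)) \<partial>M)
        \<le> ennreal (C * ((t - s) powr (1 + \<theta>) * decay \<theta> \<xi>) ^ m)"
proof -
  obtain C where C: "0 \<le> C"
    "\<And>c \<xi> s t m. cmod c = 1 \<Longrightarrow> 0 \<le> s \<Longrightarrow> s \<le> t \<Longrightarrow> t \<le> T \<Longrightarrow>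
      (\<integral>\<omega>. bounded_field.S N (phase c \<xi>) s t \<omega> ^ (2 * m) \<partial>M)
        \<le> fact (2 * m) * (C * ((t - s) powr (1 + \<theta>) * decay \<theta> \<xi>)) ^ m"
    by (rule phase_moment[OF \<theta>]) (rule that)
  show ?thesis
  proof (rule that[of "2 ^ m * (2 * fact (2 * m) * C ^ m)"])
    show "0 \<le> 2 ^ m * (2 * fact (2 * m) * C ^ m)" using C(1) by simp
    fix \<xi> s t assume st: "0 \<le> s" "s \<le> t" "t \<le> T"
    interpret c: bounded_field N M "phase 1 \<xi>" s by (rule phase_field) simp
    interpret i: bounded_field N M "phase (- \<i>) \<xi>" s by (rule phase_field) simp
    define A where "A = (t - s) powr (1 + \<theta>) * decay \<theta> \<xi>"
    have cint: "integrable M (\<lambda>\<omega>. c.S t \<omega> ^ (2 * m))"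
      by (rule integrable_bounded[where B="c.B ^ (2 * m)"]) (auto simp only: real_norm_def c.S_power_bound, measurable)
    have iint: "integrable M (\<lambda>\<omega>. i.S t \<omega> ^ (2 * m))"
      by (rule integrable_bounded[where B="i.B ^ (2 * m)"]) (auto simp only: real_norm_def i.S_power_bound, measurable)
    have pw: "cmod (occ_hat s t \<omega> \<xi>) ^ (2 * m) \<le> 2 ^ m * (c.S t \<omega> ^ (2 * m) + i.S t \<omega> ^ (2 * m))"
      if w: "\<omega> \<in> space M" for \<omega>
    proof -
      \<comment> \<open>Real and imaginary parts are separated by (a + b)^m <= (2 max a b)^m <= 2^m
        (a^m + b^m).\<close>
      define a b where "a = (c.S t \<omega>)\<^sup>2" and "b = (i.S t \<omega>)\<^sup>2"
      have ab: "0 \<le> a" "0 \<le> b" by (auto simp: a_def b_def)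
      have "cmod (occ_hat s t \<omega> \<xi>) ^ (2 * m) = (a + b) ^ m"
        unfolding power_mult cmod_power2 occ_hat_phase[OF w] a_def b_def by simp
      also have "\<dots> \<le> (2 * max a b) ^ m" using ab by (intro power_mono) auto
      also have "\<dots> = 2 ^ m * max a b ^ m" by (rule power_mult_distrib)
      also have "max a b ^ m \<le> a ^ m + b ^ m" using ab by (auto simp: max_def)
      finally show ?thesis by (simp add: a_def b_def power_mult)
    qed
    have "(\<integral>\<^sup>+\<omega>. ennreal (cmod (occ_hat s t \<omega> \<xi>) ^ (2 * m)) \<partial>M)
       \<le> (\<integral>\<^sup>+\<omega>. ennreal (2 ^ m * (c.S t \<omega> ^ (2 * m) + i.S t \<omega> ^ (2 * m))) \<partial>M)"
      by (intro nn_integral_mono ennreal_leI pw)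
    also have "\<dots> = ennreal (\<integral>\<omega>. 2 ^ m * (c.S t \<omega> ^ (2 * m) + i.S t \<omega> ^ (2 * m)) \<partial>M)"
      using cint iint by (intro nn_integral_eq_integral) (auto simp: power_mult)
    also have "\<dots> \<le> ennreal (2 ^ m * (2 * fact (2 * m) * C ^ m) * A ^ m)"
    proof (rule ennreal_leI)
      have "(\<integral>\<omega>. 2 ^ m * (c.S t \<omega> ^ (2 * m) + i.S t \<omega> ^ (2 * m)) \<partial>M)
          = 2 ^ m * ((\<integral>\<omega>. c.S t \<omega> ^ (2 * m) \<partial>M) + (\<integral>\<omega>. i.S t \<omega> ^ (2 * m) \<partial>M))"
        using cint iint by simp
      also have "\<dots> \<le> 2 ^ m * (fact (2 * m) * (C * A) ^ m + fact (2 * m) * (C * A) ^ m)"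
        unfolding A_def using st by (intro mult_left_mono add_mono C(2)) auto
      finally show "(\<integral>\<omega>. 2 ^ m * (c.S t \<omega> ^ (2 * m) + i.S t \<omega> ^ (2 * m)) \<partial>M)
          \<le> 2 ^ m * (2 * fact (2 * m) * C ^ m) * A ^ m"
        by (simp add: power_mult_distrib mult_ac)
    qed
    finally show "(\<integral>\<^sup>+\<omega>. ennreal (cmod (occ_hat s t \<omega> \<xi>) ^ (2 * m)) \<partial>M)
        \<le> ennreal (2 ^ m * (2 * fact (2 * m) * C ^ m) * ((t - s) powr (1 + \<theta>) * decay \<theta> \<xi>) ^ m)"
      by (simp only: A_def)
  qed
qed

end

section \<open>Hoelder regularity of the occupation measure\<close>

context volterra_levy
begin

lemma AE_N_neq: "AE u in N. u \<noteq> x"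
  by (rule AE_neq_atomless) (auto intro: borel_lebesgue_on simp: N_atomless[simplified])

lemma occ_hat_measurable_freq[measurable]: "\<omega> \<in> space M \<Longrightarrow> occ_hat s t \<omega> \<in> borel_measurable borel"
  using measurable_compose[OF measurable_Pair2' occ_hat_measurable] by simp

lemma occ_hat_refl: "\<omega> \<in> space M \<Longrightarrow> occ_hat s s \<omega> \<xi> = 0"
proof -
  assume "\<omega> \<in> space M"
  then have [measurable]: "(\<lambda>u. of_real (indicator {s..s} u) * iexp (- (\<xi> \<bullet> z u \<omega>))) \<in> borel_measurable N"
    by (intro borel_measurable_integrable occ_hat_integrable)
  have "occ_hat s s \<omega> \<xi> = (CLINT u|N. 0)"
    unfolding occ_hat_def
  proof (rule integral_cong_AE)
    show "AE u in N. complex_of_real (indicator {s..s} u) * iexp (- (\<xi> \<bullet> z u \<omega>)) = 0"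
      using AE_N_neq[of s] by eventually_elim simp
  qed measurable
  then show ?thesis by simp
qed

lemma occ_hat_add:
  assumes w: "\<omega> \<in> space M" and "x \<le> y" "y \<le> v"
  shows "occ_hat x v \<omega> \<xi> = occ_hat x y \<omega> \<xi> + occ_hat y v \<omega> \<xi>"
proof -
  let ?f = "\<lambda>a b u. complex_of_real (indicator {a..b} u) * iexp (- (\<xi> \<bullet> z u \<omega>))"
  have int: "complex_integrable N (?f a b)" for a b by (rule occ_hat_integrable[OF w])
  have "occ_hat x v \<omega> \<xi> = (CLINT u|N. ?f x y u + ?f y v u)"
    unfolding occ_hat_def
  proof (rule integral_cong_AE)
    show "AE u in N. ?f x v u = ?f x y u + ?f y v u"
      using AE_N_neq[of y] by eventually_elim (use assms in \<open>auto split: split_indicator\<close>)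
  qed (use int in \<open>auto intro!: borel_measurable_add borel_measurable_integrable\<close>)
  also have "\<dots> = occ_hat x y \<omega> \<xi> + occ_hat y v \<omega> \<xi>"
    unfolding occ_hat_def by (rule Bochner_Integration.integral_add[OF int int])
  finally show ?thesis .
qed

text \<open>The indicators converge at every time other than the two limiting endpoints, which form
  a null set. Through Fatou this supplies the semicontinuity required by the chaining.\<close>

lemma occ_hat_tendsto:
  assumes w: "\<omega> \<in> space M" and "xs \<longlonglongrightarrow> x" "ys \<longlonglongrightarrow> y"
  shows "(\<lambda>n. occ_hat (xs n) (ys n) \<omega> \<xi>) \<longlonglongrightarrow> occ_hat x y \<omega> \<xi>"
  unfolding occ_hat_def
proof (rule integral_dominated_convergence[where w="\<lambda>_. 1"])
  show "AE u in N. (\<lambda>n. complex_of_real (indicator {xs n..ys n} u) * iexp (- (\<xi> \<bullet> z u \<omega>)))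
      \<longlonglongrightarrow> complex_of_real (indicator {x..y} u) * iexp (- (\<xi> \<bullet> z u \<omega>))"
    using AE_N_neq[of x] AE_N_neq[of y]
  proof eventually_elim
    case (elim u)
    have "eventually (\<lambda>n. (xs n \<le> u) = (x \<le> u)) sequentially"
    proof (cases "x < u")
      case True
      show ?thesis using order_tendstoD(2)[OF assms(2) True]
        by (rule eventually_mono) (use True in auto)
    next
      case False
      then have "u < x" using elim by simp
      show ?thesis using order_tendstoD(1)[OF assms(2) \<open>u < x\<close>]
        by (rule eventually_mono) (use \<open>u < x\<close> in auto)
    qed
    moreover have "eventually (\<lambda>n. (u \<le> ys n) = (u \<le> y)) sequentially"
    proof (cases "u < y")
      case True
      show ?thesis using order_tendstoD(1)[OF assms(3) True]
        by (rule eventually_mono) (use True in auto)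
    next
      case False
      then have "y < u" using elim by simp
      show ?thesis using order_tendstoD(2)[OF assms(3) \<open>y < u\<close>]
        by (rule eventually_mono) (use \<open>y < u\<close> in auto)
    qed
    ultimately have "eventually (\<lambda>n. indicator {x..y} u = (indicator {xs n..ys n} u :: real)) sequentially"
      by eventually_elim (simp add: indicator_def)
    then show ?case by (intro tendsto_eventually) (auto elim: eventually_mono)
  qed
qed (use occ_hat_integrable[OF w] in \<open>auto simp: norm_mult split: split_indicator intro!: AE_I2\<close>)

text \<open>The Sobolev weight is factored as \<rho> times a power that exactly cancels the decay in
  \<xi>, so \<open>q\<close> has moments bounded uniformly in \<xi> and the integrable \<rho>
  carries the \<xi>-integral. Expectations are taken of the integral of \<rho> q^m, where Fubini
  applies directly; the return to \<rho> q is made afterwards for fixed \<omega> by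
  \<open>bernoulli_nn_integral\<close>.\<close>

lemma occ_hat_holder:
  fixes \<theta> \<kappa> \<gamma> :: real
  assumes \<theta>: "0 < \<theta>" "\<theta> < 1" and \<kappa>: "2 * \<kappa> + real DIM('v) < (1 - \<theta>) * \<alpha> / \<zeta>"
    and \<gamma>: "0 < \<gamma>" "2 * \<gamma> < 1 + \<theta>"
  shows "AE \<omega> in M. \<exists>C>0. \<forall>s\<in>{0..T}. \<forall>t\<in>{0..T}. s < t \<longrightarrow>
     L2_le lborel (\<lambda>\<xi>. (1 + (norm \<xi>)\<^sup>2) powr \<kappa>) (occ_hat s t \<omega>) (C * (t - s) powr \<gamma>)"
proof -
  define \<beta> where "\<beta> = (1 - \<theta>) * \<alpha> / \<zeta>"
  \<comment> \<open>The assumption on \<kappa> says precisely that 2 \<delta> exceeds the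
    dimension.\<close>
  define \<delta> where "\<delta> = \<beta> / 2 - \<kappa>"
  define J1 where "J1 = (\<lambda>\<xi>::'v. 1 + (norm \<xi>)\<^sup>2)"
  have J1: "1 \<le> J1 \<xi>" "0 < J1 \<xi>" for \<xi> by (auto simp: J1_def intro: add_pos_nonneg)
  have [measurable]: "J1 \<in> borel_measurable borel" unfolding J1_def by measurable
  define \<rho> where "\<rho> = (\<lambda>\<xi>. J1 \<xi> powr (- \<delta>))"
  have [measurable]: "\<rho> \<in> borel_measurable borel" unfolding \<rho>_def by measurable
  obtain R where R: "1 \<le> R" "(\<integral>\<^sup>+\<xi>. ennreal (\<rho> \<xi>) \<partial>lborel) \<le> ennreal R"
  proof -
    have "real DIM('v) < 2 * \<delta>" using \<kappa> by (simp add: \<delta>_def \<beta>_def)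
    then have fin: "(\<integral>\<^sup>+\<xi>. ennreal (\<rho> \<xi>) \<partial>lborel) < \<infinity>"
      unfolding \<rho>_def J1_def by (rule nn_integral_bessel_finite)
    then obtain R0 where "(\<integral>\<^sup>+\<xi>. ennreal (\<rho> \<xi>) \<partial>lborel) = ennreal R0"
      by (cases "\<integral>\<^sup>+\<xi>. ennreal (\<rho> \<xi>) \<partial>lborel") auto
    then show ?thesis by (intro that[of "max 1 R0"]) (auto intro: ennreal_leI)
  qed
  \<comment> \<open>This choice makes the ratio \<open>r\<close> of the series bounding E Z smaller
    than 1: the 2^n intervals of level n are outweighed by the moment gain.\<close>
  obtain m :: nat where m: "1 / (1 + \<theta> - 2 * \<gamma>) < real m" using reals_Archimedean2 by blast
  have "0 < 1 / (1 + \<theta> - 2 * \<gamma>)" using \<gamma> by simp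
  then have m0: "0 < m" using m by (metis gr0I of_nat_0 order_less_trans less_irrefl)
  have m1: "1 < real m * (1 + \<theta> - 2 * \<gamma>)" using m \<gamma> by (simp add: field_simps)
  obtain C where C: "0 \<le> C"
    "\<And>\<xi> s t. 0 \<le> s \<Longrightarrow> s \<le> t \<Longrightarrow> t \<le> T \<Longrightarrow>
      (\<integral>\<^sup>+\<omega>. ennreal (cmod (occ_hat s t \<omega> \<xi>) ^ (2 * m)) \<partial>M)
        \<le> ennreal (C * ((t - s) powr (1 + \<theta>) * decay \<theta> \<xi>) ^ m)"
    by (rule occ_hat_moment[OF \<theta>, of m]) (rule that)
  define q where "q = (\<lambda>s t \<omega> \<xi>. J1 \<xi> powr (\<beta> / 2) * (cmod (occ_hat s t \<omega> \<xi>))\<^sup>2)"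
  have q0: "0 \<le> q s t \<omega> \<xi>" for s t \<omega> \<xi> by (simp add: q_def)
  have \<rho>q: "\<rho> \<xi> * q s t \<omega> \<xi> = (1 + (norm \<xi>)\<^sup>2) powr \<kappa> * (cmod (occ_hat s t \<omega> \<xi>))\<^sup>2" for s t \<omega> \<xi>
    unfolding \<rho>_def q_def mult.assoc[symmetric] powr_add[symmetric] by (simp add: \<delta>_def J1_def)
  have q_meas[measurable]: "(\<lambda>(\<xi>, \<omega>). q s t \<omega> \<xi>) \<in> borel_measurable (borel \<Otimes>\<^sub>M M)" for s t
    unfolding q_def by measurable
  define J where "J = (\<lambda>s t \<omega>. \<integral>\<^sup>+\<xi>. ennreal (\<rho> \<xi> * q s t \<omega> \<xi> ^ m) \<partial>lborel)"
  interpret LM: pair_sigma_finite "lborel :: 'v measure" M ..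
  have Jpair: "(\<lambda>(\<xi>, \<omega>). ennreal (\<rho> \<xi> * q s t \<omega> \<xi> ^ m)) \<in> borel_measurable (lborel \<Otimes>\<^sub>M M)" for s t
    by measurable
  have J_meas[measurable]: "J s t \<in> borel_measurable M" for s t
    unfolding J_def by measurable
  have EJ: "(\<integral>\<^sup>+\<omega>. J s t \<omega> \<partial>M) \<le> ennreal (C * R * ((t - s) powr (1 + \<theta>)) ^ m)"
    if st: "0 \<le> s" "s \<le> t" "t \<le> T" for s t
  proof -
    have "(\<integral>\<^sup>+\<omega>. J s t \<omega> \<partial>M) = (\<integral>\<^sup>+\<xi>. (\<integral>\<^sup>+\<omega>. ennreal (\<rho> \<xi> * q s t \<omega> \<xi> ^ m) \<partial>M) \<partial>lborel)"
      unfolding J_def by (rule LM.Fubini'[OF Jpair])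
    also have "\<dots> \<le> (\<integral>\<^sup>+\<xi>. ennreal (C * ((t - s) powr (1 + \<theta>)) ^ m) * ennreal (\<rho> \<xi>) \<partial>lborel)"
    proof (rule nn_integral_mono)
      fix \<xi> :: 'v
      have [measurable]: "(\<lambda>\<omega>. occ_hat s t \<omega> \<xi>) \<in> borel_measurable M"
        using measurable_compose[OF measurable_Pair1' occ_hat_measurable] by simp
      define P where "P = J1 \<xi> powr (\<beta> / 2)"
      have P: "0 < P" using J1(2)[of \<xi>] by (simp add: P_def)
      have "(\<integral>\<^sup>+\<omega>. ennreal (\<rho> \<xi> * q s t \<omega> \<xi> ^ m) \<partial>M)
         = (\<integral>\<^sup>+\<omega>. ennreal (\<rho> \<xi> * P ^ m) * ennreal (cmod (occ_hat s t \<omega> \<xi>) ^ (2 * m)) \<partial>M)"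
      proof (rule nn_integral_cong)
        fix \<omega>
        have "\<rho> \<xi> * q s t \<omega> \<xi> ^ m = (\<rho> \<xi> * P ^ m) * cmod (occ_hat s t \<omega> \<xi>) ^ (2 * m)"
          by (simp add: q_def P_def power_mult_distrib power_mult)
        then show "ennreal (\<rho> \<xi> * q s t \<omega> \<xi> ^ m) = ennreal (\<rho> \<xi> * P ^ m) * ennreal (cmod (occ_hat s t \<omega> \<xi>) ^ (2 * m))"
          using P by (simp only:, intro ennreal_mult) (auto simp: \<rho>_def)
      qed
      also have "\<dots> = ennreal (\<rho> \<xi> * P ^ m) * (\<integral>\<^sup>+\<omega>. ennreal (cmod (occ_hat s t \<omega> \<xi>) ^ (2 * m)) \<partial>M)"
        by (rule nn_integral_cmult) measurable
      also have "\<dots> \<le> ennreal (\<rho> \<xi> * P ^ m) * ennreal (C * ((t - s) powr (1 + \<theta>) * decay \<theta> \<xi>) ^ m)"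
        by (intro mult_left_mono C(2) st) simp
      also have "decay \<theta> \<xi> = inverse P"
        by (simp add: decay_def P_def J1_def \<beta>_def powr_minus[symmetric])
      also have "ennreal (\<rho> \<xi> * P ^ m) * ennreal (C * ((t - s) powr (1 + \<theta>) * inverse P) ^ m)
         = ennreal (\<rho> \<xi> * P ^ m * (C * ((t - s) powr (1 + \<theta>) * inverse P) ^ m))"
        using P C(1) by (intro ennreal_mult[symmetric]) (auto simp: \<rho>_def)
      also have "\<rho> \<xi> * P ^ m * (C * ((t - s) powr (1 + \<theta>) * inverse P) ^ m) = C * ((t - s) powr (1 + \<theta>)) ^ m * \<rho> \<xi>"
        using P by (simp add: power_mult_distrib power_inverse)
      also have "ennreal \<dots> = ennreal (C * ((t - s) powr (1 + \<theta>)) ^ m) * ennreal (\<rho> \<xi>)"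
        using C(1) by (intro ennreal_mult) (auto simp: \<rho>_def)
      finally show "(\<integral>\<^sup>+\<omega>. ennreal (\<rho> \<xi> * q s t \<omega> \<xi> ^ m) \<partial>M)
          \<le> ennreal (C * ((t - s) powr (1 + \<theta>)) ^ m) * ennreal (\<rho> \<xi>)" .
    qed
    also have "\<dots> = ennreal (C * ((t - s) powr (1 + \<theta>)) ^ m) * (\<integral>\<^sup>+\<xi>. ennreal (\<rho> \<xi>) \<partial>lborel)"
      by (rule nn_integral_cmult) measurable
    also have "\<dots> \<le> ennreal (C * ((t - s) powr (1 + \<theta>)) ^ m) * ennreal R"
      using R(2) by (rule mult_left_mono) simp
    also have "\<dots> = ennreal (C * R * ((t - s) powr (1 + \<theta>)) ^ m)"
      using C(1) R(1) by (subst ennreal_mult[symmetric]) (auto simp: mult_ac)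
    finally show ?thesis .
  qed
  define e where "e = 2 * \<gamma> * real m"
  define p where "p = (\<lambda>n k. T * real k / 2 ^ n)"
  \<comment> \<open>\<open>Z\<close> adds up the functionals of all dyadic intervals, weighted by
    the reciprocal of their expected size 2^(-2 \<gamma> m n), so finiteness of one random variable
    controls every interval at once.\<close>
  define Z where "Z = (\<lambda>\<omega>. \<Sum>n. \<Sum>k<2 ^ n. ennreal (2 powr (e * real n)) * J (p n k) (p n (Suc k)) \<omega>)"
  have [measurable]: "Z \<in> borel_measurable M" unfolding Z_def by measurable
  define r where "r = 2 powr (1 + e - real m * (1 + \<theta>))"
  have r: "0 < r" "r < 1" using m1 by (auto simp: r_def e_def powr_less_one algebra_simps)
  define D where "D = C * R * (T powr (1 + \<theta>)) ^ m"
  have D: "0 \<le> D" using C(1) R(1) by (simp add: D_def)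
  have "(\<integral>\<^sup>+\<omega>. Z \<omega> \<partial>M) = (\<Sum>n. \<integral>\<^sup>+\<omega>. (\<Sum>k<2 ^ n. ennreal (2 powr (e * real n)) * J (p n k) (p n (Suc k)) \<omega>) \<partial>M)"
    unfolding Z_def by (rule nn_integral_suminf) measurable
  also have "\<dots> \<le> (\<Sum>n. ennreal (D * r ^ n))"
  proof (rule suminf_le)
    fix n
    have "(\<integral>\<^sup>+\<omega>. (\<Sum>k<2 ^ n. ennreal (2 powr (e * real n)) * J (p n k) (p n (Suc k)) \<omega>) \<partial>M)
        = (\<Sum>k<2 ^ n. ennreal (2 powr (e * real n)) * (\<integral>\<^sup>+\<omega>. J (p n k) (p n (Suc k)) \<omega> \<partial>M))"
      by (subst nn_integral_sum) (auto simp: nn_integral_cmult)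
    also have "\<dots> \<le> (\<Sum>k<(2::nat) ^ n. ennreal (2 powr (e * real n)) * ennreal (C * R * ((T / 2 ^ n) powr (1 + \<theta>)) ^ m))"
    proof (intro sum_mono mult_left_mono)
      fix k :: nat assume "k \<in> {..<2 ^ n}"
      then have "Suc k \<le> 2 ^ n" by simp
      then have k: "real (Suc k) \<le> 2 ^ n" by (metis of_nat_le_iff of_nat_numeral of_nat_power)
      have "T * real (Suc k) \<le> T * 2 ^ n" using k T_pos by (intro mult_left_mono) auto
      then have "p n (Suc k) \<le> T" by (simp add: p_def divide_le_eq)
      moreover have "p n (Suc k) - p n k = T / 2 ^ n" by (simp add: p_def field_simps)
      ultimately show "(\<integral>\<^sup>+\<omega>. J (p n k) (p n (Suc k)) \<omega> \<partial>M) \<le> ennreal (C * R * ((T / 2 ^ n) powr (1 + \<theta>)) ^ m)"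
        using EJ[of "p n k" "p n (Suc k)"] T_pos by (auto simp: p_def divide_right_mono)
    qed simp
    also have "\<dots> = ennreal (2 ^ n * (2 powr (e * real n) * (C * R * ((T / 2 ^ n) powr (1 + \<theta>)) ^ m)))"
      using C(1) R(1) by (simp add: ennreal_mult ennreal_power[symmetric])
    also have "2 ^ n * (2 powr (e * real n) * (C * R * ((T / 2 ^ n) powr (1 + \<theta>)) ^ m)) = D * r ^ n"
    proof -
      have "(T / 2 ^ n) powr (1 + \<theta>) = T powr (1 + \<theta>) * 2 powr (- (1 + \<theta>) * real n)"
      proof -
        have "T / 2 ^ n = T * 2 powr (- real n)" by (simp add: powr_minus powr_realpow divide_inverse)
        then show ?thesis by (simp add: powr_mult powr_powr algebra_simps)
      qed
      then have "((T / 2 ^ n) powr (1 + \<theta>)) ^ m = (T powr (1 + \<theta>)) ^ m * 2 powr (- (1 + \<theta>) * real n * real m)"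
        by (simp add: power_mult_distrib powr_powr[symmetric] powr_realpow[symmetric])
      moreover have "(2::real) ^ n = 2 powr real n" by (simp add: powr_realpow)
      moreover have "r ^ n = 2 powr ((1 + e - real m * (1 + \<theta>)) * real n)"
        by (simp add: r_def powr_realpow[symmetric] powr_powr)
      moreover have "2 powr real n * 2 powr (e * real n) * 2 powr (- (1 + \<theta>) * real n * real m)
          = (2::real) powr ((1 + e - real m * (1 + \<theta>)) * real n)"
        by (simp add: powr_add[symmetric] algebra_simps)
      ultimately show ?thesis by (simp add: D_def mult_ac)
    qed
    finally show "(\<integral>\<^sup>+\<omega>. (\<Sum>k<2 ^ n. ennreal (2 powr (e * real n)) * J (p n k) (p n (Suc k)) \<omega>) \<partial>M) \<le> ennreal (D * r ^ n)" .
  qed auto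
  also have "\<dots> < \<infinity>"
  proof -
    have "(\<Sum>n. ennreal (D * r ^ n)) \<noteq> \<top>"
      using r D by (intro ennreal_suminf_neq_top summable_mult summable_geometric) auto
    then show ?thesis by (simp add: less_top)
  qed
  finally have "(\<integral>\<^sup>+\<omega>. Z \<omega> \<partial>M) \<noteq> \<infinity>" by simp
  then have "AE \<omega> in M. Z \<omega> \<noteq> \<infinity>" by (intro nn_integral_noteq_infinite) measurable
  then show ?thesis
    using AE_space
  proof eventually_elim
    case (elim \<omega>)
    then have w: "\<omega> \<in> space M" by simp
    obtain K where K: "1 \<le> K" "Z \<omega> \<le> ennreal K"
    proof -
      obtain K0 where "Z \<omega> = ennreal K0" using elim(1) by (cases "Z \<omega>") auto
      then show ?thesis by (intro that[of "max 1 K0"]) (auto intro: ennreal_leI)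
    qed
    let ?w = "\<lambda>\<xi>::'v. (1 + (norm \<xi>)\<^sup>2) powr \<kappa>"
    have wm: "?w \<in> borel_measurable lborel" by measurable
    have om: "occ_hat x y \<omega> \<in> borel_measurable lborel" for x y using occ_hat_measurable_freq[OF w] by simp
    define Q where "Q = (\<lambda>x y C. L2_le lborel ?w (occ_hat x y \<omega>) C)"
    have step: "Q (T * real k / 2 ^ n) (T * real (Suc k) / 2 ^ n) (sqrt (K * R) * 2 powr (- \<gamma> * real n))"
      if k: "k < 2 ^ n" for n k
    proof -
      have "ennreal (2 powr (e * real n)) * J (p n k) (p n (Suc k)) \<omega>
          \<le> (\<Sum>k<2 ^ n. ennreal (2 powr (e * real n)) * J (p n k) (p n (Suc k)) \<omega>)"
        using k by (intro member_le_sum) auto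
      also have "\<dots> \<le> Z \<omega>"
      proof -
        define g where "g = (\<lambda>n. \<Sum>k<2 ^ n. ennreal (2 powr (e * real n)) * J (p n k) (p n (Suc k)) \<omega>)"
        have "sum g {n} \<le> suminf g" by (intro sum_le_suminf) auto
        then show ?thesis by (simp add: g_def Z_def)
      qed
      finally have "ennreal (2 powr (e * real n)) * J (p n k) (p n (Suc k)) \<omega> \<le> ennreal K"
        using K(2) by simp
      then have "ennreal (2 powr (- e * real n)) * (ennreal (2 powr (e * real n)) * J (p n k) (p n (Suc k)) \<omega>)
          \<le> ennreal (2 powr (- e * real n)) * ennreal K" by (intro mult_left_mono) auto
      also have "ennreal (2 powr (- e * real n)) * (ennreal (2 powr (e * real n)) * J (p n k) (p n (Suc k)) \<omega>)
          = J (p n k) (p n (Suc k)) \<omega>"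
        by (simp add: mult.assoc[symmetric] ennreal_mult[symmetric] powr_add[symmetric])
      also have "ennreal (2 powr (- e * real n)) * ennreal K \<le> ennreal ((K * 2 powr (- 2 * \<gamma> * real n)) ^ m * R)"
      proof -
        \<comment> \<open>With K >= 1 the constant can be moved under the m-th power, giving the
          form a^m R that \<open>bernoulli_nn_integral\<close> expects with a = K 2^(-2 \<gamma>
          n).\<close>
        have "K \<le> K ^ m" using K(1) m0 by (simp add: self_le_power)
        moreover have "(2 powr (- 2 * \<gamma> * real n)) ^ m = (2::real) powr (- e * real n)"
          by (simp add: powr_realpow[symmetric] powr_powr e_def mult_ac)
        ultimately have "2 powr (- e * real n) * K \<le> (K * 2 powr (- 2 * \<gamma> * real n)) ^ m * 1"
          by (simp add: power_mult_distrib mult.commute)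
        also have "\<dots> \<le> (K * 2 powr (- 2 * \<gamma> * real n)) ^ m * R"
          using R(1) K(1) by (intro mult_left_mono) auto
        finally show ?thesis using K(1) by (subst ennreal_mult[symmetric]) (auto intro: ennreal_leI)
      qed
      finally have Jle: "(\<integral>\<^sup>+\<xi>. ennreal (\<rho> \<xi> * q (p n k) (p n (Suc k)) \<omega> \<xi> ^ m) \<partial>lborel)
          \<le> ennreal ((K * 2 powr (- 2 * \<gamma> * real n)) ^ m * R)" by (simp add: J_def)
      have "(\<integral>\<^sup>+\<xi>. ennreal (\<rho> \<xi> * q (p n k) (p n (Suc k)) \<omega> \<xi>) \<partial>lborel) \<le> ennreal (K * 2 powr (- 2 * \<gamma> * real n) * R)"
      proof (rule bernoulli_nn_integral[OF _ _ _ _ _ m0 R(2) _ Jle])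
        have [measurable]: "occ_hat (p n k) (p n (Suc k)) \<omega> \<in> borel_measurable lborel" by (rule om)
        show "q (p n k) (p n (Suc k)) \<omega> \<in> borel_measurable lborel" unfolding q_def by measurable
      qed (use q0 K(1) R(1) in \<open>auto simp: \<rho>_def[abs_def]\<close>)
      also have "K * 2 powr (- 2 * \<gamma> * real n) * R = (sqrt (K * R) * 2 powr (- \<gamma> * real n))\<^sup>2"
      proof -
        have "(2 powr (- \<gamma> * real n))\<^sup>2 = (2::real) powr (- 2 * \<gamma> * real n)"
          by (simp add: power2_eq_square powr_add[symmetric] mult.assoc)
        then show ?thesis using K(1) R(1) by (simp add: power_mult_distrib)
      qed
      finally show ?thesis unfolding Q_def L2_le_def \<rho>q p_def .
    qed
    obtain C' where C': "0 < C'"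
      "\<And>x y. x \<in> {0..T} \<Longrightarrow> y \<in> {0..T} \<Longrightarrow> x < y \<Longrightarrow> Q x y (C' * (y - x) powr \<gamma>)"
    proof (rule dyadic_chaining[where Q=Q and T=T and K="sqrt (K * R)" and \<gamma>=\<gamma>])
      fix x C :: real
      show "Q x x C" by (simp add: Q_def L2_le_def occ_hat_refl[OF w])
    next
      fix x y C D :: real assume "Q x y C" "0 < C" "C \<le> D"
      then show "Q x y D" unfolding Q_def by (rule L2_le_mono[OF _ less_imp_le])
    next
      fix x y v C D :: real
      assume xy: "x \<le> y" "y \<le> v" "0 < C" "0 < D" "Q x y C" "Q y v D"
      have "occ_hat x v \<omega> = (\<lambda>\<xi>. occ_hat x y \<omega> \<xi> + occ_hat y v \<omega> \<xi>)"
        using occ_hat_add[OF w xy(1,2)] by auto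
      moreover have "L2_le lborel ?w (\<lambda>\<xi>. occ_hat x y \<omega> \<xi> + occ_hat y v \<omega> \<xi>) (C + D)"
        using xy unfolding Q_def by (intro L2_le_add wm om) auto
      ultimately show "Q x v (C + D)" by (simp add: Q_def)
    next
      fix x y C :: real and xs ys :: "nat \<Rightarrow> real"
      assume lim: "xs \<longlonglongrightarrow> x" "ys \<longlonglongrightarrow> y" and Qn: "\<And>n. Q (xs n) (ys n) C"
      have [measurable]: "occ_hat a b \<omega> \<in> borel_measurable lborel" for a b by (rule om)
      \<comment> \<open>Lower semicontinuity of the weighted norm: the transforms converge at each
        \<xi>, and Fatou does the rest.\<close>
      have "(\<integral>\<^sup>+\<xi>. ennreal (?w \<xi> * (cmod (occ_hat x y \<omega> \<xi>))\<^sup>2) \<partial>lborel)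
          = (\<integral>\<^sup>+\<xi>. liminf (\<lambda>n. ennreal (?w \<xi> * (cmod (occ_hat (xs n) (ys n) \<omega> \<xi>))\<^sup>2)) \<partial>lborel)"
      proof (rule nn_integral_cong)
        fix \<xi>
        have "(\<lambda>n. ennreal (?w \<xi> * (cmod (occ_hat (xs n) (ys n) \<omega> \<xi>))\<^sup>2)) \<longlonglongrightarrow> ennreal (?w \<xi> * (cmod (occ_hat x y \<omega> \<xi>))\<^sup>2)"
          by (intro tendsto_ennrealI tendsto_mult tendsto_const tendsto_power tendsto_norm occ_hat_tendsto[OF w lim])
        then show "ennreal (?w \<xi> * (cmod (occ_hat x y \<omega> \<xi>))\<^sup>2)
            = liminf (\<lambda>n. ennreal (?w \<xi> * (cmod (occ_hat (xs n) (ys n) \<omega> \<xi>))\<^sup>2))"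
          by (rule lim_imp_Liminf[OF sequentially_bot, symmetric])
      qed
      also have "\<dots> \<le> liminf (\<lambda>n. \<integral>\<^sup>+\<xi>. ennreal (?w \<xi> * (cmod (occ_hat (xs n) (ys n) \<omega> \<xi>))\<^sup>2) \<partial>lborel)"
        by (rule nn_integral_liminf) measurable
      also have "\<dots> \<le> liminf (\<lambda>n. ennreal (C\<^sup>2))"
        using Qn unfolding Q_def L2_le_def by (intro Liminf_mono always_eventually allI)
      also have "\<dots> = ennreal (C\<^sup>2)" by (simp add: Liminf_const)
      finally show "Q x y C" by (simp add: Q_def L2_le_def)
    next
      show "0 < sqrt (K * R)" using K(1) R(1) by simp
    qed (use step T_pos \<gamma> that in auto)
    then show ?case unfolding Q_def by blast
  qed
qed

end

section \<open>Local times\<close>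

definition occ :: "(real \<Rightarrow> 'v::euclidean_space) \<Rightarrow> real \<Rightarrow> 'v measure" where
  "occ w t = distr (lebesgue_on {0..t}) borel w"

text \<open>Defined for every path, so that nonnegativity holds without exception; it is a density
  of the occupation measure once absolute continuity is known. \<open>enn2real\<close> sends the
  value infinity to 0, which for a finite measure alters the derivative on a null set only.\<close>

definition local_time :: "(real \<Rightarrow> 'v::euclidean_space) \<Rightarrow> real \<Rightarrow> 'v \<Rightarrow> real" where
  "local_time w t x = enn2real (RN_deriv lborel (occ w t) x)"

lemma sets_occ: "sets (occ w t) = sets borel"
  by (simp add: occ_def)

context
  fixes T :: real and w :: "real \<Rightarrow> 'v::euclidean_space"
  assumes w: "w \<in> borel_measurable (lebesgue_on {0..T})"
begin

lemma path_measurable: "t \<le> T \<Longrightarrow> w \<in> borel_measurable (lebesgue_on {0..t})"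
  by (rule measurable_restrict_mono[OF w]) auto

lemma finite_measure_occ: "t \<le> T \<Longrightarrow> finite_measure (occ w t)"
  unfolding occ_def
  by (intro finite_measure.finite_measure_distr finite_measure_lebesgue_on_Icc path_measurable)

lemma emeasure_occ:
  assumes t: "t \<le> T" and A: "A \<in> sets borel"
  shows "emeasure (occ w t) A = occupation_measure w t A"
proof -
  have "emeasure (occ w t) A = emeasure (lebesgue_on {0..t}) (w -` A \<inter> {0..t})"
    unfolding occ_def using path_measurable[OF t] A by (subst emeasure_distr) auto
  also have "\<dots> = emeasure lebesgue (w -` A \<inter> {0..t})"
    by (rule emeasure_restrict_space) auto
  also have "w -` A \<inter> {0..t} = {s\<in>{0..t}. w s \<in> A}" by auto
  finally show ?thesis by (simp add: occupation_measure_def)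
qed

lemma occ_integral:
  assumes t: "t \<le> T"
  shows "(CLINT x|occ w t. iexp (- (\<xi> \<bullet> x)))
    = (CLINT u|lebesgue_on {0..T}. of_real (indicator {0..t} u) * iexp (- (\<xi> \<bullet> w u)))"
proof -
  have "(CLINT x|occ w t. iexp (- (\<xi> \<bullet> x))) = (CLINT u|lebesgue_on {0..t}. iexp (- (\<xi> \<bullet> w u)))"
    unfolding occ_def using path_measurable[OF t] by (subst integral_distr) auto
  also have "\<dots> = (CLINT u|lebesgue. indicator {0..t} u *\<^sub>R iexp (- (\<xi> \<bullet> w u)))"
    by (rule integral_restrict_space) auto
  also have "\<dots> = (CLINT u|lebesgue. indicator {0..T} u *\<^sub>R (of_real (indicator {0..t} u) * iexp (- (\<xi> \<bullet> w u))))"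
    using t by (intro Bochner_Integration.integral_cong) (auto split: split_indicator)
  also have "\<dots> = (CLINT u|lebesgue_on {0..T}. of_real (indicator {0..t} u) * iexp (- (\<xi> \<bullet> w u)))"
    by (rule integral_restrict_space[symmetric]) auto
  finally show ?thesis .
qed

text \<open>Occupation measures increase with time, so absolute continuity at the final time implies
  it at all earlier ones. One exceptional set of \<omega> therefore serves every t.\<close>

lemma absolutely_continuous_occ:
  assumes ac: "absolutely_continuous lborel (occ w T)" and t: "t \<le> T"
  shows "absolutely_continuous lborel (occ w t)"
  unfolding absolutely_continuous_def
proof
  fix A :: "'v set" assume A: "A \<in> null_sets lborel"
  then have Ab: "A \<in> sets borel" by (simp add: null_sets_def)
  then have m: "{s\<in>{0..T}. w s \<in> A} \<in> sets lebesgue"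
  proof -
    have "w -` A \<inter> {0..T} \<in> sets (lebesgue_on {0..T})" using measurable_sets[OF w Ab] by simp
    then have "w -` A \<inter> {0..T} \<in> sets lebesgue" by (simp add: sets_restrict_space_iff)
    also have "w -` A \<inter> {0..T} = {s\<in>{0..T}. w s \<in> A}" by auto
    finally show ?thesis .
  qed
  have "emeasure (occ w t) A = emeasure lebesgue {s\<in>{0..t}. w s \<in> A}"
    by (simp add: emeasure_occ[OF t Ab] occupation_measure_def)
  also have "\<dots> \<le> emeasure lebesgue {s\<in>{0..T}. w s \<in> A}"
    using t m by (intro emeasure_mono) auto
  also have "\<dots> = emeasure (occ w T) A"
    by (simp add: emeasure_occ[OF _ Ab] occupation_measure_def)
  also have "\<dots> = 0" using ac A unfolding absolutely_continuous_def by (blast dest: null_setsD1)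
  finally show "A \<in> null_sets (occ w t)" using Ab by (intro null_setsI) (auto simp: sets_occ)
qed

context
  assumes ac: "absolutely_continuous lborel (occ w T)"
begin

lemma density_local_time:
  assumes t: "t \<le> T"
  shows "density lborel (\<lambda>x. ennreal (local_time w t x)) = occ w t"
proof -
  note act = absolutely_continuous_occ[OF ac t]
  interpret finite_measure "occ w t" by (rule finite_measure_occ[OF t])
  have "AE x in lborel. RN_deriv lborel (occ w t) x \<noteq> \<infinity>"
    using sigma_finite_measure.RN_deriv_finite[OF sigma_finite_lborel _ act] sigma_finite_measure_axioms by (simp add: sets_occ)
  then have "AE x in lborel. ennreal (local_time w t x) = RN_deriv lborel (occ w t) x"
    by eventually_elim (simp add: local_time_def less_top)
  then have "density lborel (\<lambda>x. ennreal (local_time w t x)) = density lborel (RN_deriv lborel (occ w t))"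
    by (intro density_cong) (auto simp: local_time_def)
  also have "\<dots> = occ w t" by (rule sigma_finite_measure.density_RN_deriv[OF sigma_finite_lborel act]) (simp add: sets_occ)
  finally show ?thesis .
qed

lemma local_time_measurable[measurable]: "local_time w t \<in> borel_measurable borel"
  unfolding local_time_def[abs_def] using borel_measurable_RN_deriv[of lborel "occ w t"] by simp

lemma local_time_is_local_time: "is_local_time T w (local_time w)"
  unfolding is_local_time_def
proof (intro ballI conjI allI)
  fix t assume t: "t \<in> {0..T}"
  show "local_time w t \<in> borel_measurable borel" by (rule local_time_measurable)
  show "0 \<le> local_time w t x" for x by (simp add: local_time_def)
  fix A :: "'v set" assume A: "A \<in> sets borel"
  have "occupation_measure w t A = emeasure (density lborel (\<lambda>x. ennreal (local_time w t x))) A"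
    using density_local_time[of t] emeasure_occ[OF _ A] t by simp
  also have "\<dots> = (\<integral>\<^sup>+x\<in>A. ennreal (local_time w t x) \<partial>lborel)"
    using A by (intro emeasure_density) auto
  finally show "occupation_measure w t A = (\<integral>\<^sup>+x\<in>A. ennreal (local_time w t x) \<partial>lborel)" .
qed

lemma local_time_integrable:
  assumes t: "t \<le> T"
  shows "integrable lborel (local_time w t)"
proof (rule integrableI_bounded)
  interpret finite_measure "occ w t" by (rule finite_measure_occ[OF t])
  have "(\<integral>\<^sup>+x. ennreal (norm (local_time w t x)) \<partial>lborel) = emeasure (density lborel (\<lambda>x. ennreal (local_time w t x))) UNIV"
    by (subst emeasure_density) (auto simp: local_time_def)
  also have "\<dots> = emeasure (occ w t) UNIV" by (simp only: density_local_time[OF t])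
  also have "\<dots> < \<infinity>" by (simp add: less_top[symmetric])
  finally show "(\<integral>\<^sup>+x. ennreal (norm (local_time w t x)) \<partial>lborel) < \<infinity>" .
qed measurable

lemma fourier_local_time:
  assumes t: "t \<le> T"
  shows "fourier (local_time w t) \<xi>
    = (CLINT u|lebesgue_on {0..T}. of_real (indicator {0..t} u) * iexp (- (\<xi> \<bullet> w u)))"
proof -
  have "fourier (local_time w t) \<xi> = (CLINT x|lborel. local_time w t x *\<^sub>R iexp (- (\<xi> \<bullet> x)))"
    by (simp add: fourier_def scaleR_conv_of_real mult.commute)
  also have "\<dots> = (CLINT x|density lborel (\<lambda>x. ennreal (local_time w t x)). iexp (- (\<xi> \<bullet> x)))"
    by (rule integral_density[symmetric]) (auto simp: local_time_def)
  finally show ?thesis unfolding density_local_time[OF t] occ_integral[OF t] .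
qed

lemma fourier_local_time_diff:
  assumes "s \<le> T" "t \<le> T"
  shows "fourier (\<lambda>x. local_time w t x - local_time w s x) \<xi> = fourier (local_time w t) \<xi> - fourier (local_time w s) \<xi>"
proof -
  have int: "complex_integrable lborel (\<lambda>x. iexp (- (\<xi> \<bullet> x)) * of_real (local_time w t x))" if "t \<le> T" for t
    by (rule Bochner_Integration.integrable_bound[OF local_time_integrable[OF that]]) (auto simp: norm_mult)
  show ?thesis
    unfolding fourier_def
    by (subst Bochner_Integration.integral_diff[OF int int, symmetric]) (auto simp: assms right_diff_distrib)
qed

end

end

section \<open>Existence and regularity of the local time of z\<close>

context volterra_levy
begin

text \<open>By additivity in time, an increment of the local time has transform
  \<open>occ_hat s t\<close>. The Sobolev norm sees only moduli of transforms, so the case of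
  reversed times follows by a change of sign; t = 0 is separate because the bound is stated for s <
  t.\<close>

lemma local_time_holder:
  assumes \<omega>: "\<omega> \<in> space M" and ac: "absolutely_continuous lborel (occ (\<lambda>t. z t \<omega>) T)"
    and C: "0 < C" "\<forall>s\<in>{0..T}. \<forall>t\<in>{0..T}. s < t \<longrightarrow>
     L2_le lborel (\<lambda>\<xi>. (1 + (norm \<xi>)\<^sup>2) powr \<kappa>) (occ_hat s t \<omega>) (C * (t - s) powr \<gamma>)"
  shows "local_time (\<lambda>t. z t \<omega>) \<in> holder_sobolev T \<gamma> \<kappa>"
proof -
  let ?w = "\<lambda>t. z t \<omega>"
  let ?l = "local_time ?w"
  have w: "?w \<in> borel_measurable N" by (rule z_path_measurable[OF \<omega>])
  have four: "fourier (?l t) \<xi> = occ_hat 0 t \<omega> \<xi>" if "t \<le> T" for t \<xi>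
    unfolding occ_hat_def by (rule fourier_local_time[OF w ac that])
  have diff: "fourier (\<lambda>x. ?l t x - ?l s x) \<xi> = occ_hat s t \<omega> \<xi>" if "0 \<le> s" "s \<le> t" "t \<le> T" for s t \<xi>
    using fourier_local_time_diff[OF w ac, of s t] four[of t] four[of s] occ_hat_add[OF \<omega>, of 0 s t \<xi>] that by simp
  have sob: "sobolev_sq \<kappa> f \<le> ennreal ((C * (t - s) powr \<gamma>)\<^sup>2)"
    if "0 \<le> s" "s < t" "t \<le> T" "\<And>\<xi>. cmod (fourier f \<xi>) = cmod (occ_hat s t \<omega> \<xi>)" for f s t
    using C(2) that unfolding sobolev_sq_def L2_le_def by simp
  have norm_le: "sobolev_norm \<kappa> f \<le> C * \<bar>t - s\<bar> powr \<gamma>"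
    if "0 \<le> s" "s < t" "t \<le> T" "\<And>\<xi>. cmod (fourier f \<xi>) = cmod (occ_hat s t \<omega> \<xi>)" for f s t
  proof -
    have "enn2real (sobolev_sq \<kappa> f) \<le> (C * (t - s) powr \<gamma>)\<^sup>2"
      using sob[OF that] by (rule enn2real_leI[rotated]) simp
    then have "sqrt (enn2real (sobolev_sq \<kappa> f)) \<le> sqrt ((C * (t - s) powr \<gamma>)\<^sup>2)"
      by (rule real_sqrt_le_mono)
    also have "\<dots> = C * (t - s) powr \<gamma>" using C(1) by simp
    finally show ?thesis using that by (simp add: sobolev_norm_def)
  qed
  show ?thesis
    unfolding holder_sobolev_def mem_Collect_eq
  proof (intro conjI ballI exI[of _ C])
    fix t assume t: "t \<in> {0..T}"
    have "sobolev_sq \<kappa> (?l t) < \<infinity>"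
    proof (cases "t = 0")
      case True
      have "occ_hat 0 0 \<omega> \<xi> = 0" for \<xi> by (rule occ_hat_refl[OF \<omega>])
      then show ?thesis using four[of 0] T_pos True by (simp add: sobolev_sq_def)
    next
      case False
      then have "sobolev_sq \<kappa> (?l t) \<le> ennreal ((C * (t - 0) powr \<gamma>)\<^sup>2)"
        using t four by (intro sob) auto
      then show ?thesis by (simp add: le_less_trans[OF _ ennreal_less_top])
    qed
    then show "?l t \<in> sobolev_space \<kappa>"
      using local_time_integrable[OF w ac] t by (simp add: sobolev_space_def)
  next
    fix s t assume st: "s \<in> {0..T}" "t \<in> {0..T}"
    show "sobolev_norm \<kappa> (\<lambda>x. ?l t x - ?l s x) \<le> C * \<bar>t - s\<bar> powr \<gamma>"
    proof (cases s t rule: linorder_cases)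
      case less
      then show ?thesis using st diff by (intro norm_le) auto
    next
      case equal
      then show ?thesis by (simp add: sobolev_norm_def sobolev_sq_def fourier_def)
    next
      case greater
      have "cmod (fourier (\<lambda>x. ?l t x - ?l s x) \<xi>) = cmod (occ_hat t s \<omega> \<xi>)" for \<xi>
      proof -
        have "fourier (\<lambda>x. ?l t x - ?l s x) \<xi> = - fourier (\<lambda>x. ?l s x - ?l t x) \<xi>"
          using st by (simp add: fourier_local_time_diff[OF w ac])
        then show ?thesis using diff[of t s \<xi>] greater st by simp
      qed
      then have "sobolev_norm \<kappa> (\<lambda>x. ?l t x - ?l s x) \<le> C * \<bar>s - t\<bar> powr \<gamma>"
        using greater st by (intro norm_le) auto
      then show ?thesis by (simp add: abs_minus_commute)
    qed
  qed
qed

text \<open>Any \<theta> in (0, 1) below 1 - D / A works, and half of that number is taken. The cap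
  1/2 matters for very negative \<kappa>, where 1 - D / A is large.\<close>

lemma holder_parameter:
  assumes "\<kappa> < \<alpha> / (2 * \<zeta>) - real DIM('v) / 2"
  obtains \<theta> where "0 < \<theta>" "\<theta> < 1" "2 * \<kappa> + real DIM('v) < (1 - \<theta>) * \<alpha> / \<zeta>"
proof -
  define A where "A = \<alpha> / \<zeta>"
  define D where "D = 2 * \<kappa> + real DIM('v)"
  have A: "0 < A" using \<alpha>_pos \<zeta>_pos by (simp add: A_def)
  have D: "D < A" using assms by (simp add: A_def D_def field_simps)
  define \<theta> where "\<theta> = min (1/2) ((1 - D / A) / 2)"
  have "0 < \<theta>" "\<theta> < 1" using A D by (auto simp: \<theta>_def)
  moreover have "D < (1 - \<theta>) * A"
  proof -
    have "\<theta> \<le> (1 - D / A) / 2" unfolding \<theta>_def by (rule min.cobounded2)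
    then have "\<theta> * A \<le> (1 - D / A) / 2 * A" using A by (intro mult_right_mono) auto
    also have "\<dots> = (A - D) / 2" using A by (simp add: field_simps)
    finally show ?thesis using D by (simp add: algebra_simps)
  qed
  ultimately show ?thesis using that[of \<theta>] by (simp add: A_def D_def)
qed

text \<open>The bound on \<zeta> says exactly that \<kappa> = 0 is admissible. Only the increment
  over [0, T] is used, so the convenient exponent 1/2 suffices.\<close>

lemma AE_absolutely_continuous:
  assumes "\<zeta> < \<alpha> / real DIM('v)"
  shows "AE \<omega> in M. absolutely_continuous lborel (occ (\<lambda>t. z t \<omega>) T)"
proof -
  have "0 < \<alpha> / (2 * \<zeta>) - real DIM('v) / 2"
    using assms \<zeta>_pos by (simp add: field_simps)
  then obtain \<theta> where \<theta>: "0 < \<theta>" "\<theta> < 1" "2 * 0 + real DIM('v) < (1 - \<theta>) * \<alpha> / \<zeta>"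
    by (rule holder_parameter)
  have "AE \<omega> in M. \<exists>C>0. \<forall>s\<in>{0..T}. \<forall>t\<in>{0..T}. s < t \<longrightarrow>
     L2_le lborel (\<lambda>\<xi>. (1 + (norm \<xi>)\<^sup>2) powr 0) (occ_hat s t \<omega>) (C * (t - s) powr (1 / 2))"
    using \<theta> by (intro occ_hat_holder) auto
  then show ?thesis
    using AE_space
  proof eventually_elim
    case (elim \<omega>)
    then obtain C where C: "L2_le lborel (\<lambda>\<xi>. (1 + (norm \<xi>)\<^sup>2) powr 0) (occ_hat 0 T \<omega>) (C * (T - 0) powr (1 / 2))"
      using T_pos by fastforce
    have w: "(\<lambda>t. z t \<omega>) \<in> borel_measurable N" by (rule z_path_measurable[OF elim(2)])
    have J: "(1 + (norm \<xi>)\<^sup>2) powr 0 = 1" for \<xi> :: 'v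
      using add_pos_nonneg[of 1 "(norm \<xi>)\<^sup>2"] by simp
    show ?case
    proof (rule absolutely_continuous_if_fourier_L2)
      show "finite_measure (occ (\<lambda>t. z t \<omega>) T)" by (rule finite_measure_occ[OF w order_refl])
      show "(\<integral>\<^sup>+\<xi>. ennreal ((cmod (CLINT x|occ (\<lambda>t. z t \<omega>) T. iexp (- (\<xi> \<bullet> x))))\<^sup>2) \<partial>lborel) < \<infinity>"
        using C unfolding occ_integral[OF w order_refl] occ_hat_def[symmetric] L2_le_def J
        by (simp add: le_less_trans[OF _ ennreal_less_top])
    qed (simp add: sets_occ)
  qed
qed

end

theorem theorem1:
  fixes T \<alpha> \<zeta> :: real
    and M :: "'w measure" and F :: "real \<Rightarrow> 'w measure"
    and X z :: "real \<Rightarrow> 'w \<Rightarrow> real ^ 'd"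
    and \<psi> :: "real ^ 'd \<Rightarrow> complex"
    and k :: "real \<Rightarrow> real \<Rightarrow> real"
  assumes "0 < T"
    and "levy_process T M F X"
    and "levy_characteristic T M X \<psi>"
    and "0 < \<alpha>" and "\<alpha> \<le> 2"
    and "volterra_levy_process T M \<alpha> X k z"
    and "continuous_in_prob T M z"
    and "0 < \<zeta>"
    and "nondeterminism_const T \<alpha> \<zeta> \<psi> k > 0"
    and "\<zeta> < \<alpha> / real CARD('d)"
  shows "\<exists>L :: 'w \<Rightarrow> real \<Rightarrow> real ^ 'd \<Rightarrow> real.
           (\<forall>\<omega> t x. 0 \<le> L \<omega> t x) \<and>
           (AE \<omega> in M. is_local_time T (\<lambda>t. z t \<omega>) (L \<omega>)) \<and>
           (\<forall>\<kappa> < \<alpha> / (2 * \<zeta>) - real CARD('d) / 2.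
              \<exists>\<gamma>. 1/2 < \<gamma> \<and> \<gamma> < 1 \<and> (AE \<omega> in M. L \<omega> \<in> holder_sobolev T \<gamma> \<kappa>))"
proof -
  interpret volterra_levy T M F X \<psi> \<alpha> \<zeta> k z
    by unfold_locales (use assms in auto)
  have dim: "DIM(real ^ 'd) = CARD('d)" by simp
  have ac: "AE \<omega> in M. absolutely_continuous lborel (occ (\<lambda>t. z t \<omega>) T)"
    using assms(10) by (intro AE_absolutely_continuous) simp
  show ?thesis
  \<comment> \<open>The witness depends neither on \<kappa> nor on \<gamma>, so one local time
    serves all exponents; only the exceptional null sets may vary with them.\<close>
  proof (intro exI[of _ "\<lambda>\<omega>. local_time (\<lambda>t. z t \<omega>)"] conjI allI impI)
    show "0 \<le> local_time (\<lambda>t. z t \<omega>) t x" for \<omega> t x by (simp add: local_time_def)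
    show "AE \<omega> in M. is_local_time T (\<lambda>t. z t \<omega>) (local_time (\<lambda>t. z t \<omega>))"
      using ac AE_space
      by eventually_elim (intro local_time_is_local_time z_path_measurable)
    fix \<kappa> assume "\<kappa> < \<alpha> / (2 * \<zeta>) - real CARD('d) / 2"
    then obtain \<theta> where \<theta>: "0 < \<theta>" "\<theta> < 1" "2 * \<kappa> + real DIM(real ^ 'd) < (1 - \<theta>) * \<alpha> / \<zeta>"
      unfolding dim[symmetric] by (rule holder_parameter)
    \<comment> \<open>Halfway between 1/2 and the critical exponent (1 + \<theta>) / 2, which is
      itself below 1.\<close>
    define \<gamma> where "\<gamma> = 1 / 2 + \<theta> / 4"
    have \<gamma>: "1 / 2 < \<gamma>" "\<gamma> < 1" "0 < \<gamma>" "2 * \<gamma> < 1 + \<theta>" using \<theta> by (auto simp: \<gamma>_def)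
    have "AE \<omega> in M. local_time (\<lambda>t. z t \<omega>) \<in> holder_sobolev T \<gamma> \<kappa>"
      using occ_hat_holder[OF \<theta> \<gamma>(3,4)] ac AE_space
    proof eventually_elim
      case (elim \<omega>)
      then show ?case using local_time_holder[OF elim(3,2)] by blast
    qed
    with \<gamma> show "\<exists>\<gamma>. 1/2 < \<gamma> \<and> \<gamma> < 1 \<and> (AE \<omega> in M. local_time (\<lambda>t. z t \<omega>) \<in> holder_sobolev T \<gamma> \<kappa>)"
      by blast
  qed
qed

end
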